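(* Let $J\ge1$, $\theta>0$, $\alpha\in(0,1)$, $\tau>0$, and let $P\sim\mathrm{NGGP}(\theta,G_0,\alpha,\tau)$, i.e. $P\sim\mathrm{NRM}(\theta,G_0,\rho)$ with $\rho(x)=\Gamma(1-\alpha)^{-1}x^{-1-\alpha}e^{-\tau x}$. Let $V_j$ be a random variable with density on $(0,1)$ $$f_{V_j}(v)=\frac{\theta}{J}\,v\int_0^{+\infty}t\,\rho(tv)\,f_{T_j}(t(1-v))\,\mathrm dt,$$ where $f_{T_j}$ is the density of the total mass of a completely random measure with jump intensity $(\theta/J)\rho(x)\,\mathrm dx$. Then $V_j$ is equal in distribution to $$V_{\theta,\alpha,\tau}:=B_{1-\alpha,\alpha}\left(1-\left(\frac{\frac{\theta\tau^\alpha}{J\alpha}}{\frac{\theta\tau^\alpha}{J\alpha}+E}\right)^{1/\alpha}\right),$$ where $B_{1-\alpha,\alpha}$ is a Beta random variable with parameter $(1-\alpha,\alpha)$ and $E$ is an independent exponential random variable with parameter $1$. Consequently, for $j\in[J]$ and a bucket count $c_j$, the smoothed estimator $\hat f^{(\mathrm{NGGP})}_{X_{n+1}}:=\mathbb E_{P\sim\mathrm{NGGP},\,h\sim\mathscr H_J}\big[c_j\sum_{s\in\mathbb S_j}(p_s/q_j)^2\big]$ (expectation with $c_j$ held fixed) equals $$\hat f^{(\mathrm{NGGP})}_{X_{n+1}}=c_j\,\mathbb E[V_j]=c_j(1-\alpha)\left(1-\frac{\theta\tau^\alpha}{J\alpha}\,e^{\frac{\theta\tau^\alpha}{J\alpha}}\,E_{1/\alpha}\!\left(\frac{\theta\tau^\alpha}{J\alpha}\right)\right),$$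 where $E_a(z):=\int_1^{+\infty}x^{-a}e^{-zx}\,\mathrm dx$ is the exponential integral function.
   Context: Hashing: $[J]=\{1,\dots,J\}$; $\mathscr H_J$ is a strongly universal (pairwise independent) hash family, i.e. a distribution over functions $h:\mathbb S\to[J]$ with $\Pr[h(x_1)=j_1,h(x_2)=j_2]=J^{-2}$ for all $j_1,j_2\in[J]$ and all fixed $x_1\ne x_2$ in $\mathbb S$; $h$ is independent of $P$ and of the data. For a discrete distribution $P=\sum_s p_s\delta_s$ write $\mathbb S_j=\{s\in\mathbb S:h(s)=j\}$ and $q_j=\sum_{s\in\mathbb S_j}p_s$, sums over $s$ running over the atoms of $P$. Normalized random measures: let $\theta>0$, $G_0$ a non-atomic probability measure on $\mathbb S$, and $\rho$ a nonnegative function on $\mathbb R_+$ with $\int_{\mathbb R_+}\rho(x)\mathrm dx=+\infty$ and $\int_{\mathbb R_+}(1-e^{-ux})\rho(x)\mathrm dx<+\infty$ for all $u>0$. Let $\tilde\mu=\sum_{k\ge1}J_k\delta_{S_k}$ be the purely atomic completely random measure on $\mathbb S$ with Lévy intensity $\nu(\mathrm dx,\mathrm ds)=\theta G_0(\mathrm ds)\rho(x)\mathrm dx$, i.e. $\{(J_k,S_k)\}$ are the points of a Poisson process on $\mathbb R_+\times\mathbb S$ with intensity $\nu$; its total mass $T=\tilde\mu(\mathbb S)$ is a.s. positive and finite. Then $P\sim\mathrm{NRM}(\theta,G_0,\rho)$ means $P=\tilde\mu/T$.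
   Formalization: The hash family is also assumed to have finite-dimensional laws that depend measurably on the symbols, and the expectation over P and h is read as the mean over P of the mean over h with P fixed; without this the expectation need not be defined. *)

theory Defs
  imports "HOL-Probability.Probability"
begin

section \<open>Poisson processes and completely random measures\<close>

text \<open>
  A process with infinitely many points is given by an enumeration \<open>X 0, X 1, \<dots>\<close> of its points
  by random variables. No particular enumeration (for instance by decreasing jump) is prescribed.
\<close>

definition point_count :: "(nat \<Rightarrow> 'w \<Rightarrow> 'b) \<Rightarrow> 'b set \<Rightarrow> 'w \<Rightarrow> ennreal" where
  "point_count X A \<omega> = emeasure (count_space UNIV) {k. X k \<omega> \<in> A}"

definition poisson_points :: "'w measure \<Rightarrow> 'b measure \<Rightarrow> (nat \<Rightarrow> 'w \<Rightarrow> 'b) \<Rightarrow> bool" where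
  "poisson_points M \<nu> X \<longleftrightarrow>
     prob_space M \<and>
     (\<forall>k. X k \<in> measurable M \<nu>) \<and>
     (\<forall>A\<in>sets \<nu>. emeasure \<nu> A < \<infinity> \<longrightarrow>
        (\<forall>n::nat. measure M {\<omega>\<in>space M. point_count X A \<omega> = of_nat n} =
           measure \<nu> A ^ n / fact n * exp (- measure \<nu> A))) \<and>
     (\<forall>(A :: nat \<Rightarrow> 'b set) m. (\<forall>i<m. A i \<in> sets \<nu>) \<longrightarrow> disjoint_family_on A {..<m} \<longrightarrow>
        prob_space.indep_vars M (\<lambda>_. borel) (\<lambda>i. point_count X (A i)) {..<m})"

text \<open>The Levy intensity \<open>\<theta> G0(ds) \<rho>(x) dx\<close>, carried by the jumps \<open>x > 0\<close>.\<close>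

definition levy_intensity :: "real \<Rightarrow> 'a measure \<Rightarrow> (real \<Rightarrow> real) \<Rightarrow> (real \<times> 'a) measure" where
  "levy_intensity \<theta> G0 \<rho> =
     density lborel (\<lambda>x. ennreal (\<theta> * \<rho> x) * indicator {0<..} x) \<Otimes>\<^sub>M G0"

text \<open>
  \<open>\<Sum>\<^sub>k J\<^sub>k \<delta>(S\<^sub>k)\<close> for \<open>X k \<omega> = (J\<^sub>k, S\<^sub>k)\<close>: the image, under \<open>k \<mapsto> S\<^sub>k\<close>, of the measure
  on the indices that gives \<open>k\<close> the mass \<open>J\<^sub>k\<close>.
\<close>

definition jump_measure :: "(nat \<Rightarrow> 'w \<Rightarrow> real \<times> 'a::topological_space) \<Rightarrow> 'w \<Rightarrow> 'a measure" where
  "jump_measure X \<omega> =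
     distr (density (count_space UNIV) (\<lambda>k. ennreal (fst (X k \<omega>)))) borel (\<lambda>k. snd (X k \<omega>))"

definition is_CRM ::
  "'w measure \<Rightarrow> real \<Rightarrow> 'a::topological_space measure \<Rightarrow> (real \<Rightarrow> real) \<Rightarrow> ('w \<Rightarrow> 'a measure) \<Rightarrow> bool"
where
  "is_CRM M \<theta> G0 \<rho> \<mu> \<longleftrightarrow>
     (\<exists>X. poisson_points M (levy_intensity \<theta> G0 \<rho>) X \<and> (\<forall>\<omega>\<in>space M. \<mu> \<omega> = jump_measure X \<omega>))"

definition total_mass :: "('w \<Rightarrow> 'a measure) \<Rightarrow> 'w \<Rightarrow> ennreal" where
  "total_mass \<mu> \<omega> = emeasure (\<mu> \<omega>) (space (\<mu> \<omega>))"


section \<open>Normalized random measures\<close>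

definition nrm_jump_density :: "(real \<Rightarrow> real) \<Rightarrow> bool" where
  "nrm_jump_density \<rho> \<longleftrightarrow>
     \<rho> \<in> borel_measurable borel \<and> (\<forall>x>0. 0 \<le> \<rho> x) \<and>
     (\<integral>\<^sup>+x\<in>{0<..}. ennreal (\<rho> x) \<partial>lborel) = \<infinity> \<and>
     (\<forall>u>0. (\<integral>\<^sup>+x\<in>{0<..}. ennreal ((1 - exp (- u * x)) * \<rho> x) \<partial>lborel) < \<infinity>)"

text \<open>
  On the null event where the total mass is \<open>0\<close> or \<open>\<infinity>\<close>, the \<^typ>\<open>ennreal\<close> conventions make the
  normalized measure purely conventional.
\<close>

definition NRM ::
  "'w measure \<Rightarrow> real \<Rightarrow> 'a::topological_space measure \<Rightarrow> (real \<Rightarrow> real) \<Rightarrow> ('w \<Rightarrow> 'a measure) \<Rightarrow> bool"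
where
  "NRM M \<theta> G0 \<rho> P \<longleftrightarrow>
     nrm_jump_density \<rho> \<and>
     (\<exists>\<mu>. is_CRM M \<theta> G0 \<rho> \<mu> \<and>
        (\<forall>\<omega>\<in>space M. P \<omega> = scale_measure (inverse (total_mass \<mu> \<omega>)) (\<mu> \<omega>)))"

definition nggp_jump_density :: "real \<Rightarrow> real \<Rightarrow> real \<Rightarrow> real" where
  "nggp_jump_density \<alpha> \<tau> x = inverse (Gamma (1 - \<alpha>)) * x powr (- 1 - \<alpha>) * exp (- \<tau> * x)"

definition NGGP ::
  "'w measure \<Rightarrow> real \<Rightarrow> 'a::topological_space measure \<Rightarrow> real \<Rightarrow> real \<Rightarrow> ('w \<Rightarrow> 'a measure) \<Rightarrow> bool"
where
  "NGGP M \<theta> G0 \<alpha> \<tau> P \<longleftrightarrow> NRM M \<theta> G0 (nggp_jump_density \<alpha> \<tau>) P"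


section \<open>Hashing\<close>

definition strongly_universal :: "nat \<Rightarrow> ('a \<Rightarrow> nat) measure \<Rightarrow> bool" where
  "strongly_universal J H \<longleftrightarrow>
     prob_space H \<and>
     (\<forall>h\<in>space H. \<forall>x. h x \<in> {1..J}) \<and>
     (\<forall>x. (\<lambda>h. h x) \<in> measurable H (count_space UNIV)) \<and>
     (\<forall>x1 x2. x1 \<noteq> x2 \<longrightarrow> (\<forall>j1\<in>{1..J}. \<forall>j2\<in>{1..J}.
        measure H {h\<in>space H. h x1 = j1 \<and> h x2 = j2} = 1 / (real J)\<^sup>2))"

text \<open>
  The joint law of the hash values of finitely many symbols depends measurably on the symbols.
  This regularity is what makes hashing the random atoms of \<open>P\<close> meaningful. Joint measurability of
  \<open>(h, x) \<mapsto> h x\<close> must not be asked for: by Fubini it contradicts pairwise independence as soon as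
  \<open>J \<ge> 2\<close> and the symbols carry a non-atomic law.
\<close>

definition measurable_hash_laws :: "('a::topological_space \<Rightarrow> nat) measure \<Rightarrow> bool" where
  "measurable_hash_laws H \<longleftrightarrow>
     (\<forall>(n::nat) (l :: nat \<Rightarrow> nat).
        (\<lambda>x. measure H {h\<in>space H. \<forall>i<n. h (x i) = l i})
          \<in> borel_measurable (Pi\<^sub>M {..<n} (\<lambda>_. borel)))"

definition bucket_atoms :: "'a measure \<Rightarrow> ('a \<Rightarrow> nat) \<Rightarrow> nat \<Rightarrow> 'a set" where
  "bucket_atoms P h j = {s. 0 < measure P {s} \<and> h s = j}"

definition bucket_mass :: "'a measure \<Rightarrow> ('a \<Rightarrow> nat) \<Rightarrow> nat \<Rightarrow> real" where
  "bucket_mass P h j = (\<Sum>\<^sub>\<infinity>s\<in>bucket_atoms P h j. measure P {s})"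

text \<open>
  Since \<open>h\<close> is independent of \<open>P\<close>, the expectation over both is the mean over \<open>P\<close> of the mean over
  \<open>h\<close> with \<open>P\<close> held fixed. It is written as an iterated integral because the integrand is in general
  not measurable for the product of the two \<open>\<sigma>\<close>-algebras (see the remark on joint measurability).
\<close>

definition smoothed_estimator ::
  "'w measure \<Rightarrow> ('w \<Rightarrow> 'a measure) \<Rightarrow> ('a \<Rightarrow> nat) measure \<Rightarrow> nat \<Rightarrow> nat \<Rightarrow> real"
where
  "smoothed_estimator M P H c j =
     (\<integral>\<omega>. (\<integral>h. real c * (\<Sum>\<^sub>\<infinity>s\<in>bucket_atoms (P \<omega>) h j.
        (measure (P \<omega>) {s} / bucket_mass (P \<omega>) h j)\<^sup>2) \<partial>H) \<partial>M)"


section \<open>The laws in the statement\<close>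

text \<open>The density of \<open>V\<^sub>j\<close>; \<open>fT\<close> is the density of the total mass \<open>T\<^sub>j\<close>.\<close>

definition V_density :: "real \<Rightarrow> nat \<Rightarrow> (real \<Rightarrow> real) \<Rightarrow> (real \<Rightarrow> ennreal) \<Rightarrow> real \<Rightarrow> ennreal" where
  "V_density \<theta> J \<rho> fT v =
     (ennreal (\<theta> / real J * v) *
       (\<integral>\<^sup>+t\<in>{0<..}. ennreal (t * \<rho> (t * v)) * fT (t * (1 - v)) \<partial>lborel)) * indicator {0<..<1} v"

definition beta_density :: "real \<Rightarrow> real \<Rightarrow> real \<Rightarrow> real" where
  "beta_density a b x = x powr (a - 1) * (1 - x) powr (b - 1) / Beta a b * indicator {0<..<1} x"

definition exp_integral :: "real \<Rightarrow> real \<Rightarrow> real" where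
  "exp_integral a z = (LINT x:{1..}|lborel. x powr (- a) * exp (- z * x))"

end

theory Submission
  imports Defs
begin

text \<open>
  Both laws of \<open>V\<close> live on the unit interval, so it suffices to compare moments. Writing
  \<open>1 / (x + t) ^ (m + 1)\<close> as a Laplace integral turns the \<open>m\<close>-th moment of \<open>V\<close> into an integral over
  \<open>u\<close> of \<open>u ^ m\<close>, a Gamma integral of the jump density and the Laplace transform of \<open>T\<^sub>j\<close>; the
  substitution of the Laplace exponent for \<open>u\<close> identifies it with the product of the moments of the
  two factors.

  For the estimator, pairwise independence is enough because the atoms are diffuse. For any event the
  centred indicators of \<open>h y = l\<close> are orthogonal, so by Bessel's inequality the event is correlated
  with \<open>h y = l\<close> for at most countably many \<open>y\<close>; hence the hash values of almost all \<open>n\<close>-tuples are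
  iid uniform. Tuples of distinct Poisson points avoid null sets (boxes with disjoint sides), so almost
  surely the hash values of the atoms are iid. With \<open>q\<close> the mass and \<open>r\<close> the sum of squared jumps of
  the bucket, \<open>r / q\<^sup>2\<close> is the integral of \<open>u r exp (- u q)\<close> over \<open>u\<close>, and the mean of \<open>r exp (- u q)\<close>
  is a derivative of the Laplace functional of the thinned process. The result is the integral for
  the first moment of \<open>V\<close>.
\<close>

section \<open>Gamma integrals and the jump density\<close>

text \<open>Without joint measurability of hashing, the points of one bucket cannot be handled as a
  Poisson process of their own by a marking theorem. Instead \<omega> is fixed and the mean over
  \<open>h\<close> comes first: a point with exponent g then contributes the averaged factor 1 - (1
  - exp (- g)) / J, and the Laplace functional of the full process turns these factors into an
  exponent with \<theta> / J in place of \<theta>. This is how the rate of \<open>T\<^sub>j\<close>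
  enters the estimator. The same obstacle shapes the differentiation: Fubini over (u, \<omega>) is
  possible only for integrands that do not mention \<open>h\<close>, so the derivative is a supremum
  of difference quotients of functions of u and \<omega> alone. An arbitrary enumeration gives no
  usable law for the first n points; only null sets can be transferred to them. The density of
  \<open>T\<^sub>j\<close> is never computed, and the estimator is matched with the mean of V at the
  level of integrals, before any closed form. Integrals are mostly taken in \<open>ennreal\<close>,
  where Tonelli and monotone convergence apply freely; \<open>enn2real\<close> returns to the reals
  once finiteness is known.\<close>

lemma nn_integral_powr_times_exp:
  fixes a s :: real
  assumes a: "0 < a" and s: "0 < s"
  shows "(\<integral>\<^sup>+x\<in>{0<..}. ennreal (x powr (a - 1) * exp (- s * x)) \<partial>lborel) =
    ennreal (Gamma a * s powr (- a))"
proof -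
  have "ennreal (Gamma a) =
    (\<integral>\<^sup>+t. ennreal (indicator {0..} t * (t powr (a - 1) / exp t)) \<partial>lborel)"
    using nn_integral_has_integral_lebesgue[OF _ Gamma_integral_real[OF a]] by simp
  also have "\<dots> = (\<integral>\<^sup>+t\<in>{0<..}. ennreal (t powr (a - 1) * exp (- t)) \<partial>lborel)"
  proof (rule nn_integral_cong_AE)
    show "AE t in lborel. ennreal (indicator {0..} t * (t powr (a - 1) / exp t)) =
      ennreal (t powr (a - 1) * exp (- t)) * indicator {0<..} t"
      using AE_lborel_singleton[of "0::real"]
      by eventually_elim (auto simp: indicator_def exp_minus field_simps)
  qed
  also have "\<dots> = ennreal s * (\<integral>\<^sup>+x. ennreal ((s * x) powr (a - 1) * exp (- (s * x))) *
      indicator {0<..} (s * x) \<partial>lborel)"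
    using s by (subst nn_integral_real_affine[where c = s and t = 0]) auto
  also have "\<dots> = (\<integral>\<^sup>+x. ennreal (s powr a) * (ennreal (x powr (a - 1) * exp (- s * x)) *
      indicator {0<..} x) \<partial>lborel)"
    using s by (subst nn_integral_cmult[symmetric])
      (auto intro!: nn_integral_cong simp: indicator_def powr_mult powr_diff ennreal_mult'[symmetric]
        zero_less_mult_iff field_simps)
  also have "\<dots> = ennreal (s powr a) *
      (\<integral>\<^sup>+x\<in>{0<..}. ennreal (x powr (a - 1) * exp (- s * x)) \<partial>lborel)"
    by (subst nn_integral_cmult) auto
  finally have "ennreal (s powr (- a)) * ennreal (Gamma a) =
    ennreal (s powr (- a)) * (ennreal (s powr a) *
      (\<integral>\<^sup>+x\<in>{0<..}. ennreal (x powr (a - 1) * exp (- s * x)) \<partial>lborel))"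
    by simp
  moreover have "ennreal (s powr (- a)) * ennreal (s powr a) = 1"
    using s by (simp add: ennreal_mult'[symmetric] powr_add[symmetric])
  ultimately have "(\<integral>\<^sup>+x\<in>{0<..}. ennreal (x powr (a - 1) * exp (- s * x)) \<partial>lborel) =
    ennreal (s powr (- a)) * ennreal (Gamma a)"
    by (simp only: mult.assoc[symmetric]) simp
  then show ?thesis
    using a by (simp add: ennreal_mult'' mult.commute Gamma_real_pos less_imp_le)
qed

text \<open>A negative power of a sum becomes an integral of exponentials, which split into factors.
  General \<open>m\<close> serves a jump plus the remaining mass; \<open>m = 1\<close> serves the
  squared bucket mass in the denominator of the estimator.\<close>

lemma nn_integral_power_times_exp_scaled:
  fixes s :: real
  assumes s: "0 < s"
  shows "(\<integral>\<^sup>+u\<in>{0<..}. ennreal (u ^ m / fact m * exp (- s * u)) \<partial>lborel) =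
    ennreal (1 / s ^ (m + 1))"
proof -
  have "(\<integral>\<^sup>+u\<in>{0<..}. ennreal (u ^ m / fact m * exp (- s * u)) \<partial>lborel) =
    (\<integral>\<^sup>+u. ennreal (1 / fact m) * (ennreal (u powr (real (m + 1) - 1) * exp (- s * u)) *
      indicator {0<..} u) \<partial>lborel)"
    by (intro nn_integral_cong)
      (auto simp: indicator_def ennreal_mult'[symmetric] powr_realpow)
  also have "\<dots> = ennreal (1 / fact m) * ennreal (Gamma (real (m + 1)) * s powr (- real (m + 1)))"
    using s nn_integral_powr_times_exp[of "real (m + 1)" s] by (subst nn_integral_cmult) auto
  also have "s powr (- real (m + 1)) = 1 / s ^ (m + 1)"
    using s by (simp only: powr_minus powr_realpow inverse_eq_divide)
  also have "ennreal (1 / fact m) * ennreal (Gamma (real (m + 1)) * (1 / s ^ (m + 1))) =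
      ennreal (1 / s ^ (m + 1))"
    using s Gamma_fact[of m, where 'a = real]
    by (simp add: ennreal_mult'[symmetric] add.commute)
  finally show ?thesis .
qed

lemma nggp_jump_density_measurable [measurable]: "nggp_jump_density \<alpha> \<tau> \<in> borel_measurable borel"
  unfolding nggp_jump_density_def[abs_def] by measurable

lemma nggp_jump_density_nonneg: "\<alpha> < 1 \<Longrightarrow> 0 \<le> nggp_jump_density \<alpha> \<tau> x"
  using Gamma_real_pos[of "1 - \<alpha>"] by (auto simp: nggp_jump_density_def)

text \<open>Exponential tilting by u only shifts \<tau> to \<tau> + u, and the m + 1 powers of x
  outweigh the singularity of the density at 0: what remains is a Gamma integral of shape m + 1 -
  \<alpha> > 0.\<close>

lemma nggp_moment:
  assumes \<alpha>: "0 < \<alpha>" "\<alpha> < 1" and s: "0 < \<tau> + u"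
  shows "(\<integral>\<^sup>+x\<in>{0<..}. ennreal (x ^ (m + 1) * exp (- u * x) * nggp_jump_density \<alpha> \<tau> x) \<partial>lborel) =
    ennreal (Gamma (real m + 1 - \<alpha>) / Gamma (1 - \<alpha>) * (\<tau> + u) powr (\<alpha> - real m - 1))"
proof -
  have G: "0 < Gamma (1 - \<alpha>)"
    using \<alpha> by (intro Gamma_real_pos) auto
  have "(\<integral>\<^sup>+x\<in>{0<..}. ennreal (x ^ (m + 1) * exp (- u * x) * nggp_jump_density \<alpha> \<tau> x) \<partial>lborel) =
    (\<integral>\<^sup>+x. ennreal (1 / Gamma (1 - \<alpha>)) * (ennreal (x powr ((real m + 1 - \<alpha>) - 1) *
      exp (- (\<tau> + u) * x)) * indicator {0<..} x) \<partial>lborel)"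
  proof (intro nn_integral_cong)
    fix x :: real
    have "x ^ (m + 1) * x powr (- 1 - \<alpha>) = x powr (real m - \<alpha>)" if "0 < x"
      using that by (simp add: powr_realpow[symmetric] powr_add[symmetric] flip: power_Suc)
    moreover have "exp (- u * x) * exp (- \<tau> * x) = exp (- (\<tau> + u) * x)"
      by (simp add: exp_add[symmetric] algebra_simps)
    ultimately have "x ^ (m + 1) * exp (- u * x) * nggp_jump_density \<alpha> \<tau> x =
      1 / Gamma (1 - \<alpha>) * (x powr (real m - \<alpha>) * exp (- (\<tau> + u) * x))" if "0 < x"
      using that unfolding nggp_jump_density_def
      by (simp add: divide_inverse) (metis (no_types, opaque_lifting) mult.assoc mult.commute mult.left_commute)
    then show "ennreal (x ^ (m + 1) * exp (- u * x) * nggp_jump_density \<alpha> \<tau> x) * indicator {0<..} x =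
      ennreal (1 / Gamma (1 - \<alpha>)) * (ennreal (x powr ((real m + 1 - \<alpha>) - 1) *
        exp (- (\<tau> + u) * x)) * indicator {0<..} x)"
      using G by (auto simp: indicator_def ennreal_mult'[symmetric])
  qed
  also have "\<dots> = ennreal (1 / Gamma (1 - \<alpha>)) *
      ennreal (Gamma (real m + 1 - \<alpha>) * (\<tau> + u) powr (- (real m + 1 - \<alpha>)))"
    using \<alpha> s by (subst nn_integral_cmult) (simp_all only: nn_integral_powr_times_exp, auto)
  also have "\<dots> = ennreal (Gamma (real m + 1 - \<alpha>) / Gamma (1 - \<alpha>) * (\<tau> + u) powr (\<alpha> - real m - 1))"
    using G by (simp add: ennreal_mult'[symmetric] algebra_simps)
  finally show ?thesis .
qed

lemma one_minus_exp_eq_nn_integral: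
  fixes u x :: real
  assumes "0 \<le> u" "0 \<le> x"
  shows "ennreal (1 - exp (- u * x)) = (\<integral>\<^sup>+w\<in>{0..u}. ennreal (x * exp (- w * x)) \<partial>lborel)"
proof -
  have "(\<integral>\<^sup>+w\<in>{0..u}. ennreal (x * exp (- w * x)) \<partial>lborel) = ennreal (- exp (- u * x) - - exp (- 0 * x))"
    using assms by (intro nn_integral_FTC_Icc) (auto intro!: derivative_eq_intros)
  then show ?thesis
    by simp
qed

text \<open>Splitting 1 - exp (- u * x) would produce two divergent integrals, since the density is
  not integrable at 0. Written as an integral over w in [0, u], it reduces to the tilted first
  moment, that is \<open>nggp_moment\<close> with m = 0.\<close>

lemma nggp_laplace_exponent:
  assumes \<alpha>: "0 < \<alpha>" "\<alpha> < 1" and \<tau>: "0 < \<tau>" and u: "0 \<le> u"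
  shows "(\<integral>\<^sup>+x\<in>{0<..}. ennreal ((1 - exp (- u * x)) * nggp_jump_density \<alpha> \<tau> x) \<partial>lborel) =
    ennreal (((\<tau> + u) powr \<alpha> - \<tau> powr \<alpha>) / \<alpha>)"
proof -
  have "(\<integral>\<^sup>+x\<in>{0<..}. ennreal ((1 - exp (- u * x)) * nggp_jump_density \<alpha> \<tau> x) \<partial>lborel) =
    (\<integral>\<^sup>+x. \<integral>\<^sup>+w. ennreal (x ^ (0 + 1) * exp (- w * x) * nggp_jump_density \<alpha> \<tau> x) *
      indicator {0<..} x * indicator {0..u} w \<partial>lborel \<partial>lborel)"
  proof (intro nn_integral_cong)
    fix x :: real
    show "ennreal ((1 - exp (- u * x)) * nggp_jump_density \<alpha> \<tau> x) * indicator {0<..} x =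
      (\<integral>\<^sup>+w. ennreal (x ^ (0 + 1) * exp (- w * x) * nggp_jump_density \<alpha> \<tau> x) *
        indicator {0<..} x * indicator {0..u} w \<partial>lborel)"
    proof (cases "0 < x")
      case True
      have "ennreal ((1 - exp (- u * x)) * nggp_jump_density \<alpha> \<tau> x) =
        ennreal (1 - exp (- u * x)) * ennreal (nggp_jump_density \<alpha> \<tau> x)"
        by (rule ennreal_mult'') (rule nggp_jump_density_nonneg[OF \<alpha>(2)])
      also have "\<dots> = (\<integral>\<^sup>+w. ennreal (x * exp (- w * x)) * indicator {0..u} w *
          ennreal (nggp_jump_density \<alpha> \<tau> x) \<partial>lborel)"
        using True u by (subst one_minus_exp_eq_nn_integral) (auto intro!: nn_integral_multc[symmetric])
      also have "\<dots> = (\<integral>\<^sup>+w. ennreal (x ^ (0 + 1) * exp (- w * x) * nggp_jump_density \<alpha> \<tau> x) *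
          indicator {0..u} w \<partial>lborel)"
        by (intro nn_integral_cong)
          (auto simp: indicator_def ennreal_mult''[OF nggp_jump_density_nonneg[OF \<alpha>(2)]])
      finally show ?thesis
        using True by simp
    qed auto
  qed
  also have "\<dots> = (\<integral>\<^sup>+w. \<integral>\<^sup>+x. ennreal (x ^ (0 + 1) * exp (- w * x) * nggp_jump_density \<alpha> \<tau> x) *
      indicator {0<..} x * indicator {0..u} w \<partial>lborel \<partial>lborel)"
    by (rule lborel_pair.Fubini') measurable
  also have "\<dots> = (\<integral>\<^sup>+w. ennreal ((\<tau> + w) powr (\<alpha> - 1)) * indicator {0..u} w \<partial>lborel)"
  proof (intro nn_integral_cong)
    fix w :: real
    have "Gamma (1 - \<alpha>) \<noteq> 0"
      using Gamma_real_pos[of "1 - \<alpha>"] \<alpha> by fastforce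
    then show "(\<integral>\<^sup>+x. ennreal (x ^ (0 + 1) * exp (- w * x) * nggp_jump_density \<alpha> \<tau> x) *
      indicator {0<..} x * indicator {0..u} w \<partial>lborel) =
      ennreal ((\<tau> + w) powr (\<alpha> - 1)) * indicator {0..u} w"
      using nggp_moment[OF \<alpha>, of \<tau> w 0] \<tau> by (auto simp: indicator_def)
  qed
  also have "\<dots> = ennreal ((\<tau> + u) powr \<alpha> / \<alpha> - (\<tau> + 0) powr \<alpha> / \<alpha>)"
    using \<alpha> \<tau> u by (intro nn_integral_FTC_Icc) (auto intro!: derivative_eq_intros)
  finally show ?thesis
    by (simp add: diff_divide_distrib)
qed


section \<open>The Laplace functional of a Poisson process\<close>

locale poisson_process = prob_space M for M :: "'w measure" +
  fixes \<nu> :: "'b measure" and X :: "nat \<Rightarrow> 'w \<Rightarrow> 'b"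
  assumes X_measurable [measurable]: "\<And>k. X k \<in> measurable M \<nu>"
    and count_law: "\<And>A n. A \<in> sets \<nu> \<Longrightarrow> emeasure \<nu> A < \<infinity> \<Longrightarrow>
      prob {\<omega>\<in>space M. point_count X A \<omega> = of_nat n} =
        measure \<nu> A ^ n / fact n * exp (- measure \<nu> A)"
    and count_indep: "\<And>(A :: nat \<Rightarrow> 'b set) m. (\<And>i. i < m \<Longrightarrow> A i \<in> sets \<nu>) \<Longrightarrow>
      disjoint_family_on A {..<m} \<Longrightarrow> indep_vars (\<lambda>_. borel) (\<lambda>i. point_count X (A i)) {..<m}"

lemma poisson_points_iff: "poisson_points M \<nu> X \<longleftrightarrow> poisson_process M \<nu> X"
  unfolding poisson_points_def poisson_process_def poisson_process_axioms_def by blast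

context poisson_process
begin

lemma X_space: "\<omega> \<in> space M \<Longrightarrow> X k \<omega> \<in> space \<nu>"
  using measurable_space[OF X_measurable] .

lemma point_count_measurable [measurable]:
  assumes "A \<in> sets \<nu>"
  shows "point_count X A \<in> borel_measurable M"
  using count_indep[of 1 "\<lambda>_. A"] assms by (auto simp: indep_vars_def disjoint_family_on_def)

text \<open>The default values agree: for infinitely many points \<open>card\<close> is 0, and so is
  \<open>enn2real\<close> of infinity.\<close>

lemma point_count_nat: "enn2real (point_count X A \<omega>) = real (card {k. X k \<omega> \<in> A})"
  by (cases "finite {k. X k \<omega> \<in> A}") (simp_all add: point_count_def emeasure_count_space)

lemma sums_poisson_weights: "(\<lambda>n. l ^ n / fact n * exp (- l)) sums (1::real)"
  using sums_mult2[OF exp_converges[of l], of "exp (- l)"]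
  by (simp add: divide_inverse mult_ac exp_minus)

text \<open>The Poisson weights sum to 1, which leaves no probability for an infinite count.\<close>

lemma AE_finite_points:
  assumes A [measurable]: "A \<in> sets \<nu>" and fin: "emeasure \<nu> A < \<infinity>"
  shows "AE \<omega> in M. finite {k. X k \<omega> \<in> A}"
proof -
  define C where "C n = {\<omega>\<in>space M. point_count X A \<omega> = of_nat n}" for n
  have C [measurable]: "C n \<in> sets M" for n
    unfolding C_def by measurable
  have "disjoint_family C"
    by (auto simp: C_def disjoint_family_on_def)
  then have "emeasure M (\<Union>n. C n) = (\<Sum>n. emeasure M (C n))"
    by (intro suminf_emeasure[symmetric]) auto
  also have "\<dots> = (\<Sum>n. ennreal (measure \<nu> A ^ n / fact n * exp (- measure \<nu> A)))"
    using count_law[OF A fin] by (simp add: C_def emeasure_eq_measure)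
  also have "\<dots> = ennreal 1"
    by (intro suminf_ennreal_eq sums_poisson_weights) simp
  finally have "AE \<omega> in M. \<omega> \<in> (\<Union>n. C n)"
    by (intro AE_prob_1) (simp add: measure_def)
  then show ?thesis
  proof eventually_elim
    case (elim \<omega>)
    then have "point_count X A \<omega> \<noteq> \<infinity>"
      by (auto simp: C_def)
    then show ?case
      by (auto simp: point_count_def emeasure_count_space split: if_splits)
  qed
qed

lemma nn_integral_point_count:
  fixes g :: "nat \<Rightarrow> ennreal"
  assumes A [measurable]: "A \<in> sets \<nu>" and fin: "emeasure \<nu> A < \<infinity>"
  shows "(\<integral>\<^sup>+\<omega>. g (card {k. X k \<omega> \<in> A}) \<partial>M) =
    (\<Sum>n. g n * ennreal (measure \<nu> A ^ n / fact n * exp (- measure \<nu> A)))"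
proof -
  define C where "C n = {\<omega>\<in>space M. point_count X A \<omega> = of_nat n}" for n
  have C [measurable]: "C n \<in> sets M" for n
    unfolding C_def by measurable
  have "(\<integral>\<^sup>+\<omega>. g (card {k. X k \<omega> \<in> A}) \<partial>M) = (\<integral>\<^sup>+\<omega>. (\<Sum>n. g n * indicator (C n) \<omega>) \<partial>M)"
  proof (rule nn_integral_cong_AE)
    show "AE \<omega> in M. g (card {k. X k \<omega> \<in> A}) = (\<Sum>n. g n * indicator (C n) \<omega>)"
      using AE_finite_points[OF A fin] AE_space
    proof eventually_elim
      case (elim \<omega>)
      then have "indicator (C n) \<omega> = (if n = card {k. X k \<omega> \<in> A} then 1 else 0 :: ennreal)" for n
        by (auto simp: C_def point_count_def emeasure_count_space)
      then have "(\<Sum>n. g n * indicator (C n) \<omega>) =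
          (\<Sum>n\<in>{card {k. X k \<omega> \<in> A}}. g n * indicator (C n) \<omega>)"
        by (intro suminf_finite) auto
      then show ?case
        using elim by (simp add: C_def point_count_def emeasure_count_space)
    qed
  qed
  also have "\<dots> = (\<Sum>n. g n * emeasure M (C n))"
    by (subst nn_integral_suminf) (auto intro!: suminf_cong nn_integral_cmult_indicator)
  finally show ?thesis
    using count_law[OF A fin] by (simp add: C_def emeasure_eq_measure)
qed

text \<open>The probability generating function of the Poisson law.\<close>

lemma nn_integral_power_point_count:
  fixes y :: real
  assumes A: "A \<in> sets \<nu>" and fin: "emeasure \<nu> A < \<infinity>" and y: "0 \<le> y"
  shows "(\<integral>\<^sup>+\<omega>. ennreal y ^ card {k. X k \<omega> \<in> A} \<partial>M) = ennreal (exp ((y - 1) * measure \<nu> A))"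
proof -
  let ?l = "measure \<nu> A"
  have "(\<lambda>n. (y * ?l) ^ n / fact n * exp (- ?l)) sums (exp (y * ?l) * exp (- ?l))"
    using sums_mult2[OF exp_converges[of "y * ?l"], of "exp (- ?l)"] by (simp add: divide_inverse mult_ac)
  then have "(\<Sum>n. ennreal ((y * ?l) ^ n / fact n * exp (- ?l))) = ennreal (exp ((y - 1) * ?l))"
    using y by (subst suminf_ennreal_eq) (auto simp: exp_add[symmetric] algebra_simps)
  then show ?thesis
    using y by (subst nn_integral_point_count[OF A fin])
      (simp add: ennreal_power ennreal_mult'[symmetric] power_mult_distrib mult.assoc)
qed

lemma nn_integral_prod_power_point_count:
  fixes y :: "nat \<Rightarrow> real"
  assumes A: "\<And>i. i < m \<Longrightarrow> A i \<in> sets \<nu>" and fin: "\<And>i. i < m \<Longrightarrow> emeasure \<nu> (A i) < \<infinity>"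
    and disj: "disjoint_family_on A {..<m}" and y: "\<And>i. i < m \<Longrightarrow> 0 \<le> y i"
  shows "(\<integral>\<^sup>+\<omega>. (\<Prod>i<m. ennreal (y i) ^ card {k. X k \<omega> \<in> A i}) \<partial>M) =
    ennreal (exp (\<Sum>i<m. (y i - 1) * measure \<nu> (A i)))"
proof -
  \<comment> \<open>Independence is assumed for the extended counts, so the cardinality is written
    as a Borel function of them.\<close>
  have count: "card {k. X k \<omega> \<in> A i} = nat \<lfloor>enn2real (point_count X (A i) \<omega>)\<rfloor>" for i \<omega>
    by (simp add: point_count_nat)
  have "indep_vars (\<lambda>_. borel) (\<lambda>i \<omega>. ennreal (y i) ^ card {k. X k \<omega> \<in> A i}) {..<m}"
    unfolding count
    by (rule indep_vars_compose2[OF count_indep[OF A disj]]) simp_all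
  then have "(\<integral>\<^sup>+\<omega>. (\<Prod>i<m. ennreal (y i) ^ card {k. X k \<omega> \<in> A i}) \<partial>M) =
      (\<Prod>i<m. \<integral>\<^sup>+\<omega>. ennreal (y i) ^ card {k. X k \<omega> \<in> A i} \<partial>M)"
    by (intro indep_vars_nn_integral) auto
  also have "\<dots> = (\<Prod>i<m. ennreal (exp ((y i - 1) * measure \<nu> (A i))))"
    by (intro prod.cong nn_integral_power_point_count A fin y) auto
  also have "\<dots> = ennreal (exp (\<Sum>i<m. (y i - 1) * measure \<nu> (A i)))"
    by (subst prod_ennreal) (auto simp: exp_sum)
  finally show ?thesis .
qed

end

section \<open>Infinite products of factors in the unit interval\<close>

lemma decseq_prod_ennreal:
  fixes a :: "nat \<Rightarrow> ennreal"
  assumes "\<And>k. a k \<le> 1"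
  shows "decseq (\<lambda>n. \<Prod>k<n. a k)"
proof (rule decseq_SucI)
  fix n
  show "(\<Prod>k<Suc n. a k) \<le> (\<Prod>k<n. a k)"
    using mult_left_mono[OF assms[of n], of "\<Prod>k<n. a k"] by simp
qed

text \<open>An infinite product of factors at most 1 is taken as the infimum of its partial
  products, which always exists. This lemma checks that the encoding is the expected one when only
  finitely many factors differ from 1.\<close>

lemma INF_prod_eq_finite_prod:
  fixes a :: "nat \<Rightarrow> ennreal"
  assumes le: "\<And>k. a k \<le> 1" and fin: "finite {k. a k \<noteq> 1}"
  shows "(INF n. \<Prod>k<n. a k) = (\<Prod>k | a k \<noteq> 1. a k)"
proof -
  obtain n0 where n0: "{k. a k \<noteq> 1} \<subseteq> {..<n0}"
    using fin unfolding finite_nat_iff_bounded by blast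
  have "(\<Prod>k<n. a k) = (\<Prod>k | a k \<noteq> 1. a k)" if "n0 \<le> n" for n
    using n0 that by (intro prod.mono_neutral_right) auto
  then have "(\<lambda>n. \<Prod>k<n. a k) \<longlonglongrightarrow> (\<Prod>k | a k \<noteq> 1. a k)"
    by (intro tendsto_eventually eventually_sequentiallyI[of n0])
  then show ?thesis
    by (rule LIMSEQ_unique[OF LIMSEQ_INF[OF decseq_prod_ennreal[OF le]]])
qed

text \<open>Multiplication on \<open>ennreal\<close> is discontinuous at (0, infinity); the bound by
  1 keeps away from that point.\<close>

lemma tendsto_prod_ennreal_le_one:
  fixes a :: "nat \<Rightarrow> 'i \<Rightarrow> ennreal"
  assumes le: "\<And>i k. a i k \<le> 1" and lim: "\<And>k. (\<lambda>i. a i k) \<longlonglongrightarrow> b k" and fin: "finite K"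
  shows "(\<lambda>i. \<Prod>k\<in>K. a i k) \<longlonglongrightarrow> (\<Prod>k\<in>K. b k)"
  using fin
proof (induction K rule: finite_induct)
  case (insert k K)
  have b: "b k \<le> 1" for k
    by (rule LIMSEQ_le_const2[OF lim]) (use le in blast)
  then have "prod b K \<le> 1"
    by (intro prod_le_1) auto
  then have "b k \<noteq> top" "prod b K \<noteq> top"
    using b[of k] by (auto simp: top_unique)
  then show ?case
    unfolding prod.insert[OF insert.hyps] by (intro tendsto_mult_ennreal lim insert.IH) auto
qed simp

context poisson_process
begin

text \<open>Here \<open>v\<close> stands for 1 - exp (- f) of the usual Laplace functional. Grouping
  the factors by the value of \<open>v\<close> gives powers indexed by the counts of the level sets,
  which are disjoint, so the counts are independent and the generating functions multiply.\<close>

lemma laplace_functional_simple: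
  fixes v :: "'b \<Rightarrow> ennreal"
  assumes v: "simple_function \<nu> v" and le: "\<And>x. v x \<le> 1" and fin: "(\<integral>\<^sup>+x. v x \<partial>\<nu>) < \<infinity>"
  shows "(\<integral>\<^sup>+\<omega>. (INF n. \<Prod>k<n. 1 - v (X k \<omega>)) \<partial>M) = ennreal (exp (- enn2real (\<integral>\<^sup>+x. v x \<partial>\<nu>)))"
proof -
  have vfin [simp]: "v x \<noteq> top" for x
    using le[of x] by (auto simp: top_unique)
  \<comment> \<open>The value 0 is left out: its level set may have infinite intensity, but its
    points only contribute factors 1.\<close>
  define Y where "Y = v ` space \<nu> - {0}"
  have "finite Y"
    using v by (auto simp: Y_def simple_function_def)
  then obtain e where e: "bij_betw e {..<card Y} Y"
    using ex_bij_betw_nat_finite[of Y] by (auto simp: atLeast0LessThan)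
  define m where "m = card Y"
  define A where "A i = v -` {e i} \<inter> space \<nu>" for i
  have eY: "e i \<in> Y" "e i \<noteq> 0" "e i \<le> 1" if "i < m" for i
  proof -
    show "e i \<in> Y"
      using bij_betwE[OF e] that by (simp add: m_def)
    then show "e i \<noteq> 0" "e i \<le> 1"
      using le by (auto simp: Y_def)
  qed
  have A: "A i \<in> sets \<nu>" for i
    using v by (auto simp: A_def)
  have disj: "disjoint_family_on A {..<m}"
    using e by (auto simp: disjoint_family_on_def A_def bij_betw_def inj_on_def m_def)
  have int: "(\<integral>\<^sup>+x. v x \<partial>\<nu>) = (\<Sum>i<m. e i * emeasure \<nu> (A i))"
  proof -
    have "(\<integral>\<^sup>+x. v x \<partial>\<nu>) = (\<Sum>y\<in>Y. y * emeasure \<nu> (v -` {y} \<inter> space \<nu>))"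
      unfolding nn_integral_eq_simple_integral[OF v] simple_integral_def Y_def
      using v by (intro sum.mono_neutral_right) (auto simp: simple_function_def)
    also have "\<dots> = (\<Sum>i<m. e i * emeasure \<nu> (A i))"
      unfolding A_def m_def by (rule sum.reindex_bij_betw[OF e, symmetric])
    finally show ?thesis .
  qed
  have Afin: "emeasure \<nu> (A i) < \<infinity>" if "i < m" for i
  proof -
    have "e i * emeasure \<nu> (A i) \<le> (\<integral>\<^sup>+x. v x \<partial>\<nu>)"
      unfolding int using that by (intro member_le_sum) auto
    then have "e i * emeasure \<nu> (A i) < \<top>"
      using fin by (simp add: le_less_trans)
    then show ?thesis
      using eY(2)[OF that] by (auto simp: ennreal_mult_less_top)
  qed
  define r where "r i = enn2real (e i)" for i
  have r: "e i = ennreal (r i)" "0 \<le> r i" "r i \<le> 1" if "i < m" for i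
    using eY[OF that] by (cases "e i" rule: ennreal_cases; simp add: r_def top_unique)+
  have ae: "AE \<omega> in M. \<forall>i\<in>{..<m}. finite {k. X k \<omega> \<in> A i}"
    by (intro AE_finite_allI AE_finite_points A Afin) auto
  have "(\<integral>\<^sup>+\<omega>. (INF n. \<Prod>k<n. 1 - v (X k \<omega>)) \<partial>M) =
      (\<integral>\<^sup>+\<omega>. (\<Prod>i<m. ennreal (1 - r i) ^ card {k. X k \<omega> \<in> A i}) \<partial>M)"
  proof (rule nn_integral_cong_AE)
    show "AE \<omega> in M. (INF n. \<Prod>k<n. 1 - v (X k \<omega>)) =
        (\<Prod>i<m. ennreal (1 - r i) ^ card {k. X k \<omega> \<in> A i})"
      using ae AE_space
    proof eventually_elim
      case (elim \<omega>)
      define K where "K = {k. v (X k \<omega>) \<noteq> 0}"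
      have K: "K = (\<Union>i<m. {k. X k \<omega> \<in> A i})"
      proof safe
        fix k assume "k \<in> K"
        then have "v (X k \<omega>) \<in> Y"
          using X_space[OF elim(2), of k] by (auto simp: K_def Y_def)
        then have "\<exists>i<m. v (X k \<omega>) = e i"
          using e by (auto simp: bij_betw_def m_def)
        then show "k \<in> (\<Union>i<m. {k. X k \<omega> \<in> A i})"
          using X_space[OF elim(2), of k] by (auto simp: A_def)
      next
        fix k i assume "i < m" "X k \<omega> \<in> A i"
        then show "k \<in> K"
          using eY(2)[of i] by (auto simp: A_def K_def)
      qed
      have K': "{k. 1 - v (X k \<omega>) \<noteq> 1} = K"
      proof -
        have "1 - v x = 1 \<longleftrightarrow> v x = 0" for x
          using le[of x] by (cases "v x" rule: ennreal_cases) (auto simp: ennreal_1[symmetric] ennreal_minus simp del: ennreal_1)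
        then show ?thesis
          by (auto simp: K_def)
      qed
      have "finite K"
        using elim by (auto simp: K)
      then have "(INF n. \<Prod>k<n. 1 - v (X k \<omega>)) = (\<Prod>k\<in>K. 1 - v (X k \<omega>))"
        by (subst INF_prod_eq_finite_prod) (auto simp: K' diff_le_self_ennreal)
      also have "\<dots> = (\<Prod>i<m. \<Prod>k | X k \<omega> \<in> A i. 1 - v (X k \<omega>))"
        unfolding K using elim disj
        by (intro prod.UNION_disjoint) (auto simp: disjoint_family_on_def)
      also have "\<dots> = (\<Prod>i<m. ennreal (1 - r i) ^ card {k. X k \<omega> \<in> A i})"
      proof (intro prod.cong refl)
        fix i assume "i \<in> {..<m}"
        then have "1 - v (X k \<omega>) = ennreal (1 - r i)" if "X k \<omega> \<in> A i" for k
          using that r[of i] by (simp add: A_def ennreal_minus flip: ennreal_1)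
        then show "(\<Prod>k | X k \<omega> \<in> A i. 1 - v (X k \<omega>)) = ennreal (1 - r i) ^ card {k. X k \<omega> \<in> A i}"
          by simp
      qed
      finally show ?case .
    qed
  qed
  also have "\<dots> = ennreal (exp (\<Sum>i<m. ((1 - r i) - 1) * measure \<nu> (A i)))"
    using r by (intro nn_integral_prod_power_point_count A Afin disj) auto
  also have "(\<Sum>i<m. ((1 - r i) - 1) * measure \<nu> (A i)) = - enn2real (\<integral>\<^sup>+x. v x \<partial>\<nu>)"
  proof -
    have "(\<integral>\<^sup>+x. v x \<partial>\<nu>) = (\<Sum>i<m. ennreal (r i * measure \<nu> (A i)))"
      unfolding int using r Afin
      by (intro sum.cong refl)
        (simp add: emeasure_eq_ennreal_measure ennreal_mult less_top[symmetric])
    also have "\<dots> = ennreal (\<Sum>i<m. r i * measure \<nu> (A i))"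
      using r by (intro sum_ennreal) simp
    finally have "(\<integral>\<^sup>+x. v x \<partial>\<nu>) = ennreal (\<Sum>i<m. r i * measure \<nu> (A i))" .
    moreover have "0 \<le> (\<Sum>i<m. r i * measure \<nu> (A i))"
      using r by (intro sum_nonneg) auto
    ultimately show ?thesis
      by (simp add: sum_negf)
  qed
  finally show ?thesis .
qed

text \<open>Simple functions increase to \<open>v\<close>, so the products decrease twice, in the
  approximation index and in the number of factors. Two infima commute, which replaces any argument
  about uniform convergence of the infinite products.\<close>

theorem laplace_functional:
  fixes v :: "'b \<Rightarrow> ennreal"
  assumes v [measurable]: "v \<in> borel_measurable \<nu>" and le: "\<And>x. v x \<le> 1"
    and fin: "(\<integral>\<^sup>+x. v x \<partial>\<nu>) < \<infinity>"
  shows "(\<integral>\<^sup>+\<omega>. (INF n. \<Prod>k<n. 1 - v (X k \<omega>)) \<partial>M) = ennreal (exp (- enn2real (\<integral>\<^sup>+x. v x \<partial>\<nu>)))"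
proof -
  obtain f where f: "\<And>i. simple_function \<nu> (f i)" "incseq f" "\<And>i x. f i x < \<top>" "\<And>x. (SUP i. f i x) = v x"
    using borel_measurable_implies_simple_function_sequence'[OF v] by blast
  have f_meas [measurable]: "f i \<in> borel_measurable \<nu>" for i
    using f(1) by (rule borel_measurable_simple_function)
  have fv: "f i x \<le> v x" for i x
    using SUP_upper[of i UNIV "\<lambda>i. f i x"] f(4) by simp
  then have f1: "f i x \<le> 1" for i x
    using le order.trans by blast
  have inc: "incseq (\<lambda>i. f i x)" for x
    using f(2) by (auto simp: incseq_def le_fun_def)
  have lim: "(\<lambda>i. f i x) \<longlonglongrightarrow> v x" for x
    using LIMSEQ_SUP[OF inc, of x] f(4) by simp
  have fint: "(\<integral>\<^sup>+x. f i x \<partial>\<nu>) < \<infinity>" for i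
    using nn_integral_mono[of \<nu> "f i" v] fv fin by (metis le_less_trans)
  have "(\<lambda>i. \<integral>\<^sup>+x. f i x \<partial>\<nu>) \<longlonglongrightarrow> (\<integral>\<^sup>+x. v x \<partial>\<nu>)"
    by (intro nn_integral_LIMSEQ[OF f(2)] f_meas lim)
  then have lim_exp: "(\<lambda>i. ennreal (exp (- enn2real (\<integral>\<^sup>+x. f i x \<partial>\<nu>)))) \<longlonglongrightarrow>
      ennreal (exp (- enn2real (\<integral>\<^sup>+x. v x \<partial>\<nu>)))"
    using fin by (intro tendsto_ennrealI tendsto_intros) (auto simp: less_top)
  define W where "W i \<omega> = (INF n. \<Prod>k<n. 1 - f i (X k \<omega>))" for i \<omega>
  have W_lim: "(\<lambda>i. \<integral>\<^sup>+\<omega>. W i \<omega> \<partial>M) \<longlonglongrightarrow> (\<integral>\<^sup>+\<omega>. (INF i. W i \<omega>) \<partial>M)"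
  proof -
    have dec: "decseq W"
    proof (rule decseq_SucI, rule le_funI)
      fix i \<omega>
      show "W (Suc i) \<omega> \<le> W i \<omega>"
        unfolding W_def using incseq_SucD[OF inc]
        by (intro INF_mono' prod_mono_ennreal ennreal_minus_mono) auto
    qed
    have meas: "W i \<in> borel_measurable M" for i
      unfolding W_def[abs_def] by measurable
    have "W 0 \<omega> \<le> 1" for \<omega>
      unfolding W_def by (rule INF_lower2[of 0]) auto
    then have "(\<integral>\<^sup>+\<omega>. W 0 \<omega> \<partial>M) \<le> (\<integral>\<^sup>+\<omega>. 1 \<partial>M)"
      by (intro nn_integral_mono)
    then have "(\<integral>\<^sup>+\<omega>. W 0 \<omega> \<partial>M) < \<infinity>"
      using ennreal_one_less_top by (auto simp: emeasure_space_1 intro: le_less_trans)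
    then have INF_int: "(\<integral>\<^sup>+\<omega>. (INF i. W i \<omega>) \<partial>M) = (INF i. \<integral>\<^sup>+\<omega>. W i \<omega> \<partial>M)"
      by (rule nn_integral_monotone_convergence_INF_decseq[where f = W, OF dec meas])
    have "decseq (\<lambda>i. \<integral>\<^sup>+\<omega>. W i \<omega> \<partial>M)"
      using decseq_SucD[OF dec] by (intro decseq_SucI nn_integral_mono) (auto simp: le_fun_def)
    then show ?thesis
      unfolding INF_int by (rule LIMSEQ_INF)
  qed
  have INF_W: "(INF i. W i \<omega>) = (INF n. \<Prod>k<n. 1 - v (X k \<omega>))" for \<omega>
  proof -
    have "(INF i. \<Prod>k<n. 1 - f i (X k \<omega>)) = (\<Prod>k<n. 1 - v (X k \<omega>))" for n
    proof -
      have prod_lim: "(\<lambda>i. \<Prod>k<n. 1 - f i (X k \<omega>)) \<longlonglongrightarrow> (\<Prod>k<n. 1 - v (X k \<omega>))"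
      proof (rule tendsto_prod_ennreal_le_one)
        fix k
        have "v (X k \<omega>) \<noteq> top"
          using le[of "X k \<omega>"] by (auto simp: top_unique)
        then show "(\<lambda>i. 1 - f i (X k \<omega>)) \<longlonglongrightarrow> 1 - v (X k \<omega>)"
          by (intro tendsto_diff_ennreal tendsto_const lim) auto
      qed (auto simp: diff_le_self_ennreal)
      have "decseq (\<lambda>i. \<Prod>k<n. 1 - f i (X k \<omega>))"
        using incseq_SucD[OF inc] by (intro decseq_SucI prod_mono_ennreal ennreal_minus_mono) auto
      then show ?thesis
        by (rule LIMSEQ_unique[OF LIMSEQ_INF prod_lim])
    qed
    then show ?thesis
      unfolding W_def by (subst INF_commute) (simp only:)
  qed
  have W_int: "(\<integral>\<^sup>+\<omega>. W i \<omega> \<partial>M) = ennreal (exp (- enn2real (\<integral>\<^sup>+x. f i x \<partial>\<nu>)))" for i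
    unfolding W_def by (rule laplace_functional_simple[OF f(1) f1 fint])
  show ?thesis
    using W_lim lim_exp unfolding W_int INF_W by (rule LIMSEQ_unique)
qed

end


section \<open>Tuples of Poisson points\<close>

context poisson_process
begin

text \<open>The quadratic order in the intensity is what matters: summed over the cells of a fine
  partition under a diffuse law, such bounds tend to 0.\<close>

lemma emeasure_two_points_le:
  assumes A [measurable]: "A \<in> sets \<nu>" and fin: "emeasure \<nu> A < \<infinity>"
  shows "emeasure M {\<omega>\<in>space M. \<exists>k l. k \<noteq> l \<and> X k \<omega> \<in> A \<and> X l \<omega> \<in> A} \<le> (emeasure \<nu> A)\<^sup>2"
proof -
  define C where "C = {\<omega>\<in>space M. \<exists>k l. k \<noteq> l \<and> X k \<omega> \<in> A \<and> X l \<omega> \<in> A}"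
  have [measurable]: "C \<in> sets M"
    unfolding C_def by measurable
  let ?l = "measure \<nu> A"
  let ?p = "\<lambda>n. ?l ^ n / fact n * exp (- ?l)"
  let ?g = "\<lambda>n::nat. if n < 2 then 0 else 1 :: ennreal"
  have "emeasure M C = (\<integral>\<^sup>+\<omega>. indicator C \<omega> \<partial>M)"
    by simp
  also have "\<dots> \<le> (\<integral>\<^sup>+\<omega>. ?g (card {k. X k \<omega> \<in> A}) \<partial>M)"
  proof (rule nn_integral_mono_AE)
    show "AE \<omega> in M. indicator C \<omega> \<le> ?g (card {k. X k \<omega> \<in> A})"
      using AE_finite_points[OF A fin]
    proof eventually_elim
      case (elim \<omega>)
      show ?case
      proof (cases "\<omega> \<in> C")
        case True
        then obtain k l where kl: "k \<noteq> l" "{k, l} \<subseteq> {k. X k \<omega> \<in> A}"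
          by (auto simp: C_def)
        have "card {k, l} \<le> card {k. X k \<omega> \<in> A}"
          by (intro card_mono elim kl)
        then show ?thesis
          using kl(1) by (simp add: indicator_def)
      qed simp
    qed
  qed
  also have "\<dots> = (\<Sum>n. ?g n * ennreal (?p n))"
    by (rule nn_integral_point_count[OF A fin])
  also have "\<dots> = (\<Sum>n. ennreal (?p n - (if n < 2 then ?p n else 0)))"
    by (intro suminf_cong) simp
  also have "\<dots> = ennreal (1 - (\<Sum>n<2. ?p n))"
  proof (intro suminf_ennreal_eq sums_diff sums_poisson_weights)
    show "(\<lambda>n. if n < 2 then ?p n else 0) sums (\<Sum>n<2. ?p n)"
      using sums_If_finite_set[of "{..<2}" ?p] by simp
  qed auto
  also have "\<dots> \<le> ennreal (?l\<^sup>2)"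
  proof (rule ennreal_leI)
    \<comment> \<open>With l the intensity of \<open>A\<close>, the probability of at least two
      points is 1 - (1 + l) exp (- l), and exp (- l) is at least 1 - l; the difference 1 - (1 + l)
      (1 - l) is the square of l.\<close>
    have "(1 + ?l) * (1 - ?l) \<le> (1 + ?l) * exp (- ?l)"
      using exp_ge_add_one_self[of "- ?l"] by (intro mult_left_mono) auto
    then show "1 - (\<Sum>n<2. ?p n) \<le> ?l\<^sup>2"
      by (simp add: numeral_2_eq_2 algebra_simps)
  qed
  also have "\<dots> = (emeasure \<nu> A)\<^sup>2"
    using fin by (simp add: emeasure_eq_ennreal_measure ennreal_power less_top)
  finally show ?thesis
    by (simp add: C_def)
qed

lemma nn_integral_point_count_eq:
  assumes A [measurable]: "A \<in> sets \<nu>" and fin: "emeasure \<nu> A < \<infinity>"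
  shows "(\<integral>\<^sup>+\<omega>. point_count X A \<omega> \<partial>M) = emeasure \<nu> A"
proof -
  let ?l = "measure \<nu> A"
  let ?p = "\<lambda>n. ?l ^ n / fact n * exp (- ?l)"
  have "(\<integral>\<^sup>+\<omega>. point_count X A \<omega> \<partial>M) = (\<integral>\<^sup>+\<omega>. of_nat (card {k. X k \<omega> \<in> A}) \<partial>M)"
    using AE_finite_points[OF A fin]
    by (intro nn_integral_cong_AE) (auto simp: point_count_def emeasure_count_space)
  also have "\<dots> = (\<Sum>n. ennreal (real n * ?p n))"
    by (subst nn_integral_point_count[OF A fin])
      (simp add: ennreal_mult'[symmetric] ennreal_of_nat_eq_real_of_nat mult.assoc)
  also have "\<dots> = ennreal ?l"
  proof (rule suminf_ennreal_eq)
    have "(\<lambda>n. ?l * ?p n) sums (?l * 1)"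
      by (intro sums_mult sums_poisson_weights)
    moreover have "real (Suc n) * ?p (Suc n) = ?l * ?p n" for n
      by (simp add: divide_simps)
    ultimately have "(\<lambda>n. real (Suc n) * ?p (Suc n)) sums ?l"
      by (simp only: mult_1_right)
    then show "(\<lambda>n. real n * ?p n) sums ?l"
      by (subst (asm) sums_Suc_iff) simp
  qed simp
  finally show ?thesis
    using fin by (simp add: emeasure_eq_ennreal_measure less_top)
qed

lemma nn_integral_prod_point_count:
  fixes A :: "nat \<Rightarrow> 'b set" and n :: nat
  assumes A: "\<And>i. i < n \<Longrightarrow> A i \<in> sets \<nu>" and fin: "\<And>i. i < n \<Longrightarrow> emeasure \<nu> (A i) < \<infinity>"
    and disj: "disjoint_family_on A {..<n}"
  shows "(\<integral>\<^sup>+\<omega>. (\<Prod>i<n. point_count X (A i) \<omega>) \<partial>M) = (\<Prod>i<n. emeasure \<nu> (A i))"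
  using indep_vars_nn_integral[OF _ count_indep[of n A, OF A disj]]
  by (auto simp: nn_integral_point_count_eq[OF A fin] intro!: prod.cong)

text \<open>
  On a product of disjoint sets the mean number of tuples of points in a set is its measure under the
  product of the intensities. The tuple of the first \<open>n\<close> points is one of the tuples counted, so it
  avoids null sets, whatever the enumeration.
\<close>

lemma AE_tuple_avoids_null_set:
  fixes A :: "nat \<Rightarrow> 'b set" and n :: nat
  assumes \<nu>: "sigma_finite_measure \<nu>"
    and A: "\<And>i. A i \<in> sets \<nu>" and fin: "\<And>i. i < n \<Longrightarrow> emeasure \<nu> (A i) < \<infinity>"
    and disj: "disjoint_family_on A {..<n}"
    and B: "B \<in> null_sets (PiM {..<n} (\<lambda>i. density \<nu> (indicator (A i))))"
  shows "AE \<omega> in M. (\<forall>i<n. X i \<omega> \<in> A i) \<longrightarrow> (\<lambda>i\<in>{..<n}. X i \<omega>) \<notin> B"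
proof -
  let ?D = "\<lambda>i. density \<nu> (indicator (A i))"
  let ?N = "PiM {..<n} ?D"
  let ?K = "PiM {..<n} (\<lambda>_. count_space (UNIV :: nat set))"
  note A[measurable]
  interpret C: product_sigma_finite "\<lambda>_::nat. count_space (UNIV :: nat set)"
    by (intro product_sigma_finite.intro sigma_finite_measure_count_space)
  interpret K: sigma_finite_measure ?K
    by (rule C.sigma_finite) simp
  interpret KM: pair_sigma_finite ?K M
    by unfold_locales
  interpret D: product_sigma_finite ?D
  proof (rule product_sigma_finite.intro)
    show "sigma_finite_measure (?D i)" for i
      using A by (subst sigma_finite_measure.sigma_finite_iff_density_finite[OF \<nu>])
        (auto intro!: borel_measurable_indicator AE_I2 simp: indicator_def)
  qed
  have sets_N: "sets ?N = sets (PiM {..<n} (\<lambda>_. \<nu>))"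
    by (intro sets_PiM_cong) auto
  \<comment> \<open>\<open>k\<close> selects the indices of n points. Integrating over it with the
    counting measure \<open>?K\<close> sums over all index tuples, and the weight \<open>w\<close>
    below keeps those whose i-th point lies in \<open>A i\<close>.\<close>
  define \<Phi> where "\<Phi> = (\<lambda>(k, \<omega>). \<lambda>i\<in>{..<n}. X (k i) \<omega>)"
  have X_idx [measurable]: "(\<lambda>(k, \<omega>). X (k i) \<omega>) \<in> measurable (?K \<Otimes>\<^sub>M M) \<nu>" if "i < n" for i
  proof -
    have "(\<lambda>z. X (fst z i) (snd z)) \<in> measurable (?K \<Otimes>\<^sub>M M) \<nu>"
    proof (rule measurable_compose_countable[where f = "\<lambda>k z. X k (snd z)"])
      show "(\<lambda>z. fst z i) \<in> ?K \<Otimes>\<^sub>M M \<rightarrow>\<^sub>M count_space UNIV"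
        using that by (intro measurable_compose[OF measurable_fst] measurable_component_singleton) auto
    qed measurable
    then show ?thesis
      by (simp add: case_prod_beta')
  qed
  have \<Phi> [measurable]: "\<Phi> \<in> measurable (?K \<Otimes>\<^sub>M M) ?N"
    unfolding \<Phi>_def measurable_cong_sets[OF refl sets_N] case_prod_beta'
    using X_idx by (intro measurable_restrict) (auto simp: case_prod_beta')
  define w :: "(nat \<Rightarrow> nat) \<times> 'w \<Rightarrow> ennreal"
    where "w = (\<lambda>(k, \<omega>). \<Prod>i<n. indicator (A i) (X (k i) \<omega>))"
  have w [measurable]: "w \<in> borel_measurable (?K \<Otimes>\<^sub>M M)"
  proof -
    have "(\<lambda>z. indicator (A i) (case z of (k, \<omega>) \<Rightarrow> X (k i) \<omega>) :: ennreal) \<in>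
        borel_measurable (?K \<Otimes>\<^sub>M M)" if "i < n" for i
      using that A by (intro measurable_compose[OF X_idx]) auto
    then show ?thesis
      unfolding w_def case_prod_beta' by (intro borel_measurable_prod_ennreal) (auto simp: case_prod_beta')
  qed
  have em: "emeasure (distr (density (?K \<Otimes>\<^sub>M M) w) ?N \<Phi>) C =
      (\<integral>\<^sup>+\<omega>. \<integral>\<^sup>+k. w (k, \<omega>) * indicator C (\<Phi> (k, \<omega>)) \<partial>?K \<partial>M)" if C: "C \<in> sets ?N" for C
  proof -
    note C [measurable]
    have "emeasure (distr (density (?K \<Otimes>\<^sub>M M) w) ?N \<Phi>) C =
        (\<integral>\<^sup>+z. indicator C z \<partial>distr (density (?K \<Otimes>\<^sub>M M) w) ?N \<Phi>)"
      using C by simp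
    also have "\<dots> = (\<integral>\<^sup>+z. indicator C (\<Phi> z) \<partial>density (?K \<Otimes>\<^sub>M M) w)"
      using \<Phi> C by (intro nn_integral_distr) auto
    also have "\<dots> = (\<integral>\<^sup>+z. w z * indicator C (\<Phi> z) \<partial>(?K \<Otimes>\<^sub>M M))"
      by (intro nn_integral_density) measurable
    also have "\<dots> = (\<integral>\<^sup>+\<omega>. \<integral>\<^sup>+k. w (k, \<omega>) * indicator C (\<Phi> (k, \<omega>)) \<partial>?K \<partial>M)"
      by (rule KM.nn_integral_snd[symmetric]) measurable
    finally show ?thesis .
  qed
  \<comment> \<open>It suffices to compare boxes. There the sum over index tuples factorises into
    counts of the sets \<open>A i \<inter> C i\<close>, and their disjointness makes the counts
    independent, so the mean is the product of the intensities.\<close>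
  have "distr (density (?K \<Otimes>\<^sub>M M) w) ?N \<Phi> = ?N"
  proof (rule D.PiM_eqI)
    fix C assume "\<And>i. i \<in> {..<n} \<Longrightarrow> C i \<in> sets (?D i)"
    then have C [measurable]: "i < n \<Longrightarrow> C i \<in> sets \<nu>" for i
      by auto
    have "(\<integral>\<^sup>+k. w (k, \<omega>) * indicator (Pi\<^sub>E {..<n} C) (\<Phi> (k, \<omega>)) \<partial>?K) =
        (\<Prod>i<n. point_count X (A i \<inter> C i) \<omega>)" for \<omega>
    proof -
      have "(\<integral>\<^sup>+k. w (k, \<omega>) * indicator (Pi\<^sub>E {..<n} C) (\<Phi> (k, \<omega>)) \<partial>?K) =
          (\<integral>\<^sup>+k. (\<Prod>i<n. indicator {k. X k \<omega> \<in> A i \<inter> C i} (k i)) \<partial>?K)"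
      proof (intro nn_integral_cong)
        fix k
        have "indicator (Pi\<^sub>E {..<n} C) (\<Phi> (k, \<omega>)) = (\<Prod>i<n. indicator (C i) (X (k i) \<omega>) :: ennreal)"
        proof (cases "\<forall>i<n. X (k i) \<omega> \<in> C i")
          case True
          then show ?thesis
            by (simp add: \<Phi>_def restrict_PiE_iff)
        next
          case False
          then obtain i where "i < n" "X (k i) \<omega> \<notin> C i"
            by blast
          then show ?thesis
            by (auto simp: \<Phi>_def restrict_PiE_iff indicator_def intro!: prod_zero[symmetric])
        qed
        then show "w (k, \<omega>) * indicator (Pi\<^sub>E {..<n} C) (\<Phi> (k, \<omega>)) =
            (\<Prod>i<n. indicator {k. X k \<omega> \<in> A i \<inter> C i} (k i))"
          by (simp add: w_def prod.distrib[symmetric] indicator_def) (intro prod.cong; simp)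
      qed
      also have "\<dots> = (\<Prod>i<n. point_count X (A i \<inter> C i) \<omega>)"
        by (subst C.product_nn_integral_prod) (auto simp: point_count_def)
      finally show ?thesis .
    qed
    moreover have "Pi\<^sub>E {..<n} C \<in> sets ?N"
      using C by (intro sets_PiM_I_finite) auto
    ultimately have "emeasure (distr (density (?K \<Otimes>\<^sub>M M) w) ?N \<Phi>) (Pi\<^sub>E {..<n} C) =
        (\<integral>\<^sup>+\<omega>. (\<Prod>i<n. point_count X (A i \<inter> C i) \<omega>) \<partial>M)"
      by (simp add: em)
    also have "\<dots> = (\<Prod>i<n. emeasure \<nu> (A i \<inter> C i))"
    proof (rule nn_integral_prod_point_count)
      show "emeasure \<nu> (A i \<inter> C i) < \<infinity>" if "i < n" for i
        using fin[OF that] emeasure_mono[of "A i \<inter> C i" "A i" \<nu>] A by (auto simp: le_less_trans)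
      show "disjoint_family_on (\<lambda>i. A i \<inter> C i) {..<n}"
        using disj by (auto simp: disjoint_family_on_def)
    qed auto
    also have "\<dots> = (\<Prod>i<n. emeasure (?D i) (C i))"
      using C A by (intro prod.cong refl) (auto simp: emeasure_density indicator_inter_arith[symmetric])
    finally show "emeasure (distr (density (?K \<Otimes>\<^sub>M M) w) ?N \<Phi>) (Pi\<^sub>E {..<n} C) =
        (\<Prod>i<n. emeasure (?D i) (C i))" .
  qed auto
  then have "emeasure (distr (density (?K \<Otimes>\<^sub>M M) w) ?N \<Phi>) B = emeasure ?N B"
    by (rule arg_cong2[where f = emeasure, OF _ refl])
  then have "(\<integral>\<^sup>+\<omega>. \<integral>\<^sup>+k. w (k, \<omega>) * indicator B (\<Phi> (k, \<omega>)) \<partial>?K \<partial>M) = 0"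
    unfolding em[OF null_setsD2[OF B]] null_setsD1[OF B] .
  moreover have [measurable]: "B \<in> sets ?N"
    using B by auto
  moreover have "(\<lambda>\<omega>. \<integral>\<^sup>+k. w (k, \<omega>) * indicator B (\<Phi> (k, \<omega>)) \<partial>?K) \<in> borel_measurable M"
    by measurable
  ultimately have "AE \<omega> in M. (\<integral>\<^sup>+k. w (k, \<omega>) * indicator B (\<Phi> (k, \<omega>)) \<partial>?K) = 0"
    by (simp add: nn_integral_0_iff_AE)
  with AE_space show ?thesis
  proof eventually_elim
    case (elim \<omega>)
    \<comment> \<open>The index tuple (0, ..., n - 1) is one term of a vanishing sum of nonnegative
      terms, so its own term vanishes.\<close>
    define k0 where "k0 = (\<lambda>i\<in>{..<n}. i)"
    have sing: "{k0} = Pi\<^sub>E {..<n} (\<lambda>i. {i})"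
    proof -
      have "Pi\<^sub>E {..<n} (\<lambda>i. {i}) = Pi\<^sub>E {..<n} (\<lambda>i. {k0 i})"
        by (intro PiE_cong) (simp add: k0_def)
      then show ?thesis
        using PiE_singleton[of k0 "{..<n}"] by (simp add: k0_def)
    qed
    have k0: "emeasure ?K {k0} = 1"
      unfolding sing by (subst C.emeasure_PiM) auto
    then have [measurable]: "{k0} \<in> sets ?K"
      by (metis emeasure_notin_sets zero_neq_one)
    have "w (k0, \<omega>) * indicator B (\<Phi> (k0, \<omega>)) =
        (\<integral>\<^sup>+k. w (k0, \<omega>) * indicator B (\<Phi> (k0, \<omega>)) * indicator {k0} k \<partial>?K)"
      using k0 by (subst nn_integral_cmult_indicator) auto
    also have "\<dots> \<le> (\<integral>\<^sup>+k. w (k, \<omega>) * indicator B (\<Phi> (k, \<omega>)) \<partial>?K)"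
      by (intro nn_integral_mono) (auto simp: indicator_def)
    finally have "w (k0, \<omega>) * indicator B (\<Phi> (k0, \<omega>)) = 0"
      using elim by simp
    moreover have "w (k0, \<omega>) = 1" if "\<forall>i<n. X i \<omega> \<in> A i"
      using that by (simp add: w_def k0_def)
    moreover have "\<Phi> (k0, \<omega>) = (\<lambda>i\<in>{..<n}. X i \<omega>)"
      by (auto simp: \<Phi>_def k0_def restrict_def)
    ultimately show ?case
      by (auto simp: indicator_def split: if_splits)
  qed
qed

end


section \<open>Strongly universal hashing\<close>

text \<open>The centred indicators \<open>\<xi> y\<close> are orthogonal with squared norm a - a^2,
  and \<open>u y\<close> is the inner product of \<open>\<xi> y\<close> with the indicator of B.
  Expanding the squared distance from B to \<open>Z\<close> gives 0 <= P(B) - (2 - a + a^2) S, with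
  S the sum of the squares of the \<open>u y\<close>. Since 2 - a + a^2 >= 1, the bound 1 follows
  without normalising the \<open>\<xi> y\<close>.\<close>

lemma (in prob_space) bessel_inequality_events:
  assumes B [measurable]: "B \<in> events" and E [measurable]: "\<And>y. E y \<in> events"
    and a: "\<And>y. prob (E y) = a" and aa: "\<And>y z. y \<noteq> z \<Longrightarrow> prob (E y \<inter> E z) = a\<^sup>2"
    and Y: "finite Y"
  shows "(\<Sum>y\<in>Y. (prob (B \<inter> E y) - a * prob B)\<^sup>2) \<le> 1"
proof -
  define u where "u y = prob (B \<inter> E y) - a * prob B" for y
  define \<xi> where "\<xi> y \<omega> = indicator (E y) \<omega> - a" for y \<omega>
  define Z where "Z \<omega> = (\<Sum>y\<in>Y. u y * \<xi> y \<omega>)" for \<omega>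
  have a01: "0 \<le> a" "a \<le> 1"
    using a[of undefined] by (metis measure_nonneg, metis prob_le_1)
  have [measurable]: "\<xi> y \<in> borel_measurable M" for y
    unfolding \<xi>_def[abs_def] by measurable
  have \<xi>_bound: "\<bar>\<xi> y \<omega>\<bar> \<le> 1" for y \<omega>
    using a01 by (auto simp: \<xi>_def indicator_def)
  have int_\<xi>\<xi>: "integrable M (\<lambda>\<omega>. \<xi> y \<omega> * \<xi> z \<omega>)" for y z
    by (intro integrable_const_bound[where B = 1] AE_I2)
      (auto simp: abs_mult intro!: mult_le_one \<xi>_bound)
  have int_B\<xi>: "integrable M (\<lambda>\<omega>. indicator B \<omega> * \<xi> y \<omega>)" for y
    by (intro integrable_const_bound[where B = 1] AE_I2)
      (auto simp: abs_mult intro!: mult_le_one \<xi>_bound)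
  have int_ind: "integrable M (indicator C :: _ \<Rightarrow> real)" if "C \<in> events" for C
    using that by (intro integrable_real_indicator) (auto simp: emeasure_eq_measure)
  have E_\<xi>\<xi>: "expectation (\<lambda>\<omega>. \<xi> y \<omega> * \<xi> z \<omega>) = (if y = z then a - a\<^sup>2 else 0)" for y z
  proof -
    have "expectation (\<lambda>\<omega>. \<xi> y \<omega> * \<xi> z \<omega>) =
        expectation (\<lambda>\<omega>. indicator (E y \<inter> E z) \<omega> - a * indicator (E y) \<omega> - a * indicator (E z) \<omega> + a\<^sup>2)"
      by (intro Bochner_Integration.integral_cong refl)
        (auto simp: \<xi>_def indicator_def power2_eq_square algebra_simps)
    also have "\<dots> = prob (E y \<inter> E z) - a * prob (E y) - a * prob (E z) + a\<^sup>2"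
      using int_ind[of "E y \<inter> E z"] int_ind[of "E y"] int_ind[of "E z"] by (simp add: prob_space)
    finally show ?thesis
      using a aa by (auto simp: power2_eq_square)
  qed
  have E_B\<xi>: "expectation (\<lambda>\<omega>. indicator B \<omega> * \<xi> y \<omega>) = u y" for y
  proof -
    have "expectation (\<lambda>\<omega>. indicator B \<omega> * \<xi> y \<omega>) =
        expectation (\<lambda>\<omega>. indicator (B \<inter> E y) \<omega> - a * indicator B \<omega>)"
      by (intro Bochner_Integration.integral_cong refl) (auto simp: \<xi>_def indicator_def)
    also have "\<dots> = u y"
      using int_ind[of "B \<inter> E y"] int_ind[of B] by (simp add: u_def)
    finally show ?thesis .
  qed
  define S where "S = (\<Sum>y\<in>Y. (u y)\<^sup>2)"
  have "0 \<le> expectation (\<lambda>\<omega>. (indicator B \<omega> - Z \<omega>)\<^sup>2)"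
    by (intro Bochner_Integration.integral_nonneg) simp
  also have "\<dots> = expectation (\<lambda>\<omega>. indicator B \<omega> -
      2 * (\<Sum>y\<in>Y. u y * (indicator B \<omega> * \<xi> y \<omega>)) +
      (\<Sum>y\<in>Y. \<Sum>z\<in>Y. u y * u z * (\<xi> y \<omega> * \<xi> z \<omega>)))"
    by (intro Bochner_Integration.integral_cong refl)
      (auto simp: Z_def power2_eq_square sum_distrib_left sum_distrib_right algebra_simps indicator_def
        sum_product sum_subtractf sum.distrib intro!: sum.cong)
  also have "\<dots> = prob B - 2 * (\<Sum>y\<in>Y. u y * u y) +
      (\<Sum>y\<in>Y. \<Sum>z\<in>Y. u y * u z * (if y = z then a - a\<^sup>2 else 0))"
  proof -
    have i1: "integrable M (\<lambda>\<omega>. 2 * (\<Sum>y\<in>Y. u y * (indicator B \<omega> * \<xi> y \<omega>)))"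
      by (intro integrable_mult_right Bochner_Integration.integrable_sum int_B\<xi>)
    have i2: "integrable M (\<lambda>\<omega>. \<Sum>y\<in>Y. \<Sum>z\<in>Y. u y * u z * (\<xi> y \<omega> * \<xi> z \<omega>))"
      by (intro integrable_mult_right Bochner_Integration.integrable_sum int_\<xi>\<xi>)
    show ?thesis
      unfolding Bochner_Integration.integral_add[OF Bochner_Integration.integrable_diff[OF int_ind[OF B] i1] i2]
        Bochner_Integration.integral_diff[OF int_ind[OF B] i1] integral_mult_right_zero
        Bochner_Integration.integral_sum[OF integrable_mult_right[OF int_B\<xi>]]
        Bochner_Integration.integral_sum[OF Bochner_Integration.integrable_sum[OF integrable_mult_right[OF int_\<xi>\<xi>]]]
        Bochner_Integration.integral_sum[OF integrable_mult_right[OF int_\<xi>\<xi>]]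
        E_\<xi>\<xi> E_B\<xi>
      by simp
  qed
  also have "(\<Sum>y\<in>Y. \<Sum>z\<in>Y. u y * u z * (if y = z then a - a\<^sup>2 else 0)) = (a - a\<^sup>2) * S"
    using Y by (simp add: S_def sum_distrib_left power2_eq_square mult_ac if_distrib sum.delta cong: if_cong)
  also have "prob B - 2 * (\<Sum>y\<in>Y. u y * u y) + (a - a\<^sup>2) * S = prob B - (2 - a + a\<^sup>2) * S"
    by (simp add: S_def power2_eq_square algebra_simps)
  finally have "(2 - a + a\<^sup>2) * S \<le> 1"
    using prob_le_1[of B] by linarith
  moreover have "1 * S \<le> (2 - a + a\<^sup>2) * S"
  proof (rule mult_right_mono)
    show "1 \<le> 2 - a + a\<^sup>2"
      using a01 zero_le_power2[of a] by linarith
  qed (auto simp: S_def intro!: sum_nonneg)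
  ultimately show ?thesis
    by (simp add: S_def u_def)
qed

text \<open>
  The centred indicators of pairwise independent events of equal probability are orthogonal, so by
  Bessel's inequality a fixed event is correlated with only countably many of them.
\<close>

lemma (in prob_space) countable_dependent_events:
  assumes B: "B \<in> events" and E: "\<And>y. E y \<in> events"
    and a: "\<And>y. prob (E y) = a" and aa: "\<And>y z. y \<noteq> z \<Longrightarrow> prob (E y \<inter> E z) = a\<^sup>2"
  shows "countable {y. prob (B \<inter> E y) \<noteq> a * prob B}"
proof -
  define u where "u y = prob (B \<inter> E y) - a * prob B" for y
  \<comment> \<open>Any m + 1 symbols with squared covariance above 1 / (m + 1) would already push
    the sum above 1.\<close>
  have fin: "finite {y. 1 / real (Suc m) < (u y)\<^sup>2}" for m
  proof (rule ccontr)
    assume "infinite {y. 1 / real (Suc m) < (u y)\<^sup>2}"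
    then obtain Y where Y: "Y \<subseteq> {y. 1 / real (Suc m) < (u y)\<^sup>2}" "finite Y" "card Y = Suc m"
      using infinite_arbitrarily_large by blast
    have "1 = (\<Sum>y\<in>Y. 1 / real (Suc m))"
      using Y by simp
    also have "\<dots> < (\<Sum>y\<in>Y. (u y)\<^sup>2)"
      using Y by (intro sum_strict_mono) auto
    also have "\<dots> \<le> 1"
      unfolding u_def by (rule bessel_inequality_events[OF B E a aa Y(2)])
    finally show False
      by simp
  qed
  have "{y. u y \<noteq> 0} \<subseteq> (\<Union>m. {y. 1 / real (Suc m) < (u y)\<^sup>2})"
  proof
    fix y assume "y \<in> {y. u y \<noteq> 0}"
    then have "0 < (u y)\<^sup>2"
      by simp
    then obtain m where "1 / real (Suc m) < (u y)\<^sup>2"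
      using nat_approx_posE by metis
    then show "y \<in> (\<Union>m. {y. 1 / real (Suc m) < (u y)\<^sup>2})"
      by blast
  qed
  moreover have "countable (\<Union>m. {y. 1 / real (Suc m) < (u y)\<^sup>2})"
    using fin by (intro countable_UN) (auto intro: countable_finite)
  ultimately show ?thesis
    by (auto simp: u_def elim: countable_subset)
qed

text \<open>\<open>two_symbols\<close> serves to obtain the law of a single hash value: the
  universality condition speaks of pairs only, and marginals come from summing over a second
  symbol.\<close>

locale universal_hash = prob_space H for H :: "('a::topological_space \<Rightarrow> nat) measure" +
  fixes J :: nat
  assumes J: "1 \<le> J"
    and universal: "strongly_universal J H"
    and laws: "measurable_hash_laws H"
    and two_symbols: "\<exists>x y :: 'a. x \<noteq> y"
begin

lemma hash_range: "h \<in> space H \<Longrightarrow> h x \<in> {1..J}"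
  using universal by (auto simp: strongly_universal_def)

lemma hash_measurable [measurable]: "(\<lambda>h. h x) \<in> measurable H (count_space UNIV)"
  using universal by (auto simp: strongly_universal_def)

lemma hash_pair: "x \<noteq> y \<Longrightarrow> k \<in> {1..J} \<Longrightarrow> l \<in> {1..J} \<Longrightarrow>
    prob {h\<in>space H. h x = k \<and> h y = l} = 1 / (real J)\<^sup>2"
  using universal by (auto simp: strongly_universal_def)

lemma hash_uniform:
  assumes l: "l \<in> {1..J}"
  shows "prob {h\<in>space H. h x = l} = 1 / real J"
proof -
  obtain y where y: "x \<noteq> y"
    using two_symbols by metis
  have "{h\<in>space H. h x = l} = (\<Union>k\<in>{1..J}. {h\<in>space H. h x = l \<and> h y = k})"
    using hash_range by auto
  also have "prob \<dots> = (\<Sum>k\<in>{1..J}. prob {h\<in>space H. h x = l \<and> h y = k})"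
    by (intro finite_measure_finite_Union) (auto simp: disjoint_family_on_def)
  also have "\<dots> = 1 / real J"
    using J by (simp add: hash_pair[OF y l] power2_eq_square)
  finally show ?thesis .
qed

lemma countable_dependent_symbols:
  assumes B: "B \<in> events" and l: "l \<in> {1..J}"
  shows "countable {y. prob (B \<inter> {h\<in>space H. h y = l}) \<noteq> prob B / real J}"
proof -
  have "countable {y. prob (B \<inter> {h\<in>space H. h y = l}) \<noteq> 1 / real J * prob B}"
  proof (rule countable_dependent_events[OF B])
    show "prob ({h\<in>space H. h y = l} \<inter> {h\<in>space H. h z = l}) = (1 / real J)\<^sup>2" if "y \<noteq> z" for y z
    proof -
      have "{h\<in>space H. h y = l} \<inter> {h\<in>space H. h z = l} = {h\<in>space H. h y = l \<and> h z = l}"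
        by blast
      then show ?thesis
        using hash_pair[OF that l l] by (simp add: power_divide)
    qed
  qed (auto simp: hash_uniform[OF l])
  then show ?thesis
    by simp
qed

lemma pattern_measurable:
  fixes n :: nat
  assumes S: "\<And>i. i < n \<Longrightarrow> S i \<in> measurable N borel"
  shows "(\<lambda>x. prob {h\<in>space H. \<forall>i<n. h (S i x) = l i}) \<in> borel_measurable N"
proof -
  have tuple: "(\<lambda>x. \<lambda>i\<in>{..<n}. S i x) \<in> measurable N (Pi\<^sub>M {..<n} (\<lambda>_. borel))"
    using S by (intro measurable_restrict) auto
  have law: "(\<lambda>y. prob {h\<in>space H. \<forall>i<n. h (y i) = l i}) \<in> borel_measurable (Pi\<^sub>M {..<n} (\<lambda>_. borel))"
    using laws[unfolded measurable_hash_laws_def, rule_format, of n l] .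
  have eq: "{h\<in>space H. \<forall>i<n. h ((\<lambda>i\<in>{..<n}. S i x) i) = l i} =
      {h\<in>space H. \<forall>i<n. h (S i x) = l i}" for x
    by auto
  show ?thesis
    using measurable_compose[OF tuple law] unfolding eq .
qed

text \<open>Induction on n. Given n symbols with uniform patterns, the event B fixing their hash
  values is independent of the next one unless that symbol lies in a countable set, which is null
  because \<open>S\<close> maps \<open>\<nu> n\<close> to a diffuse measure. The measures
  \<open>\<nu> i\<close> may differ, since the tuples will live in boxes with different
  sides.\<close>

lemma AE_hash_law:
  assumes \<nu>: "product_sigma_finite \<nu>" and S: "\<And>i. S \<in> measurable (\<nu> i) borel"
    and diffuse: "\<And>i y. emeasure (\<nu> i) {x\<in>space (\<nu> i). S x = y} = 0"
    and singletons: "\<And>y. {y} \<in> sets (borel :: 'a measure)"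
    and l: "\<And>i. i < n \<Longrightarrow> l i \<in> {1..J}"
  shows "AE x in Pi\<^sub>M {..<n} \<nu>. prob {h\<in>space H. \<forall>i<n. h (S (x i)) = l i} = 1 / real J ^ n"
  using l
proof (induction n)
  case 0
  then show ?case
    by (simp add: prob_space)
next
  case (Suc n)
  interpret product_sigma_finite \<nu> by fact
  note S [measurable]
  let ?p = "\<lambda>m x. prob {h\<in>space H. \<forall>i<m. h (S (x i)) = l i}"
  have meas: "?p m \<in> borel_measurable (Pi\<^sub>M {..<m} \<nu>)" for m
    by (rule pattern_measurable) measurable
  define Bad where "Bad = {x\<in>space (Pi\<^sub>M {..<Suc n} \<nu>). ?p (Suc n) x \<noteq> 1 / real J ^ Suc n}"
  have Bad [measurable]: "Bad \<in> sets (Pi\<^sub>M {..<Suc n} \<nu>)"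
    unfolding Bad_def using meas[of "Suc n"] by measurable
  have IH: "AE x in Pi\<^sub>M {..<n} \<nu>. ?p n x = 1 / real J ^ n"
    using Suc.prems by (intro Suc.IH) auto
  have "AE x in Pi\<^sub>M {..<n} \<nu>. (\<integral>\<^sup>+y. indicator Bad (x(n := y)) \<partial>\<nu> n) = 0"
    using IH AE_space
  proof eventually_elim
    case (elim x)
    let ?B = "{h\<in>space H. \<forall>i<n. h (S (x i)) = l i}"
    \<comment> \<open>The exceptional set depends on the earlier coordinates \<open>x\<close> but is
      countable for each of them, which is all that the iterated integral asks for.\<close>
    define C where "C = {y. prob (?B \<inter> {h\<in>space H. h y = l n}) \<noteq> prob ?B / real J}"
    have "?B \<in> events"
      by measurable
    then have C: "countable C"
      unfolding C_def using Suc.prems by (intro countable_dependent_symbols) auto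
    have "S -` C \<inter> space (\<nu> n) = (\<Union>c\<in>C. {x\<in>space (\<nu> n). S x = c})"
      by auto
    also have "\<dots> \<in> null_sets (\<nu> n)"
    proof (intro null_sets_UN' C null_setsI diffuse)
      fix c
      have "S -` {c} \<inter> space (\<nu> n) \<in> sets (\<nu> n)"
        using S singletons by (rule measurable_sets)
      then show "{x\<in>space (\<nu> n). S x = c} \<in> sets (\<nu> n)"
        by (simp add: vimage_def Int_def conj_commute)
    qed
    finally have "AE y in \<nu> n. y \<notin> S -` C \<inter> space (\<nu> n)"
      by (rule AE_not_in)
    then have "AE y in \<nu> n. indicator Bad (x(n := y)) = (0::ennreal)"
      using AE_space
    proof eventually_elim
      case (elim y)
      have "{h\<in>space H. \<forall>i<Suc n. h (S ((x(n := y)) i)) = l i} = ?B \<inter> {h\<in>space H. h (S y) = l n}"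
        by (auto simp: less_Suc_eq)
      then have "?p (Suc n) (x(n := y)) = 1 / real J ^ Suc n"
        using elim \<open>prob ?B = _\<close> by (simp add: C_def)
      then show ?case
        by (simp add: Bad_def)
    qed
    then have "(\<integral>\<^sup>+y. indicator Bad (x(n := y)) \<partial>\<nu> n) = (\<integral>\<^sup>+y. 0 \<partial>\<nu> n)"
      by (rule nn_integral_cong_AE)
    then show ?case
      by simp
  qed
  then have "(\<integral>\<^sup>+x. \<integral>\<^sup>+y. indicator Bad (x(n := y)) \<partial>\<nu> n \<partial>Pi\<^sub>M {..<n} \<nu>) =
      (\<integral>\<^sup>+x. 0 \<partial>Pi\<^sub>M {..<n} \<nu>)"
    by (rule nn_integral_cong_AE)
  moreover have "(\<integral>\<^sup>+x. indicator Bad x \<partial>Pi\<^sub>M (insert n {..<n}) \<nu>) =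
      (\<integral>\<^sup>+x. \<integral>\<^sup>+y. indicator Bad (x(n := y)) \<partial>\<nu> n \<partial>Pi\<^sub>M {..<n} \<nu>)"
    using Bad by (intro product_nn_integral_insert) (auto simp: lessThan_Suc)
  ultimately have "emeasure (Pi\<^sub>M {..<Suc n} \<nu>) Bad = 0"
    by (simp add: lessThan_Suc[symmetric])
  then have "AE x in Pi\<^sub>M {..<Suc n} \<nu>. x \<notin> Bad"
    using Bad by (intro AE_not_in null_setsI)
  then show ?case
    using AE_space by eventually_elim (auto simp: Bad_def)
qed

text \<open>The mean of a function of finitely many hash values depends on the symbols only through
  the probabilities of patterns, and \<open>measurable_hash_laws\<close> makes those measurable in
  the symbols.\<close>

lemma expectation_hash_pattern:
  fixes \<Phi> :: "(nat \<Rightarrow> nat) \<Rightarrow> real"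
  shows "expectation (\<lambda>h. \<Phi> (\<lambda>i\<in>{..<n}. h (s i))) =
    (\<Sum>l\<in>Pi\<^sub>E {..<n} (\<lambda>_. {1..J}). \<Phi> l * prob {h\<in>space H. \<forall>i<n. h (s i) = l i})"
proof -
  let ?L = "Pi\<^sub>E {..<n} (\<lambda>_. {1..J})"
  let ?E = "\<lambda>l. {h\<in>space H. \<forall>i<n. h (s i) = l i}"
  have L: "finite ?L"
    by (intro finite_PiE) auto
  have "expectation (\<lambda>h. \<Phi> (\<lambda>i\<in>{..<n}. h (s i))) =
      expectation (\<lambda>h. \<Sum>l\<in>?L. \<Phi> l * indicator (?E l) h)"
  proof (intro Bochner_Integration.integral_cong refl)
    fix h assume h: "h \<in> space H"
    let ?r = "\<lambda>i\<in>{..<n}. h (s i)"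
    have "indicator (?E l) h = (if l = ?r then 1 else 0 :: real)" if "l \<in> ?L" for l
    proof -
      have "l = ?r \<longleftrightarrow> (\<forall>i<n. h (s i) = l i)"
      proof
        assume r: "\<forall>i<n. h (s i) = l i"
        show "l = ?r"
          using that r by (intro extensionalityI[of l "{..<n}"]) (auto simp: PiE_def)
      qed auto
      then show ?thesis
        using h by (simp add: indicator_def)
    qed
    then have "(\<Sum>l\<in>?L. \<Phi> l * indicator (?E l) h) = (\<Sum>l\<in>?L. if l = ?r then \<Phi> l else 0)"
      by (intro sum.cong) auto
    also have "\<dots> = \<Phi> ?r"
      using L h hash_range by (subst sum.delta) (auto simp: restrict_PiE_iff)
    finally show "\<Phi> ?r = (\<Sum>l\<in>?L. \<Phi> l * indicator (?E l) h)" ..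
  qed
  also have "\<dots> = (\<Sum>l\<in>?L. \<Phi> l * prob (?E l))"
  proof -
    have int: "integrable H (indicator (?E l) :: _ \<Rightarrow> real)" for l
      by (intro integrable_real_indicator) (auto simp: emeasure_eq_measure)
    show ?thesis
      using Bochner_Integration.integral_sum[of ?L H "\<lambda>l h. \<Phi> l * indicator (?E l) h", OF integrable_mult_right[OF int]]
      by simp
  qed
  finally show ?thesis .
qed

lemma expectation_prod_hash:
  fixes f :: "nat \<Rightarrow> nat \<Rightarrow> real"
  assumes iid: "\<And>l. (\<And>i. i < n \<Longrightarrow> l i \<in> {1..J}) \<Longrightarrow>
      prob {h\<in>space H. \<forall>i<n. h (s i) = l i} = 1 / real J ^ n"
  shows "expectation (\<lambda>h. \<Prod>i<n. f i (h (s i))) = (\<Prod>i<n. (\<Sum>l=1..J. f i l) / real J)"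
proof -
  let ?L = "Pi\<^sub>E {..<n} (\<lambda>_. {1..J})"
  have "expectation (\<lambda>h. \<Prod>i<n. f i (h (s i))) =
      expectation (\<lambda>h. (\<lambda>l. \<Prod>i<n. f i (l i)) (\<lambda>i\<in>{..<n}. h (s i)))"
    by (intro Bochner_Integration.integral_cong refl) simp
  also have "\<dots> = (\<Sum>l\<in>?L. (\<Prod>i<n. f i (l i)) * prob {h\<in>space H. \<forall>i<n. h (s i) = l i})"
    by (rule expectation_hash_pattern[of "\<lambda>l. \<Prod>i<n. f i (l i)"])
  also have "\<dots> = (\<Sum>l\<in>?L. (\<Prod>i<n. f i (l i)) * (1 / real J ^ n))"
  proof -
    have "prob {h\<in>space H. \<forall>i<n. h (s i) = l i} = 1 / real J ^ n" if "l \<in> ?L" for l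
      using iid[of l] PiE_mem[OF that] by blast
    then show ?thesis
      by (intro sum.cong refl) (simp only:)
  qed
  also have "\<dots> = (\<Prod>i<n. \<Sum>l=1..J. f i l) * (1 / real J ^ n)"
    unfolding sum_distrib_right[symmetric] by (subst prod_sum_PiE) auto
  also have "\<dots> = (\<Prod>i<n. (\<Sum>l=1..J. f i l) / real J)"
    by (simp add: prod_dividef)
  finally show ?thesis .
qed

end


section \<open>Poisson points with a Levy intensity\<close>

text \<open>A divergent sum gives the value 0, that is exp of minus infinity. This lets a Laplace
  transform detect whether the total mass is finite.\<close>

lemma INF_prod_exp:
  fixes f :: "nat \<Rightarrow> real"
  assumes f: "\<And>k. 0 \<le> f k"
  shows "(INF n. \<Prod>k<n. ennreal (exp (- f k))) =
    (if summable f then ennreal (exp (- suminf f)) else 0)"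
proof -
  have prod: "(\<Prod>k<n. ennreal (exp (- f k))) = ennreal (exp (- (\<Sum>k<n. f k)))" for n
    by (subst prod_ennreal) (auto simp: exp_sum[symmetric] sum_negf)
  have dec: "decseq (\<lambda>n. \<Prod>k<n. ennreal (exp (- f k)))"
    using f by (intro decseq_prod_ennreal) (simp add: ennreal_le_1)
  show ?thesis
  proof (cases "summable f")
    case True
    have "(\<lambda>n. \<Prod>k<n. ennreal (exp (- f k))) \<longlonglongrightarrow> ennreal (exp (- suminf f))"
      unfolding prod by (intro tendsto_ennrealI tendsto_intros summable_LIMSEQ True)
    then show ?thesis
      using LIMSEQ_unique[OF LIMSEQ_INF[OF dec]] True by simp
  next
    case False
    have small: "(INF n. \<Prod>k<n. ennreal (exp (- f k))) \<le> 0 + ennreal e" if "0 < e" for e :: real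
    proof -
      have "\<exists>n. \<not> (\<Sum>k<n. f k) \<le> - ln e"
        using False summableI_nonneg_bounded[of f "- ln e", OF f] by blast
      then obtain n where "- ln e < (\<Sum>k<n. f k)"
        by (auto simp: not_le)
      then have "exp (- (\<Sum>k<n. f k)) \<le> exp (ln e)"
        by simp
      then have "(\<Prod>k<n. ennreal (exp (- f k))) \<le> ennreal e"
        unfolding prod using that by (simp add: ennreal_leI)
      then show ?thesis
        by (intro INF_lower2[of n]) auto
    qed
    have "(INF n. \<Prod>k<n. ennreal (exp (- f k))) \<le> 0"
      by (rule ennreal_le_epsilon) (rule small)
    then show ?thesis
      using False by (simp only: le_zero_eq if_False)
  qed
qed

section \<open>A countable separating family of open sets and its cells\<close>

lemma separating_sequence:
  "\<exists>U :: nat \<Rightarrow> 'a::{second_countable_topology, t2_space} set.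
    (\<forall>b. open (U b)) \<and> (\<forall>s t. s \<noteq> t \<longrightarrow> (\<exists>b. s \<in> U b \<and> t \<notin> U b))"
proof -
  obtain \<B> :: "'a set set" where \<B>: "countable \<B>" "topological_basis \<B>"
    using ex_countable_basis by blast
  \<comment> \<open>Inserting the empty set guarantees a nonempty countable set, of which
    \<open>from_nat_into\<close> is then an enumeration with exactly that range.\<close>
  let ?U = "from_nat_into (insert {} \<B>)"
  have range: "range ?U = insert {} \<B>"
    using \<B>(1) by (intro range_from_nat_into) auto
  have "open (?U b)" for b
    using rangeI[of ?U b] unfolding range using topological_basis_open[OF \<B>(2)] by auto
  moreover have "\<exists>b. s \<in> ?U b \<and> t \<notin> ?U b" if st: "s \<noteq> t" for s t
  proof -
    obtain S where S: "open S" "s \<in> S" "t \<notin> S"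
      using separation_t1[of s t] st by auto
    then obtain B where B: "B \<in> \<B>" "s \<in> B" "B \<subseteq> S"
      using topological_basisE[OF \<B>(2)] by metis
    then have "B \<in> range ?U"
      unfolding range by simp
    then show ?thesis
      using B S by blast
  qed
  ultimately show ?thesis
    by blast
qed

definition separating_open :: "nat \<Rightarrow> 'a::{second_countable_topology, t2_space} set" where
  "separating_open = (SOME U. (\<forall>b. open (U b)) \<and> (\<forall>s t. s \<noteq> t \<longrightarrow> (\<exists>b. s \<in> U b \<and> t \<notin> U b)))"

lemma separating_open_spec:
  "(\<forall>b. open (separating_open b :: 'a::{second_countable_topology, t2_space} set)) \<and>
    (\<forall>s t :: 'a. s \<noteq> t \<longrightarrow> (\<exists>b. s \<in> separating_open b \<and> t \<notin> separating_open b))"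
  unfolding separating_open_def by (rule someI_ex[OF separating_sequence])

lemma open_separating: "open (separating_open b)"
  by (rule separating_open_spec[THEN conjunct1, THEN spec])

lemma separating_open_separates: "s \<noteq> t \<Longrightarrow> \<exists>b. s \<in> separating_open b \<and> t \<notin> separating_open b"
  by (rule separating_open_spec[THEN conjunct2, rule_format])

text \<open>Substitute for dyadic cubes in a space without a metric: for fixed m the cells with
  \<open>I \<subseteq> {..<m}\<close> partition the space, they refine as m grows, and two distinct
  points eventually lie in different cells.\<close>

definition cell :: "nat \<Rightarrow> nat set \<Rightarrow> 'a::{second_countable_topology, t2_space} set" where
  "cell m I = {s. \<forall>b<m. s \<in> separating_open b \<longleftrightarrow> b \<in> I}"

lemma cell_measurable [measurable]: "cell m I \<in> sets borel"
proof -
  have "cell m I = (\<Inter>b\<in>{..<m}. if b \<in> I then separating_open b else - separating_open b)"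
    by (auto simp: cell_def)
  also have "\<dots> \<in> sets borel"
  proof (cases "m = 0")
    case False
    then show ?thesis
      by (intro sets.finite_INT) (auto intro!: borel_open borel_comp open_separating)
  qed simp
  finally show ?thesis .
qed

lemma cell_disjoint: "I \<subseteq> {..<m} \<Longrightarrow> I' \<subseteq> {..<m} \<Longrightarrow> I \<noteq> I' \<Longrightarrow> cell m I \<inter> cell m I' = {}"
  by (auto simp: cell_def)

lemma in_own_cell: "s \<in> cell m {b. b < m \<and> s \<in> separating_open b}"
  by (auto simp: cell_def)

text \<open>Interpreted twice, with rate \<theta> for the points behind \<open>P\<close> and with
  rate \<theta> / J for the points behind \<open>T\<^sub>j\<close>.\<close>

locale levy_points =
  poisson_process M "levy_intensity \<theta> G0 \<rho>" X + G0: prob_space G0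
  for M :: "'w measure" and \<theta> :: real and G0 :: "'a::{second_countable_topology, t2_space} measure"
    and \<rho> :: "real \<Rightarrow> real" and X :: "nat \<Rightarrow> 'w \<Rightarrow> real \<times> 'a" +
  assumes \<theta>: "0 < \<theta>"
    and \<rho>_measurable [measurable]: "\<rho> \<in> borel_measurable borel"
    and \<rho>_nonneg: "\<And>x. 0 < x \<Longrightarrow> 0 \<le> \<rho> x"
    and \<rho>_finite: "\<And>u. 0 < u \<Longrightarrow>
      (\<integral>\<^sup>+x\<in>{0<..}. ennreal ((1 - exp (- u * x)) * \<rho> x) \<partial>lborel) < \<infinity>"
    and sets_G0: "sets G0 = sets borel"
    and diffuse: "\<And>s. emeasure G0 {s} = 0"
begin

abbreviation "\<nu> \<equiv> levy_intensity \<theta> G0 \<rho>"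

definition jump_law :: "real measure" where
  "jump_law = density lborel (\<lambda>x. ennreal (\<theta> * \<rho> x) * indicator {0<..} x)"

lemma sets_jump_law [measurable_cong]: "sets jump_law = sets borel"
  by (simp add: jump_law_def)

lemma levy_eq: "\<nu> = jump_law \<Otimes>\<^sub>M G0"
  by (simp add: jump_law_def levy_intensity_def)

lemmas G0_cong [measurable_cong] = sets_G0

lemma sets_levy [measurable_cong]: "sets \<nu> = sets (borel \<Otimes>\<^sub>M borel)"
  unfolding levy_eq by (intro sets_pair_measure_cong sets_jump_law sets_G0)

lemma space_levy [simp]: "space \<nu> = UNIV"
  using sets_eq_imp_space_eq[OF sets_levy] by (simp add: space_pair_measure)

lemma space_G0 [simp]: "space G0 = UNIV"
  using sets_eq_imp_space_eq[OF sets_G0] by simp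

lemma X_measurable_borel: "X k \<in> measurable M (borel \<Otimes>\<^sub>M borel)"
  using X_measurable[of k] unfolding measurable_cong_sets[OF refl sets_levy] .

lemma jump_measurable [measurable]: "(\<lambda>\<omega>. fst (X k \<omega>)) \<in> borel_measurable M"
  by (rule measurable_compose[OF X_measurable_borel measurable_fst])

lemma location_measurable [measurable]: "(\<lambda>\<omega>. snd (X k \<omega>)) \<in> measurable M borel"
  by (rule measurable_compose[OF X_measurable_borel measurable_snd])

lemma emeasure_levy_Times:
  "A \<in> sets borel \<Longrightarrow> B \<in> sets borel \<Longrightarrow> emeasure \<nu> (A \<times> B) = emeasure jump_law A * emeasure G0 B"
  unfolding levy_eq by (intro G0.emeasure_pair_measure_Times) (auto simp: sets_jump_law sets_G0)

lemma nn_integral_levy_fst: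
  assumes f [measurable]: "f \<in> borel_measurable borel"
  shows "(\<integral>\<^sup>+z. f (fst z) \<partial>\<nu>) = (\<integral>\<^sup>+x\<in>{0<..}. ennreal (\<theta> * \<rho> x) * f x \<partial>lborel)"
proof -
  have "(\<integral>\<^sup>+z. f (fst z) \<partial>\<nu>) = (\<integral>\<^sup>+x. \<integral>\<^sup>+s. f (fst (x, s)) \<partial>G0 \<partial>jump_law)"
    unfolding levy_eq by (rule G0.nn_integral_fst[symmetric]) measurable
  also have "\<dots> = (\<integral>\<^sup>+x. f x \<partial>jump_law)"
    by (simp add: G0.emeasure_space_1[simplified])
  also have "\<dots> = (\<integral>\<^sup>+x. ennreal (\<theta> * \<rho> x) * indicator {0<..} x * f x \<partial>lborel)"
    unfolding jump_law_def by (intro nn_integral_density) measurable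
  finally show ?thesis
    by (simp add: mult_ac)
qed

lemma sigma_finite_levy: "sigma_finite_measure \<nu>"
proof -
  have "sigma_finite_measure jump_law"
    unfolding jump_law_def
    by (subst sigma_finite_measure.sigma_finite_iff_density_finite[OF sigma_finite_lborel]) (auto simp: ennreal_mult_less_top less_top[symmetric] indicator_def)
  then interpret jump: sigma_finite_measure jump_law .
  interpret pair_sigma_finite jump_law G0
    by unfold_locales
  show ?thesis
    unfolding levy_eq by (rule P.sigma_finite_measure_axioms)
qed

lemma jump_law_large_finite:
  assumes e: "0 < e"
  shows "emeasure jump_law {e<..} < \<infinity>"
proof -
  \<comment> \<open>For x > e the quotient of 1 - exp (- x) by 1 - exp (- e) is at least 1, so the
    constant compares the large jumps with the finite integral in \<open>\<rho>_finite\<close> at u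
    = 1.\<close>
  let ?c = "\<theta> / (1 - exp (- e))"
  have c: "0 < ?c"
    using e \<theta> by simp
  have "emeasure jump_law {e<..} = (\<integral>\<^sup>+x. ennreal (\<theta> * \<rho> x) * indicator {0<..} x * indicator {e<..} x \<partial>lborel)"
    unfolding jump_law_def by (subst emeasure_density) auto
  also have "\<dots> \<le> (\<integral>\<^sup>+x. ennreal ?c * (ennreal ((1 - exp (- 1 * x)) * \<rho> x) * indicator {0<..} x) \<partial>lborel)"
  proof (intro nn_integral_mono)
    fix x :: real
    show "ennreal (\<theta> * \<rho> x) * indicator {0<..} x * indicator {e<..} x \<le>
        ennreal ?c * (ennreal ((1 - exp (- 1 * x)) * \<rho> x) * indicator {0<..} x)"
    proof (cases "e < x")
      case True
      then have "1 * (\<theta> * \<rho> x) \<le> (1 - exp (- x)) / (1 - exp (- e)) * (\<theta> * \<rho> x)"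
        using e \<theta> \<rho>_nonneg[of x] by (intro mult_right_mono) auto
      then have "ennreal (\<theta> * \<rho> x) \<le> ennreal (?c * ((1 - exp (- x)) * \<rho> x))"
        by (intro ennreal_leI) (simp add: mult_ac)
      also have "\<dots> = ennreal ?c * ennreal ((1 - exp (- x)) * \<rho> x)"
        using c by (intro ennreal_mult') auto
      finally show ?thesis
        using True e by simp
    qed simp
  qed
  also have "\<dots> = ennreal ?c * (\<integral>\<^sup>+x\<in>{0<..}. ennreal ((1 - exp (- 1 * x)) * \<rho> x) \<partial>lborel)"
    by (subst nn_integral_cmult) auto
  also have "\<dots> < \<infinity>"
    using \<rho>_finite[of 1] by (simp add: ennreal_mult_less_top)
  finally show ?thesis .
qed

text \<open>The space of the intensity is all of \<open>UNIV\<close>, so positivity of the jumps is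
  not built in: it holds because the mean number of points with nonpositive jump is 0.\<close>

lemma AE_jumps_pos: "AE \<omega> in M. \<forall>k. 0 < fst (X k \<omega>)"
proof -
  let ?A = "{..0::real} \<times> (UNIV :: 'a set)"
  have A: "?A \<in> sets \<nu>"
    by (simp add: sets_levy)
  have "emeasure jump_law {..0} = 0"
    unfolding jump_law_def
    by (subst emeasure_density) (auto simp: nn_integral_0_iff_AE indicator_def)
  then have A0: "emeasure \<nu> ?A = 0"
    by (subst emeasure_levy_Times) auto
  then have "(\<integral>\<^sup>+\<omega>. point_count X ?A \<omega> \<partial>M) = 0"
    using nn_integral_point_count_eq[OF A] by simp
  then have "AE \<omega> in M. point_count X ?A \<omega> = 0"
    using point_count_measurable[OF A] by (simp add: nn_integral_0_iff_AE)
  then show ?thesis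
  proof eventually_elim
    case (elim \<omega>)
    then have "{k. X k \<omega> \<in> ?A} = {}"
      by (simp add: point_count_def emeasure_count_space_eq_0)
    then show ?case
      by (auto simp: mem_Times_iff not_le)
  qed
qed

text \<open>The sum is the probability that two independent draws from \<open>G0\<close> are not
  separated by the first m open sets. These events decrease to the diagonal, which is null by Fubini
  because \<open>G0\<close> is diffuse.\<close>

lemma cell_pairs_tendsto_0: "(\<lambda>m. \<Sum>I\<in>Pow {..<m}. (emeasure G0 (cell m I))\<^sup>2) \<longlonglongrightarrow> 0"
proof -
  define Q :: "nat \<Rightarrow> ('a \<times> 'a) set" where "Q m = (\<Union>I\<in>Pow {..<m}. cell m I \<times> cell m I)" for m
  have Q_iff: "(s, t) \<in> Q m \<longleftrightarrow> (\<forall>b<m. s \<in> separating_open b \<longleftrightarrow> t \<in> separating_open b)" for s t m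
  proof
    assume "\<forall>b<m. s \<in> separating_open b \<longleftrightarrow> t \<in> separating_open b"
    then have "t \<in> cell m {b. b < m \<and> s \<in> separating_open b}"
      by (auto simp: cell_def)
    then show "(s, t) \<in> Q m"
      using in_own_cell[of s m] by (auto simp: Q_def)
  qed (auto simp: Q_def cell_def)
  have sets_Q: "Q m \<in> sets (G0 \<Otimes>\<^sub>M G0)" for m
    unfolding Q_def by (intro sets.finite_UN pair_measureI) (auto simp: sets_G0)
  interpret G0G0: pair_prob_space G0 G0
    by unfold_locales
  have em: "emeasure (G0 \<Otimes>\<^sub>M G0) (Q m) = (\<Sum>I\<in>Pow {..<m}. (emeasure G0 (cell m I))\<^sup>2)" for m
  proof -
    have "emeasure (G0 \<Otimes>\<^sub>M G0) (Q m) = (\<Sum>I\<in>Pow {..<m}. emeasure (G0 \<Otimes>\<^sub>M G0) (cell m I \<times> cell m I))"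
      unfolding Q_def
    proof (rule sum_emeasure[symmetric])
      show "disjoint_family_on (\<lambda>I. cell m I \<times> cell m I) (Pow {..<m})"
        using cell_disjoint[of _ m] by (auto simp: disjoint_family_on_def)
    qed (auto simp: sets_G0)
    also have "\<dots> = (\<Sum>I\<in>Pow {..<m}. (emeasure G0 (cell m I))\<^sup>2)"
      by (intro sum.cong refl) (subst G0.emeasure_pair_measure_Times; simp add: sets_G0 power2_eq_square)
    finally show ?thesis .
  qed
  have diag: "(\<Inter>m. Q m) = {(s, t). s = t}"
  proof (intro set_eqI iffI)
    fix p assume p: "p \<in> (\<Inter>m. Q m)"
    obtain s t where [simp]: "p = (s, t)"
      by (cases p)
    have "s \<in> separating_open b \<longleftrightarrow> t \<in> separating_open b" for b
      using p Q_iff[of s t "Suc b"] by auto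
    then show "p \<in> {(s, t). s = t}"
      using separating_open_separates[of s t] by auto
  qed (auto simp: Q_iff)
  have "{(s, t). s = t} \<in> sets (G0 \<Otimes>\<^sub>M G0)"
    unfolding diag[symmetric] using sets_Q by auto
  then have "emeasure (G0 \<Otimes>\<^sub>M G0) {(s, t). s = t} = (\<integral>\<^sup>+s. emeasure G0 (Pair s -` {(s, t). s = t}) \<partial>G0)"
    by (rule G0.emeasure_pair_measure_alt)
  also have "\<dots> = (\<integral>\<^sup>+s. emeasure G0 {s} \<partial>G0)"
    by (intro nn_integral_cong arg_cong2[where f = emeasure] refl) auto
  finally have "emeasure (G0 \<Otimes>\<^sub>M G0) (\<Inter>m. Q m) = 0"
    by (simp add: diag diffuse)
  moreover have "(\<lambda>m. emeasure (G0 \<Otimes>\<^sub>M G0) (Q m)) \<longlonglongrightarrow> emeasure (G0 \<Otimes>\<^sub>M G0) (\<Inter>m. Q m)"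
  proof (rule Lim_emeasure_decseq)
    show "decseq Q"
    proof (rule decseq_SucI, rule subsetI)
      fix m p assume "p \<in> Q (Suc m)"
      then show "p \<in> Q m"
        by (cases p) (auto simp: Q_iff)
    qed
  qed (use sets_Q in \<open>auto simp: G0G0.emeasure_eq_measure\<close>)
  ultimately show ?thesis
    by (simp add: em)
qed

text \<open>Jumps above a level e have finite intensity, and a coincidence among them puts two
  points in one cell at every level m; the probability of that is bounded by a multiple of the sum
  in \<open>cell_pairs_tendsto_0\<close>. Small jumps may have infinite intensity, so e tends to 0
  along 1 / (r + 1) only at the end.\<close>

lemma AE_locations_distinct: "AE \<omega> in M. inj (\<lambda>k. snd (X k \<omega>))"
proof -
  have "AE \<omega> in M. \<forall>k l. k \<noteq> l \<longrightarrow> e < fst (X k \<omega>) \<longrightarrow> e < fst (X l \<omega>) \<longrightarrow> snd (X k \<omega>) \<noteq> snd (X l \<omega>)"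
    if e: "0 < e" for e :: real
  proof -
    let ?A = "\<lambda>m I. {e<..} \<times> cell m I"
    define N where "N m = (\<Union>I\<in>Pow {..<m}. {\<omega>\<in>space M. \<exists>k l. k \<noteq> l \<and> X k \<omega> \<in> ?A m I \<and> X l \<omega> \<in> ?A m I})" for m
    have A [measurable]: "?A m I \<in> sets \<nu>" for m I
      by (simp add: sets_levy)
    have two_points: "{\<omega>\<in>space M. \<exists>k l. k \<noteq> l \<and> X k \<omega> \<in> B \<and> X l \<omega> \<in> B} \<in> sets M"
      if [measurable]: "B \<in> sets \<nu>" for B
      by measurable
    have N [measurable]: "N m \<in> sets M" for m
      unfolding N_def by (intro sets.finite_UN two_points A) auto
    let ?c = "emeasure jump_law {e<..}"
    have c: "?c < \<infinity>"
      by (rule jump_law_large_finite[OF e])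
    have "emeasure M (N m) \<le> ?c\<^sup>2 * (\<Sum>I\<in>Pow {..<m}. (emeasure G0 (cell m I))\<^sup>2)" for m
    proof -
      have "emeasure M (N m) \<le> (\<Sum>I\<in>Pow {..<m}.
          emeasure M {\<omega>\<in>space M. \<exists>k l. k \<noteq> l \<and> X k \<omega> \<in> ?A m I \<and> X l \<omega> \<in> ?A m I})"
        unfolding N_def by (intro emeasure_subadditive_finite) auto
      also have "\<dots> \<le> (\<Sum>I\<in>Pow {..<m}. (?c * emeasure G0 (cell m I))\<^sup>2)"
      proof (intro sum_mono)
        fix I
        have "emeasure \<nu> (?A m I) = ?c * emeasure G0 (cell m I)"
          by (intro emeasure_levy_Times) auto
        moreover have "\<dots> < \<infinity>"
          using c by (simp add: ennreal_mult_less_top G0.emeasure_eq_measure)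
        ultimately show "emeasure M {\<omega>\<in>space M. \<exists>k l. k \<noteq> l \<and> X k \<omega> \<in> ?A m I \<and> X l \<omega> \<in> ?A m I} \<le>
            (?c * emeasure G0 (cell m I))\<^sup>2"
          using emeasure_two_points_le[OF A, of m I] by simp
      qed
      finally show ?thesis
        by (simp add: power_mult_distrib sum_distrib_left)
    qed
    then have le: "emeasure M (\<Inter>m. N m) \<le> ?c\<^sup>2 * (\<Sum>I\<in>Pow {..<m}. (emeasure G0 (cell m I))\<^sup>2)" for m
      by (rule order_trans[rotated]) (intro emeasure_mono, auto)
    have "(\<lambda>m. ?c\<^sup>2 * (\<Sum>I\<in>Pow {..<m}. (emeasure G0 (cell m I))\<^sup>2)) \<longlonglongrightarrow> ?c\<^sup>2 * 0"
      using c by (intro tendsto_mult_ennreal cell_pairs_tendsto_0 tendsto_const)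
        (auto simp: power_eq_top_ennreal less_top)
    then have "emeasure M (\<Inter>m. N m) \<le> ?c\<^sup>2 * 0"
      by (rule LIMSEQ_le_const) (use le in auto)
    then have "(\<Inter>m. N m) \<in> null_sets M"
      by (intro null_setsI) auto
    then have "AE \<omega> in M. \<omega> \<notin> (\<Inter>m. N m)"
      by (rule AE_not_in)
    with AE_space show ?thesis
    proof eventually_elim
      case (elim \<omega>)
      show ?case
      proof (intro allI impI notI)
        fix k l assume kl: "k \<noteq> l" "e < fst (X k \<omega>)" "e < fst (X l \<omega>)" "snd (X k \<omega>) = snd (X l \<omega>)"
        have "\<omega> \<in> N m" for m
        proof -
          let ?I = "{b. b < m \<and> snd (X k \<omega>) \<in> separating_open b}"
          have "X k \<omega> \<in> ?A m ?I" "X l \<omega> \<in> ?A m ?I"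
            using kl in_own_cell[of "snd (X k \<omega>)" m] by (auto simp: mem_Times_iff)
          then have "\<omega> \<in> {\<omega>\<in>space M. \<exists>k l. k \<noteq> l \<and> X k \<omega> \<in> ?A m ?I \<and> X l \<omega> \<in> ?A m ?I}"
            using elim(1) kl(1) by (intro CollectI conjI exI[of _ k] exI[of _ l])
          then show ?thesis
            unfolding N_def by (rule UN_I[rotated]) auto
        qed
        then show False
          using elim(2) by blast
      qed
    qed
  qed
  then have "AE \<omega> in M. \<forall>r. \<forall>k l. k \<noteq> l \<longrightarrow> 1 / real (Suc r) < fst (X k \<omega>) \<longrightarrow>
      1 / real (Suc r) < fst (X l \<omega>) \<longrightarrow> snd (X k \<omega>) \<noteq> snd (X l \<omega>)"
    by (subst AE_all_countable) simp
  with AE_jumps_pos show ?thesis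
  proof eventually_elim
    case (elim \<omega>)
    show ?case
    proof (rule injI, rule ccontr)
      fix k l assume kl: "snd (X k \<omega>) = snd (X l \<omega>)" "k \<noteq> l"
      obtain r where "1 / real (Suc r) < min (fst (X k \<omega>)) (fst (X l \<omega>))"
        using elim(1) nat_approx_posE[of "min (fst (X k \<omega>)) (fst (X l \<omega>))"] by auto
      then show False
        using elim(2) kl by auto
    qed
  qed
qed

text \<open>The null sets of bad tuples can be avoided only within boxes of disjoint sides and
  finite intensity. Distinct locations and positive jumps ensure that almost surely, for each n, the
  first n points lie in one of countably many such boxes.\<close>

lemma AE_hash_law_locations:
  fixes H :: "('a \<Rightarrow> nat) measure"
  assumes "universal_hash H J"
  shows "AE \<omega> in M. \<forall>n l. (\<forall>i<n. l i \<in> {1..J}) \<longrightarrow>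
    measure H {h\<in>space H. \<forall>i<n. h (snd (X i \<omega>)) = l i} = 1 / real J ^ n"
proof -
  interpret H: universal_hash H J by fact
  let ?good = "\<lambda>n l x. measure H {h\<in>space H. \<forall>i<n. h (snd (x i)) = l i} = 1 / real J ^ n"
  \<comment> \<open>Injectivity of \<open>I\<close> makes the cells, hence the sides
    \<open>A i\<close>, disjoint; the threshold e on the jumps makes their intensity finite.\<close>
  have box: "AE \<omega> in M. (\<forall>i<n. e < fst (X i \<omega>) \<and> snd (X i \<omega>) \<in> cell m (I i)) \<longrightarrow>
      ?good n l (\<lambda>i. X i \<omega>)"
    if e: "0 < e" and I: "I \<in> Pi\<^sub>E {..<n} (\<lambda>_. Pow {..<m})" "inj_on I {..<n}"
      and l: "l \<in> Pi\<^sub>E {..<n} (\<lambda>_. {1..J})" for e :: real and n m I l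
  proof -
    define A where "A i = {e<..} \<times> (cell m (I i) :: 'a set)" for i
    let ?D = "\<lambda>i. density \<nu> (indicator (A i))"
    have A [measurable]: "A i \<in> sets \<nu>" for i
      by (simp add: A_def sets_levy)
    have D: "product_sigma_finite ?D"
    proof (rule product_sigma_finite.intro)
      show "sigma_finite_measure (?D i)" for i
        using A by (subst sigma_finite_measure.sigma_finite_iff_density_finite[OF sigma_finite_levy])
          (auto intro!: borel_measurable_indicator AE_I2 simp: indicator_def)
    qed
    have snd_D: "snd \<in> measurable (?D i) borel" for i
      unfolding measurable_cong_sets[OF sets_density refl] measurable_cong_sets[OF sets_levy refl]
      by (rule measurable_snd)
    have diffuse_D: "emeasure (?D i) {z\<in>space (?D i). snd z = y} = 0" for i and y :: 'a
    proof -
      have eq: "{z\<in>space (?D i). snd z = y} = UNIV \<times> {y}"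
        by auto
      have Y: "UNIV \<times> {y} \<in> null_sets \<nu>"
        using diffuse by (intro null_setsI) (auto simp: emeasure_levy_Times sets_levy)
      have "(\<integral>\<^sup>+z. indicator (A i) z * indicator (UNIV \<times> {y}) z \<partial>\<nu>) = 0"
        by (rule nn_integral_null_set[OF Y])
      then show ?thesis
        unfolding eq using null_setsD2[OF Y] by (subst emeasure_density) auto
    qed
    let ?P = "Pi\<^sub>M {..<n} ?D"
    define Bad where "Bad = {x\<in>space ?P. \<not> ?good n l x}"
    have "AE x in ?P. ?good n l x"
    proof (rule H.AE_hash_law[where \<nu> = ?D and S = snd and n = n and l = l, OF D snd_D diffuse_D])
      show "l i \<in> {1..J}" if "i < n" for i
        using PiE_mem[OF l, of i] that by simp
    qed simp
    moreover have "Bad \<in> sets ?P"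
    proof -
      have comp: "(\<lambda>x. snd (x i)) \<in> measurable ?P borel" if "i < n" for i
      proof -
        have "(\<lambda>x. x i) \<in> measurable ?P (?D i)"
          using that by (intro measurable_component_singleton) simp
        then show ?thesis
          by (rule measurable_compose) (rule snd_D)
      qed
      have "(\<lambda>x. measure H {h\<in>space H. \<forall>i<n. h (snd (x i)) = l i}) \<in> borel_measurable ?P"
        by (rule H.pattern_measurable[of n "\<lambda>i x. snd (x i)", OF comp])
      then have "(\<lambda>x. measure H {h\<in>space H. \<forall>i<n. h (snd (x i)) = l i}) -` (- {1 / real J ^ n}) \<inter>
          space ?P \<in> sets ?P"
        by (rule measurable_sets) simp
      moreover have "Bad = (\<lambda>x. measure H {h\<in>space H. \<forall>i<n. h (snd (x i)) = l i}) -` (- {1 / real J ^ n}) \<inter>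
          space ?P"
        unfolding Bad_def by blast
      ultimately show ?thesis
        by (simp only:)
    qed
    ultimately have Bad: "Bad \<in> null_sets ?P"
      unfolding Bad_def using AE_iff_null[of ?P "?good n l"] by blast
    have "AE \<omega> in M. (\<forall>i<n. X i \<omega> \<in> A i) \<longrightarrow> (\<lambda>i\<in>{..<n}. X i \<omega>) \<notin> Bad"
    proof (rule AE_tuple_avoids_null_set[OF sigma_finite_levy A _ _ Bad])
      show "emeasure \<nu> (A i) < \<infinity>" for i
        using jump_law_large_finite[OF e]
        by (simp add: A_def emeasure_levy_Times ennreal_mult_less_top G0.emeasure_eq_measure)
      show "disjoint_family_on A {..<n}"
      proof (unfold disjoint_family_on_def, intro ballI impI)
        fix i k assume ik: "i \<in> {..<n}" "k \<in> {..<n}" "i \<noteq> k"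
        have "cell m (I i) \<inter> cell m (I k) = ({} :: 'a set)"
          using ik I PiE_mem[OF I(1)] by (intro cell_disjoint) (auto simp: inj_on_def)
        then show "A i \<inter> A k = {}"
          by (auto simp: A_def)
      qed
    qed
    with AE_space show ?thesis
    proof eventually_elim
      case (elim \<omega>)
      show ?case
      proof
        assume "\<forall>i<n. e < fst (X i \<omega>) \<and> snd (X i \<omega>) \<in> cell m (I i)"
        then have "\<forall>i<n. X i \<omega> \<in> A i"
          by (auto simp: A_def mem_Times_iff)
        then have "(\<lambda>i\<in>{..<n}. X i \<omega>) \<notin> Bad"
          using elim by blast
        moreover have "(\<lambda>i\<in>{..<n}. X i \<omega>) \<in> space ?P"
          by (auto simp: space_PiM)
        ultimately have "?good n l (\<lambda>i\<in>{..<n}. X i \<omega>)"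
          by (simp only: Bad_def mem_Collect_eq simp_thms)
        moreover have "{h\<in>space H. \<forall>i<n. h (snd ((\<lambda>i\<in>{..<n}. X i \<omega>) i)) = l i} =
            {h\<in>space H. \<forall>i<n. h (snd (X i \<omega>)) = l i}"
          by auto
        ultimately show "?good n l (\<lambda>i. X i \<omega>)"
          by (simp only:)
      qed
    qed
  qed
  \<comment> \<open>For each \<open>n\<close>, \<open>m\<close>, \<open>r\<close> only finitely many
    \<open>I\<close> and \<open>l\<close> occur, so the exceptional sets form a countable union of
    null sets.\<close>
  have "AE \<omega> in M. \<forall>n m r. \<forall>I\<in>{I \<in> Pi\<^sub>E {..<n} (\<lambda>_. Pow {..<m}). inj_on I {..<n}}.
      \<forall>l\<in>Pi\<^sub>E {..<n} (\<lambda>_. {1..J}).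
      (\<forall>i<n. 1 / real (Suc r) < fst (X i \<omega>) \<and> snd (X i \<omega>) \<in> cell m (I i)) \<longrightarrow> ?good n l (\<lambda>i. X i \<omega>)"
  proof -
    have fin_I: "finite {I \<in> Pi\<^sub>E {..<n} (\<lambda>_. Pow {..<m}). inj_on I {..<n}}" for n m :: nat
      by (rule finite_subset[of _ "Pi\<^sub>E {..<n} (\<lambda>_. Pow {..<m})"]) (auto intro!: finite_PiE)
    have fin_l: "finite (Pi\<^sub>E {..<n} (\<lambda>_. {1..J}))" for n :: nat
      by (intro finite_PiE) auto
    show ?thesis
      by (intro AE_all_countable[THEN iffD2] allI AE_finite_allI fin_I fin_l box)
        (auto simp del: PiE_iff)
  qed
  with AE_jumps_pos AE_locations_distinct show ?thesis
  proof eventually_elim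
    case (elim \<omega>)
    show ?case
    proof (intro allI impI)
      fix n and l :: "nat \<Rightarrow> nat" assume l: "\<forall>i<n. l i \<in> {1..J}"
      let ?s = "\<lambda>i. snd (X i \<omega>)"
      have "\<exists>b. ?s i \<in> separating_open b \<and> ?s k \<notin> separating_open b" if "i \<noteq> k" for i k
        using that elim(2) by (intro separating_open_separates) (auto simp: inj_def)
      then obtain b where b: "\<And>i k. i \<noteq> k \<Longrightarrow> ?s i \<in> separating_open (b i k) \<and> ?s k \<notin> separating_open (b i k)"
        by metis
      \<comment> \<open>Larger than every index that separates two of the first n locations, so
        their cells at level m differ. The inserted 0 keeps the maximum defined when n = 0.\<close>
      define m where "m = Suc (Max (insert 0 ((\<lambda>(i, k). b i k) ` ({..<n} \<times> {..<n}))))"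
      have bm: "b i k < m" if "i < n" "k < n" for i k
        using that unfolding m_def less_Suc_eq_le by (intro Max_ge) auto
      define I where "I = (\<lambda>i\<in>{..<n}. {b. b < m \<and> ?s i \<in> separating_open b})"
      have "inj_on I {..<n}"
      proof (rule inj_onI, rule ccontr)
        fix i k assume ik: "i \<in> {..<n}" "k \<in> {..<n}" "I i = I k" "i \<noteq> k"
        then have "b i k \<in> I i" "b i k \<notin> I k"
          using b[OF ik(4)] bm[of i k] by (auto simp: I_def)
        then show False
          using ik(3) by simp
      qed
      moreover have "I \<in> Pi\<^sub>E {..<n} (\<lambda>_. Pow {..<m})"
        by (auto simp: I_def)
      moreover obtain r where r: "1 / real (Suc r) < Min (insert 1 ((\<lambda>i. fst (X i \<omega>)) ` {..<n}))"
        using elim(1) nat_approx_posE[of "Min (insert 1 ((\<lambda>i. fst (X i \<omega>)) ` {..<n}))"] by auto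
      moreover have "1 / real (Suc r) < fst (X i \<omega>)" if "i < n" for i
        using r by (rule less_le_trans) (use that in \<open>auto intro!: Min_le\<close>)
      moreover have "?s i \<in> cell m (I i)" if "i < n" for i
        using that in_own_cell[of "?s i" m] by (simp add: I_def)
      \<comment> \<open>The almost sure statement covers patterns from a finite set of functions, so
        \<open>l\<close> is first made trivial outside the first n indices.\<close>
      moreover have "restrict l {..<n} \<in> Pi\<^sub>E {..<n} (\<lambda>_. {1..J})"
        using l by auto
      ultimately have "?good n (restrict l {..<n}) (\<lambda>i. X i \<omega>)"
        using elim(3)[rule_format, of I n m "restrict l {..<n}" r] by (simp only: mem_Collect_eq simp_thms)
      moreover have "{h\<in>space H. \<forall>i<n. h (?s i) = restrict l {..<n} i} = {h\<in>space H. \<forall>i<n. h (?s i) = l i}"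
        by auto
      ultimately show "?good n l (\<lambda>i. X i \<omega>)"
        by (simp only:)
    qed
  qed
qed

section \<open>Laplace transforms of the jumps and of the total mass\<close>

lemma laplace_jumps:
  fixes f :: "real \<Rightarrow> real"
  assumes f [measurable]: "f \<in> borel_measurable borel" and pos: "\<And>x. 0 < x \<Longrightarrow> 0 \<le> f x"
    and fin: "(\<integral>\<^sup>+x\<in>{0<..}. ennreal (\<theta> * \<rho> x * (1 - exp (- f x))) \<partial>lborel) < \<infinity>"
  shows "(\<integral>\<^sup>+\<omega>. (INF n. \<Prod>k<n. ennreal (exp (- f (fst (X k \<omega>))))) \<partial>M) =
    ennreal (exp (- enn2real (\<integral>\<^sup>+x\<in>{0<..}. ennreal (\<theta> * \<rho> x * (1 - exp (- f x))) \<partial>lborel)))"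
proof -
  \<comment> \<open>Cut off outside the positive axis, the only place where \<open>f\<close> is
    known to be nonnegative; almost surely all jumps lie there.\<close>
  define v where "v x = ennreal (1 - exp (- f x)) * indicator {0<..} x" for x
  have v_meas [measurable]: "v \<in> borel_measurable borel"
    unfolding v_def[abs_def] by measurable
  have v1: "v x \<le> 1" for x
    by (auto simp: v_def indicator_def ennreal_le_1)
  have int: "(\<integral>\<^sup>+z. v (fst z) \<partial>\<nu>) = (\<integral>\<^sup>+x\<in>{0<..}. ennreal (\<theta> * \<rho> x * (1 - exp (- f x))) \<partial>lborel)"
    unfolding nn_integral_levy_fst[OF v_meas]
    using \<theta> \<rho>_nonneg pos
    by (intro nn_integral_cong) (auto simp: v_def indicator_def ennreal_mult'[symmetric])
  have "(\<integral>\<^sup>+\<omega>. (INF n. \<Prod>k<n. ennreal (exp (- f (fst (X k \<omega>))))) \<partial>M) =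
      (\<integral>\<^sup>+\<omega>. (INF n. \<Prod>k<n. 1 - v (fst (X k \<omega>))) \<partial>M)"
  proof (rule nn_integral_cong_AE)
    show "AE \<omega> in M. (INF n. \<Prod>k<n. ennreal (exp (- f (fst (X k \<omega>))))) =
        (INF n. \<Prod>k<n. 1 - v (fst (X k \<omega>)))"
      using AE_jumps_pos
    proof eventually_elim
      case (elim \<omega>)
      have "1 - v x = ennreal (exp (- f x))" if "0 < x" for x
      proof -
        have "v x = ennreal (1 - exp (- f x))"
          using that by (simp add: v_def)
        moreover have "ennreal 1 - ennreal (1 - exp (- f x)) = ennreal (exp (- f x))"
          using pos[OF that] by (subst ennreal_minus) auto
        ultimately show ?thesis
          by simp
      qed
      then show ?case
        using elim by simp
    qed
  qed
  also have "\<dots> = ennreal (exp (- enn2real (\<integral>\<^sup>+z. v (fst z) \<partial>\<nu>)))"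
  proof (rule laplace_functional)
    have "(\<lambda>z. v (fst z)) \<in> borel_measurable (borel \<Otimes>\<^sub>M (borel :: 'a measure))"
      by measurable
    then show "(\<lambda>z. v (fst z)) \<in> borel_measurable \<nu>"
      unfolding measurable_cong_sets[OF sets_levy refl] .
  qed (use v1 fin int in auto)
  finally show ?thesis
    unfolding int .
qed

end

lemma total_mass_jump_measure:
  "total_mass (jump_measure X) \<omega> = (\<Sum>k. ennreal (fst (X k \<omega>)))"
proof -
  have "total_mass (jump_measure X) \<omega> =
      emeasure (density (count_space UNIV) (\<lambda>k. ennreal (fst (X k \<omega>)))) UNIV"
    unfolding total_mass_def jump_measure_def by (subst emeasure_distr) auto
  also have "\<dots> = (\<Sum>k. ennreal (fst (X k \<omega>)))"
    by (subst emeasure_density) (auto simp: nn_integral_count_space_nat)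
  finally show ?thesis .
qed

context levy_points
begin

lemma laplace_exponent_finite:
  assumes u: "0 < u"
  shows "(\<integral>\<^sup>+x\<in>{0<..}. ennreal (\<theta> * \<rho> x * (1 - exp (- (u * x)))) \<partial>lborel) < \<infinity>"
proof -
  have "(\<integral>\<^sup>+x\<in>{0<..}. ennreal (\<theta> * \<rho> x * (1 - exp (- (u * x)))) \<partial>lborel) =
      (\<integral>\<^sup>+x. ennreal \<theta> * (ennreal ((1 - exp (- u * x)) * \<rho> x) * indicator {0<..} x) \<partial>lborel)"
    using \<theta> by (intro nn_integral_cong) (auto simp: indicator_def ennreal_mult'[symmetric] mult_ac)
  also have "\<dots> = ennreal \<theta> * (\<integral>\<^sup>+x\<in>{0<..}. ennreal ((1 - exp (- u * x)) * \<rho> x) \<partial>lborel)"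
    by (intro nn_integral_cmult) measurable
  finally show ?thesis
    using \<rho>_finite[OF u] by (simp add: ennreal_mult_less_top)
qed

text \<open>With exp of minus infinity read as 0, the Laplace transform of the total mass at any u >
  0 is at most the probability that the mass is finite. As u tends to 0 along 1 / (m + 1), the
  exponent tends to 0 by dominated convergence, so that probability is 1.\<close>

lemma AE_jumps_summable: "AE \<omega> in M. summable (\<lambda>k. fst (X k \<omega>))"
proof -
  define u where "u m = 1 / real (Suc m)" for m
  have u: "0 < u m" "u m \<le> 1" for m
    by (auto simp: u_def)
  define T where "T \<omega> = (\<Sum>k. ennreal (fst (X k \<omega>)))" for \<omega>
  have T [measurable]: "T \<in> borel_measurable M"
    unfolding T_def[abs_def] by measurable
  define I where "I m = (\<integral>\<^sup>+x\<in>{0<..}. ennreal (\<theta> * \<rho> x * (1 - exp (- (u m * x)))) \<partial>lborel)" for m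
  have I_fin: "I m < \<infinity>" for m
    unfolding I_def by (rule laplace_exponent_finite[OF u(1)])
  have "I \<longlonglongrightarrow> (\<integral>\<^sup>+(x::real). 0 \<partial>lborel)"
    unfolding I_def
  proof (rule nn_integral_dominated_convergence[where
        w = "\<lambda>x. ennreal (\<theta> * \<rho> x * (1 - exp (- (1 * x)))) * indicator {0<..} x"])
    show "AE x in lborel. ennreal (\<theta> * \<rho> x * (1 - exp (- (u m * x)))) * indicator {0<..} x \<le>
        ennreal (\<theta> * \<rho> x * (1 - exp (- (1 * x)))) * indicator {0<..} x" for m
      using \<theta> \<rho>_nonneg u[of m]
      by (intro AE_I2) (auto simp: indicator_def intro!: ennreal_leI mult_left_mono)
    show "AE x in lborel. (\<lambda>m. ennreal (\<theta> * \<rho> x * (1 - exp (- (u m * x)))) * indicator {0<..} x) \<longlonglongrightarrow> 0"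
    proof (intro AE_I2)
      fix x :: real
      have "u \<longlonglongrightarrow> 0"
        unfolding u_def by (rule lim_1_over_n[THEN LIMSEQ_Suc])
      then have "(\<lambda>m. ennreal (\<theta> * \<rho> x * (1 - exp (- (u m * x))))) \<longlonglongrightarrow>
          ennreal (\<theta> * \<rho> x * (1 - exp (- (0 * x))))"
        by (intro tendsto_ennrealI tendsto_intros)
      then show "(\<lambda>m. ennreal (\<theta> * \<rho> x * (1 - exp (- (u m * x)))) * indicator {0<..} x) \<longlonglongrightarrow> 0"
        by (cases "0 < x") auto
    qed
  qed (use laplace_exponent_finite[of 1] in auto)
  then have "(\<lambda>m. ennreal (exp (- enn2real (I m)))) \<longlonglongrightarrow> ennreal (exp (- 0))"
    by (intro tendsto_ennrealI tendsto_intros) auto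
  moreover have "ennreal (exp (- enn2real (I m))) \<le> emeasure M {\<omega>\<in>space M. T \<omega> < \<infinity>}" for m
  proof -
    have "ennreal (exp (- enn2real (I m))) =
        (\<integral>\<^sup>+\<omega>. (INF n. \<Prod>k<n. ennreal (exp (- (u m * fst (X k \<omega>))))) \<partial>M)"
      unfolding I_def using u(1)[of m] laplace_exponent_finite[OF u(1)]
      by (intro laplace_jumps[symmetric]) auto
    also have "\<dots> \<le> (\<integral>\<^sup>+\<omega>. indicator {\<omega>\<in>space M. T \<omega> < \<infinity>} \<omega> \<partial>M)"
    proof (rule nn_integral_mono_AE)
      show "AE \<omega> in M. (INF n. \<Prod>k<n. ennreal (exp (- (u m * fst (X k \<omega>))))) \<le>
          indicator {\<omega>\<in>space M. T \<omega> < \<infinity>} \<omega>"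
        using AE_jumps_pos AE_space
      proof eventually_elim
        case (elim \<omega>)
        have nn: "0 \<le> u m * fst (X k \<omega>)" "0 \<le> fst (X k \<omega>)" for k
          using elim(1)[rule_format, of k] u(1)[of m] by auto
        show ?case
        proof (cases "summable (\<lambda>k. u m * fst (X k \<omega>))")
          case True
          then have "summable (\<lambda>k. fst (X k \<omega>))"
            using u(1)[of m] by (subst (asm) summable_cmult_iff) auto
          then have "T \<omega> < \<infinity>"
            using nn(2) by (simp add: T_def suminf_ennreal2)
          then show ?thesis
            using True nn(1) elim(2)
            by (subst INF_prod_exp) (auto simp: ennreal_le_1 intro!: suminf_nonneg)
        next
          case False
          then show ?thesis
            using nn(1) by (subst INF_prod_exp) auto
        qed
      qed
    qed
    also have "\<dots> = emeasure M {\<omega>\<in>space M. T \<omega> < \<infinity>}"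
      by simp
    finally show ?thesis .
  qed
  ultimately have "ennreal (exp (- 0)) \<le> emeasure M {\<omega>\<in>space M. T \<omega> < \<infinity>}"
    by (intro LIMSEQ_le_const2) auto
  then have "prob {\<omega>\<in>space M. T \<omega> < \<infinity>} = 1"
    by (intro antisym prob_le_1) (simp add: emeasure_eq_measure)
  then have "AE \<omega> in M. \<omega> \<in> {\<omega>\<in>space M. T \<omega> < \<infinity>}"
    by (rule AE_prob_1)
  with AE_jumps_pos show ?thesis
  proof eventually_elim
    case (elim \<omega>)
    then show ?case
      by (intro summable_suminf_not_top) (auto simp: T_def less_imp_le)
  qed
qed

lemma laplace_total_mass:
  assumes u: "0 < u"
  shows "(\<integral>\<^sup>+\<omega>. ennreal (exp (- (u * enn2real (total_mass (jump_measure X) \<omega>)))) \<partial>M) =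
    ennreal (exp (- enn2real (\<integral>\<^sup>+x\<in>{0<..}. ennreal (\<theta> * \<rho> x * (1 - exp (- (u * x)))) \<partial>lborel)))"
proof -
  have "(\<integral>\<^sup>+\<omega>. ennreal (exp (- (u * enn2real (total_mass (jump_measure X) \<omega>)))) \<partial>M) =
      (\<integral>\<^sup>+\<omega>. (INF n. \<Prod>k<n. ennreal (exp (- (u * fst (X k \<omega>))))) \<partial>M)"
  proof (rule nn_integral_cong_AE)
    show "AE \<omega> in M. ennreal (exp (- (u * enn2real (total_mass (jump_measure X) \<omega>)))) =
        (INF n. \<Prod>k<n. ennreal (exp (- (u * fst (X k \<omega>)))))"
      using AE_jumps_pos AE_jumps_summable
    proof eventually_elim
      case (elim \<omega>)
      have nn: "0 \<le> fst (X k \<omega>)" for k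
        using elim(1) by (simp add: less_imp_le)
      have "enn2real (total_mass (jump_measure X) \<omega>) = (\<Sum>k. fst (X k \<omega>))"
        unfolding total_mass_jump_measure using nn elim(2)
        by (simp add: suminf_ennreal2 suminf_nonneg)
      then show ?case
        using nn u elim(2) by (subst INF_prod_exp) (auto simp: suminf_mult)
    qed
  qed
  also have "\<dots> = ennreal (exp (- enn2real
      (\<integral>\<^sup>+x\<in>{0<..}. ennreal (\<theta> * \<rho> x * (1 - exp (- (u * x)))) \<partial>lborel)))"
    using u laplace_exponent_finite[OF u] by (intro laplace_jumps) auto
  finally show ?thesis .
qed

text \<open>Summability enters because \<open>enn2real\<close> would send an infinite total mass to
  0.\<close>

lemma AE_total_mass_pos: "AE \<omega> in M. 0 < enn2real (total_mass (jump_measure X) \<omega>)"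
  using AE_jumps_pos AE_jumps_summable
proof eventually_elim
  case (elim \<omega>)
  have nn: "0 \<le> fst (X k \<omega>)" for k
    using elim(1) by (simp add: less_imp_le)
  have "0 < (\<Sum>k. fst (X k \<omega>))"
    using elim by (intro suminf_pos) auto
  then show ?case
    unfolding total_mass_jump_measure using nn elim(2)
    by (simp add: suminf_ennreal2)
qed

end

lemma levy_points_nggp:
  assumes pp: "poisson_points M (levy_intensity \<theta> G0 (nggp_jump_density \<alpha> \<tau>)) X"
    and \<theta>: "0 < \<theta>" and \<alpha>: "0 < \<alpha>" "\<alpha> < 1" and \<tau>: "0 < \<tau>"
    and G0: "prob_space G0" "sets G0 = sets borel" "\<forall>s. emeasure G0 {s} = 0"
  shows "levy_points M \<theta> (G0 :: 'a::{second_countable_topology, t2_space} measure)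
    (nggp_jump_density \<alpha> \<tau>) X"
proof -
  interpret poisson_process M "levy_intensity \<theta> G0 (nggp_jump_density \<alpha> \<tau>)" X
    using pp by (simp add: poisson_points_iff)
  show ?thesis
    using \<theta> G0 \<alpha> nggp_laplace_exponent[OF \<alpha> \<tau>] nggp_jump_density_nonneg[OF \<alpha>(2)]
    by (intro levy_points.intro levy_points_axioms.intro poisson_process_axioms)
      (auto simp: less_imp_le)
qed

lemma nggp_scaled_laplace_exponent:
  assumes \<theta>: "0 < \<theta>" and \<alpha>: "0 < \<alpha>" "\<alpha> < 1" and \<tau>: "0 < \<tau>" and u: "0 \<le> u"
  shows "(\<integral>\<^sup>+x\<in>{0<..}. ennreal (\<theta> * nggp_jump_density \<alpha> \<tau> x * (1 - exp (- (u * x)))) \<partial>lborel) =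
    ennreal (\<theta> * (((\<tau> + u) powr \<alpha> - \<tau> powr \<alpha>) / \<alpha>))"
proof -
  have "(\<integral>\<^sup>+x\<in>{0<..}. ennreal (\<theta> * nggp_jump_density \<alpha> \<tau> x * (1 - exp (- (u * x)))) \<partial>lborel) =
      (\<integral>\<^sup>+x. ennreal \<theta> * (ennreal ((1 - exp (- u * x)) * nggp_jump_density \<alpha> \<tau> x) *
        indicator {0<..} x) \<partial>lborel)"
    using \<theta> by (intro nn_integral_cong) (auto simp: indicator_def ennreal_mult'[symmetric] mult_ac)
  also have "\<dots> = ennreal \<theta> * ennreal (((\<tau> + u) powr \<alpha> - \<tau> powr \<alpha>) / \<alpha>)"
    by (subst nn_integral_cmult) (simp_all only: nggp_laplace_exponent[OF \<alpha> \<tau> u], measurable)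
  finally show ?thesis
    unfolding ennreal_mult'[OF less_imp_le[OF \<theta>]] .
qed


section \<open>Moments of the size-biased weight\<close>

lemma nn_integral_scale:
  fixes f :: "real \<Rightarrow> ennreal"
  assumes [measurable]: "f \<in> borel_measurable borel" and t: "0 < t"
  shows "(\<integral>\<^sup>+v. ennreal t * f (t * v) \<partial>lborel) = (\<integral>\<^sup>+x. f x \<partial>lborel)"
  using t by (subst nn_integral_real_affine[of f t 0]) (auto simp: nn_integral_cmult)

lemma nn_integral_shift:
  fixes f :: "real \<Rightarrow> ennreal"
  assumes [measurable]: "f \<in> borel_measurable borel"
  shows "(\<integral>\<^sup>+y. f (x + y) \<partial>lborel) = (\<integral>\<^sup>+t. f t \<partial>lborel)"
  by (subst nn_integral_real_affine[of f 1 x]) auto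

text \<open>Read v as x / (x + y), with x a size-biased jump and y the remaining mass: the
  substitutions x = t v and t = x + y leave the factor (x / (x + y)) ^ (m + 1). The Laplace integral
  for the negative power of x + y then separates x from y, at the price of one integration over
  u.\<close>

lemma V_density_moment:
  fixes fT :: "real \<Rightarrow> ennreal" and \<rho> :: "real \<Rightarrow> real"
  assumes J: "1 \<le> J" and \<theta>: "0 < \<theta>"
    and \<rho> [measurable]: "\<rho> \<in> borel_measurable borel" and \<rho>_nonneg: "\<And>x. 0 < x \<Longrightarrow> 0 \<le> \<rho> x"
    and fT [measurable]: "fT \<in> borel_measurable borel"
  shows "(\<integral>\<^sup>+v. ennreal (v ^ m) * V_density \<theta> J \<rho> fT v \<partial>lborel) =
    (\<integral>\<^sup>+u\<in>{0<..}. ennreal (\<theta> / real J * (u ^ m / fact m)) *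
      (\<integral>\<^sup>+x\<in>{0<..}. ennreal (x ^ (m + 1) * exp (- u * x) * \<rho> x) \<partial>lborel) *
      (\<integral>\<^sup>+y\<in>{0<..}. ennreal (exp (- (u * y))) * fT y \<partial>lborel) \<partial>lborel)"
proof -
  define c where "c = \<theta> / real J"
  have c: "0 < c"
    using J \<theta> by (simp add: c_def)
  \<comment> \<open>The integrand in the coordinates (t, x) with x = t v, apart from the Jacobian
    factor t. The indicator expresses 0 < v < 1.\<close>
  define F where "F t x = ennreal (c * (x / t) ^ (m + 1) * \<rho> x) * fT (t - x) * indicator {0<..<t} x" for t x
  have F_meas [measurable]: "(\<lambda>(t, x). F t x) \<in> borel_measurable (borel \<Otimes>\<^sub>M borel)"
  proof -
    have "(\<lambda>(t, x). F t x) = (\<lambda>(t, x). ennreal (c * (x / t) ^ (m + 1) * \<rho> x) * fT (t - x) *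
        indicator {0<..} x * indicator {0<..} (t - x))"
      by (auto simp: F_def indicator_def fun_eq_iff)
    then show ?thesis
      by simp
  qed
  have "(\<integral>\<^sup>+v. ennreal (v ^ m) * V_density \<theta> J \<rho> fT v \<partial>lborel) =
      (\<integral>\<^sup>+v. \<integral>\<^sup>+t. ennreal t * F t (t * v) * indicator {0<..} t \<partial>lborel \<partial>lborel)"
  proof (intro nn_integral_cong)
    fix v :: real
    show "ennreal (v ^ m) * V_density \<theta> J \<rho> fT v =
        (\<integral>\<^sup>+t. ennreal t * F t (t * v) * indicator {0<..} t \<partial>lborel)"
    proof (cases "0 < v \<and> v < 1")
      case True
      have "ennreal (v ^ m) * V_density \<theta> J \<rho> fT v = ennreal (v ^ m) * ennreal (c * v) *
          (\<integral>\<^sup>+t\<in>{0<..}. ennreal (t * \<rho> (t * v)) * fT (t * (1 - v)) \<partial>lborel)"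
        using True by (simp add: V_density_def c_def mult.assoc)
      also have "\<dots> = (\<integral>\<^sup>+t. ennreal (v ^ m) * ennreal (c * v) *
          (ennreal (t * \<rho> (t * v)) * fT (t * (1 - v)) * indicator {0<..} t) \<partial>lborel)"
        by (subst nn_integral_cmult) auto
      also have "\<dots> = (\<integral>\<^sup>+t. ennreal t * F t (t * v) * indicator {0<..} t \<partial>lborel)"
      proof (intro nn_integral_cong)
        fix t :: real
        show "ennreal (v ^ m) * ennreal (c * v) * (ennreal (t * \<rho> (t * v)) * fT (t * (1 - v)) *
            indicator {0<..} t) = ennreal t * F t (t * v) * indicator {0<..} t"
        proof (cases "0 < t")
          case t: True
          have "t * v \<in> {0<..<t}"
            using t True by simp
          moreover have "ennreal (v ^ m) * ennreal (c * v) * ennreal (t * \<rho> (t * v)) =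
              ennreal t * ennreal (c * v ^ (m + 1) * \<rho> (t * v))"
            using t True c \<rho>_nonneg[of "t * v"] by (simp add: ennreal_mult'[symmetric] mult_ac)
          moreover have "t * v / t = v" "t - t * v = t * (1 - v)"
            using t by (auto simp: algebra_simps)
          ultimately show ?thesis
            using t by (simp add: F_def mult.assoc[symmetric] del: power_Suc)
        qed simp
      qed
      finally show ?thesis .
    next
      case False
      have "ennreal t * F t (t * v) * indicator {0<..} t = 0" for t
        using False by (auto simp: F_def indicator_def zero_less_mult_iff mult_less_cancel_left1)
      moreover have "V_density \<theta> J \<rho> fT v = 0"
        using False by (auto simp: V_density_def)
      ultimately show ?thesis
        by (simp only: mult_zero_right nn_integral_0_iff_AE nn_integral_const mult_zero_left)
    qed
  qed
  also have "\<dots> = (\<integral>\<^sup>+t. \<integral>\<^sup>+v. ennreal t * F t (t * v) * indicator {0<..} t \<partial>lborel \<partial>lborel)"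
    by (rule lborel_pair.Fubini') measurable
  also have "\<dots> = (\<integral>\<^sup>+t. \<integral>\<^sup>+x. F t x * indicator {0<..} t \<partial>lborel \<partial>lborel)"
  proof (rule nn_integral_cong)
    fix t :: real
    show "(\<integral>\<^sup>+v. ennreal t * F t (t * v) * indicator {0<..} t \<partial>lborel) =
        (\<integral>\<^sup>+x. F t x * indicator {0<..} t \<partial>lborel)"
      using nn_integral_scale[of "F t" t] by (cases "0 < t") auto
  qed
  also have "\<dots> = (\<integral>\<^sup>+x. \<integral>\<^sup>+t. F t x * indicator {0<..} t \<partial>lborel \<partial>lborel)"
    by (rule lborel_pair.Fubini') measurable
  also have "\<dots> = (\<integral>\<^sup>+x. \<integral>\<^sup>+y. F (x + y) x * indicator {0<..} (x + y) \<partial>lborel \<partial>lborel)"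
    by (rule nn_integral_cong, rule nn_integral_shift[symmetric]) measurable
  also have "\<dots> = (\<integral>\<^sup>+x. \<integral>\<^sup>+y. \<integral>\<^sup>+u. ennreal (c * (u ^ m / fact m)) *
      (ennreal (x ^ (m + 1) * exp (- u * x) * \<rho> x) * indicator {0<..} x) *
      (ennreal (exp (- (u * y))) * fT y * indicator {0<..} y) * indicator {0<..} u \<partial>lborel \<partial>lborel \<partial>lborel)"
  proof (intro nn_integral_cong)
    fix x y :: real
    show "F (x + y) x * indicator {0<..} (x + y) = (\<integral>\<^sup>+u. ennreal (c * (u ^ m / fact m)) *
        (ennreal (x ^ (m + 1) * exp (- u * x) * \<rho> x) * indicator {0<..} x) *
        (ennreal (exp (- (u * y))) * fT y * indicator {0<..} y) * indicator {0<..} u \<partial>lborel)"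
    proof (cases "0 < x \<and> 0 < y")
      case True
      then have s: "0 < x + y" and \<rho>x: "0 \<le> \<rho> x"
        using \<rho>_nonneg by auto
      have "F (x + y) x * indicator {0<..} (x + y) =
          ennreal (c * x ^ (m + 1) * \<rho> x) * fT y * ennreal (1 / (x + y) ^ (m + 1))"
      proof -
        have "ennreal (c * (x / (x + y)) ^ (m + 1) * \<rho> x) =
            ennreal (c * x ^ (m + 1) * \<rho> x) * ennreal (1 / (x + y) ^ (m + 1))"
          using True s c \<rho>x
          by (subst ennreal_mult[symmetric]) (auto simp: power_divide mult_ac)
        then show ?thesis
          using True s by (simp add: F_def mult_ac)
      qed
      also have "\<dots> = (\<integral>\<^sup>+u. ennreal (c * x ^ (m + 1) * \<rho> x) * fT y *
          (ennreal (u ^ m / fact m * exp (- (x + y) * u)) * indicator {0<..} u) \<partial>lborel)"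
        by (subst nn_integral_cmult) (simp_all only: nn_integral_power_times_exp_scaled[OF s], measurable)
      also have "\<dots> = (\<integral>\<^sup>+u. ennreal (c * (u ^ m / fact m)) *
          (ennreal (x ^ (m + 1) * exp (- u * x) * \<rho> x) * indicator {0<..} x) *
          (ennreal (exp (- (u * y))) * fT y * indicator {0<..} y) * indicator {0<..} u \<partial>lborel)"
      proof (intro nn_integral_cong)
        fix u :: real
        have "ennreal (c * x ^ (m + 1) * \<rho> x) * ennreal (u ^ m / fact m * exp (- (x + y) * u)) =
            ennreal (c * (u ^ m / fact m)) * ennreal (x ^ (m + 1) * exp (- u * x) * \<rho> x) *
              ennreal (exp (- (u * y)))" if "0 < u"
        proof -
          have "exp (- (x + y) * u) = exp (- u * x) * exp (- (u * y))"
            by (simp add: exp_add[symmetric] algebra_simps)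
          then have "c * x ^ (m + 1) * \<rho> x * (u ^ m / fact m * exp (- (x + y) * u)) =
              c * (u ^ m / fact m) * (x ^ (m + 1) * exp (- u * x) * \<rho> x) * exp (- (u * y))"
            by (simp add: mult_ac)
          then show ?thesis
            using that True c \<rho>x by (simp add: ennreal_mult[symmetric])
        qed
        then show "ennreal (c * x ^ (m + 1) * \<rho> x) * fT y *
            (ennreal (u ^ m / fact m * exp (- (x + y) * u)) * indicator {0<..} u) =
          ennreal (c * (u ^ m / fact m)) *
            (ennreal (x ^ (m + 1) * exp (- u * x) * \<rho> x) * indicator {0<..} x) *
            (ennreal (exp (- (u * y))) * fT y * indicator {0<..} y) * indicator {0<..} u"
          using True by (cases "0 < u") (simp_all add: mult_ac)
      qed
      finally show ?thesis .
    next
      case False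
      then show ?thesis
        by (auto simp: F_def indicator_def)
    qed
  qed
  also have "\<dots> = (\<integral>\<^sup>+x. \<integral>\<^sup>+u. \<integral>\<^sup>+y. ennreal (c * (u ^ m / fact m)) *
      (ennreal (x ^ (m + 1) * exp (- u * x) * \<rho> x) * indicator {0<..} x) *
      (ennreal (exp (- (u * y))) * fT y * indicator {0<..} y) * indicator {0<..} u \<partial>lborel \<partial>lborel \<partial>lborel)"
    by (rule nn_integral_cong, rule lborel_pair.Fubini') measurable
  also have "\<dots> = (\<integral>\<^sup>+u. \<integral>\<^sup>+x. \<integral>\<^sup>+y. ennreal (c * (u ^ m / fact m)) *
      (ennreal (x ^ (m + 1) * exp (- u * x) * \<rho> x) * indicator {0<..} x) *
      (ennreal (exp (- (u * y))) * fT y * indicator {0<..} y) * indicator {0<..} u \<partial>lborel \<partial>lborel \<partial>lborel)"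
    by (rule lborel_pair.Fubini') measurable
  also have "\<dots> = (\<integral>\<^sup>+u\<in>{0<..}. ennreal (c * (u ^ m / fact m)) *
      (\<integral>\<^sup>+x\<in>{0<..}. ennreal (x ^ (m + 1) * exp (- u * x) * \<rho> x) \<partial>lborel) *
      (\<integral>\<^sup>+y\<in>{0<..}. ennreal (exp (- (u * y))) * fT y \<partial>lborel) \<partial>lborel)"
    by (simp add: nn_integral_cmult nn_integral_multc)
  finally show ?thesis
    unfolding c_def .
qed

lemma nn_integral_substitution_atLeast:
  fixes f :: "real \<Rightarrow> ennreal" and g g' :: "real \<Rightarrow> real"
  assumes f [measurable]: "f \<in> borel_measurable borel"
    and deriv: "\<And>x. 0 \<le> x \<Longrightarrow> (g has_real_derivative g' x) (at x)"
    and cont: "continuous_on {0..} g'" and nonneg: "\<And>x. 0 \<le> x \<Longrightarrow> 0 \<le> g' x"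
    and lim: "filterlim g at_top at_top"
    and meas [measurable]: "g \<in> borel_measurable borel" "g' \<in> borel_measurable borel"
  shows "(\<integral>\<^sup>+x\<in>{g 0..}. f x \<partial>lborel) = (\<integral>\<^sup>+x\<in>{0..}. f (g x) * ennreal (g' x) \<partial>lborel)"
proof -
  have mono: "g x \<le> g y" if "0 \<le> x" "x \<le> y" for x y
    using that deriv nonneg by (intro DERIV_nonneg_imp_nondecreasing[of x y g]) (meson order_trans)+
  \<comment> \<open>The successor keeps every interval {0..?b n} nondegenerate; the half line is
    reached by monotone convergence on both sides.\<close>
  let ?b = "\<lambda>n. real (Suc n)"
  have step: "(\<integral>\<^sup>+x. f x * indicator {g 0..g (?b n)} x \<partial>lborel) =
      (\<integral>\<^sup>+x. f (g x) * ennreal (g' x) * indicator {0..?b n} x \<partial>lborel)" for n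
    using cont by (intro nn_integral_substitution_aux deriv nonneg) (auto elim: continuous_on_subset)
  have L: "(\<lambda>n. \<integral>\<^sup>+x. f x * indicator {g 0..g (?b n)} x \<partial>lborel) \<longlonglongrightarrow> (\<integral>\<^sup>+x\<in>{g 0..}. f x \<partial>lborel)"
  proof (rule nn_integral_LIMSEQ)
    show "incseq (\<lambda>n x. f x * indicator {g 0..g (?b n)} x)"
    proof (rule incseq_SucI, rule le_funI)
      fix n x
      have "g (?b n) \<le> g (?b (Suc n))"
        by (intro mono) auto
      then show "f x * indicator {g 0..g (?b n)} x \<le> f x * indicator {g 0..g (?b (Suc n))} x"
        by (intro mult_left_mono) (auto simp: indicator_def)
    qed
    show "(\<lambda>n. f x * indicator {g 0..g (?b n)} x) \<longlonglongrightarrow> f x * indicator {g 0..} x" for x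
    proof (rule tendsto_eventually)
      have "filterlim (\<lambda>n. g (?b n)) at_top sequentially"
        by (rule filterlim_compose[OF lim filterlim_compose[OF filterlim_real_sequentially filterlim_Suc]])
      then have "eventually (\<lambda>n. x \<le> g (?b n)) sequentially"
        by (simp add: filterlim_at_top)
      then show "\<forall>\<^sub>F n in sequentially. f x * indicator {g 0..g (?b n)} x = f x * indicator {g 0..} x"
        by eventually_elim (auto simp: indicator_def)
    qed
  qed measurable
  have R: "(\<lambda>n. \<integral>\<^sup>+x. f (g x) * ennreal (g' x) * indicator {0..?b n} x \<partial>lborel) \<longlonglongrightarrow>
      (\<integral>\<^sup>+x\<in>{0..}. f (g x) * ennreal (g' x) \<partial>lborel)"
  proof (rule nn_integral_LIMSEQ)
    show "incseq (\<lambda>n x. f (g x) * ennreal (g' x) * indicator {0..?b n} x)"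
      by (intro incseq_SucI le_funI mult_left_mono) (auto simp: indicator_def)
    show "(\<lambda>n. f (g x) * ennreal (g' x) * indicator {0..?b n} x) \<longlonglongrightarrow>
        f (g x) * ennreal (g' x) * indicator {0..} x" for x
    proof (rule tendsto_eventually)
      have "filterlim ?b at_top sequentially"
        by (rule filterlim_compose[OF filterlim_real_sequentially filterlim_Suc])
      then have "eventually (\<lambda>n. x \<le> ?b n) sequentially"
        by (simp add: filterlim_at_top)
      then show "\<forall>\<^sub>F n in sequentially. f (g x) * ennreal (g' x) * indicator {0..?b n} x =
          f (g x) * ennreal (g' x) * indicator {0..} x"
        by eventually_elim (auto simp: indicator_def)
    qed
  qed measurable
  show ?thesis
    by (rule LIMSEQ_unique[OF L[unfolded step] R])
qed

section \<open>Bounded laws are determined by their moments\<close>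

lemma (in prob_space) char_moment_bound:
  fixes X :: "'a \<Rightarrow> real"
  assumes X [measurable]: "X \<in> borel_measurable M" and bound: "AE \<omega> in M. \<bar>X \<omega>\<bar> \<le> 1"
  shows "cmod (char (distr M borel X) t - (\<Sum>k\<le>n. ((\<i> * t) ^ k / fact k) * expectation (\<lambda>\<omega>. X \<omega> ^ k))) \<le>
    2 * (\<bar>t\<bar> ^ n / fact n)"
proof -
  have abs_pow: "AE \<omega> in M. \<bar>X \<omega> ^ k\<bar> \<le> 1" for k
    using bound by eventually_elim (simp add: power_abs power_le_one)
  have int: "integrable M (\<lambda>\<omega>. X \<omega> ^ k)" for k
    using abs_pow[of k] by (intro integrable_const_bound[where B = 1]) auto
  have "cmod (char (distr M borel X) t - (\<Sum>k\<le>n. ((\<i> * t) ^ k / fact k) * expectation (\<lambda>\<omega>. X \<omega> ^ k))) \<le>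
      (2 * \<bar>t\<bar> ^ n / fact n) * expectation (\<lambda>\<omega>. \<bar>X \<omega>\<bar> ^ n)"
    by (intro char_approx1' int) auto
  also have "\<dots> \<le> (2 * \<bar>t\<bar> ^ n / fact n) * 1"
  proof (intro mult_left_mono)
    have "expectation (\<lambda>\<omega>. \<bar>X \<omega>\<bar> ^ n) \<le> expectation (\<lambda>\<omega>. 1)"
      using abs_pow[of n] integrable_abs[OF int[of n]]
      by (intro integral_mono_AE) (auto simp: power_abs)
    then show "expectation (\<lambda>\<omega>. \<bar>X \<omega>\<bar> ^ n) \<le> 1"
      by (simp add: prob_space)
  qed auto
  finally show ?thesis
    by simp
qed

text \<open>Both characteristic functions differ from the same Taylor polynomial of degree n by at
  most 2 |t|^n / n!, because the variables are bounded by 1. This tends to 0 for each t, so the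
  characteristic functions agree and Levy uniqueness applies.\<close>

lemma distr_eqI_moments:
  fixes X :: "'q \<Rightarrow> real" and Y :: "'r \<Rightarrow> real"
  assumes Q: "prob_space Q" and R: "prob_space R"
    and X: "X \<in> borel_measurable Q" "AE \<omega> in Q. \<bar>X \<omega>\<bar> \<le> 1"
    and Y: "Y \<in> borel_measurable R" "AE \<omega> in R. \<bar>Y \<omega>\<bar> \<le> 1"
    and moments: "\<And>m. (\<integral>\<omega>. X \<omega> ^ m \<partial>Q) = (\<integral>\<omega>. Y \<omega> ^ m \<partial>R)"
  shows "distr Q borel X = distr R borel Y"
proof (rule Levy_uniqueness)
  interpret Q: prob_space Q by fact
  interpret R: prob_space R by fact
  show "real_distribution (distr Q borel X)" "real_distribution (distr R borel Y)"
    by (intro Q.real_distribution_distr X R.real_distribution_distr Y)+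
  show "char (distr Q borel X) = char (distr R borel Y)"
  proof
    fix t
    let ?d = "cmod (char (distr Q borel X) t - char (distr R borel Y) t)"
    have "?d \<le> 4 * (\<bar>t\<bar> ^ n / fact n)" for n
      using norm_triangle_mono[OF Q.char_moment_bound[OF X, of t n]
          R.char_moment_bound[OF Y, of t n, THEN norm_minus_commute[THEN eq_refl, THEN order_trans]]]
      by (simp add: moments)
    moreover have "(\<lambda>n. 4 * (\<bar>t\<bar> ^ n / fact n)) \<longlonglongrightarrow> 4 * 0"
      using summable_LIMSEQ_zero[OF summable_exp[of "\<bar>t\<bar>"]]
      by (intro tendsto_intros) (simp add: divide_inverse mult.commute)
    ultimately have "?d \<le> 4 * 0"
      by (intro LIMSEQ_le_const) auto
    then show "char (distr Q borel X) t = char (distr R borel Y) t"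
      by simp
  qed
qed

lemma distributed_AE_support:
  assumes X: "distributed M N X f" and A: "A \<in> sets N" and zero: "\<And>x. x \<notin> A \<Longrightarrow> f x = 0"
  shows "AE \<omega> in M. X \<omega> \<in> A"
proof -
  have [measurable]: "X \<in> measurable M N"
    using X by (rule distributed_measurable)
  note A [measurable]
  have "(\<integral>\<^sup>+\<omega>. indicator (space N - A) (X \<omega>) \<partial>M) = (\<integral>\<^sup>+x. f x * indicator (space N - A) x \<partial>N)"
    using A by (intro distributed_nn_integral[OF X, symmetric]) auto
  also have "\<dots> = (\<integral>\<^sup>+x. 0 \<partial>N)"
    using zero by (intro nn_integral_cong) (auto simp: indicator_def)
  finally have "(\<integral>\<^sup>+\<omega>. indicator (space N - A) (X \<omega>) \<partial>M) = 0"
    by simp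
  then have "AE \<omega> in M. indicator (space N - A) (X \<omega>) = (0 :: ennreal)"
    by (subst (asm) nn_integral_0_iff_AE) auto
  with AE_space show ?thesis
  proof eventually_elim
    case (elim \<omega>)
    then show ?case
      using measurable_space[OF \<open>X \<in> measurable M N\<close>, of \<omega>] by (auto simp: indicator_def split: if_splits)
  qed
qed

lemma laplace_transform_density:
  assumes T: "distributed M lborel T f" and pos: "AE \<omega> in M. 0 < T \<omega>"
  shows "(\<integral>\<^sup>+y\<in>{0<..}. ennreal (exp (- (u * y))) * f y \<partial>lborel) =
    (\<integral>\<^sup>+\<omega>. ennreal (exp (- (u * T \<omega>))) \<partial>M)"
proof -
  have "(\<integral>\<^sup>+y\<in>{0<..}. ennreal (exp (- (u * y))) * f y \<partial>lborel) =
      (\<integral>\<^sup>+y. f y * (ennreal (exp (- (u * y))) * indicator {0<..} y) \<partial>lborel)"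
    by (simp add: mult_ac)
  also have "\<dots> = (\<integral>\<^sup>+\<omega>. ennreal (exp (- (u * T \<omega>))) * indicator {0<..} (T \<omega>) \<partial>M)"
    by (rule distributed_nn_integral[OF T]) measurable
  also have "\<dots> = (\<integral>\<^sup>+\<omega>. ennreal (exp (- (u * T \<omega>))) \<partial>M)"
    using pos by (intro nn_integral_cong_AE) auto
  finally show ?thesis .
qed

text \<open>The change of variables is the Laplace exponent \<open>g\<close> of
  \<open>T\<^sub>j\<close>: \<kappa> + g u is a multiple of (\<tau> + u) powr \<alpha>, hence
  \<open>W (g u)\<close> = u / (\<tau> + u). This is the origin of \<kappa> and of the power 1 /
  \<alpha>. The factor exp (- g u) * g' u becomes the exponential density, and the Gamma quotient is
  constant in u.\<close>

lemma nggp_V_density_moment: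
  fixes fT :: "real \<Rightarrow> ennreal" and \<theta> \<tau> \<alpha> \<kappa> :: real and J m :: nat
  defines "\<kappa> \<equiv> \<theta> * \<tau> powr \<alpha> / (real J * \<alpha>)"
  assumes J: "1 \<le> J" and \<theta>: "0 < \<theta>" and \<alpha>: "0 < \<alpha>" "\<alpha> < 1" and \<tau>: "0 < \<tau>"
    and fT: "fT \<in> borel_measurable borel"
    and laplace: "\<And>u. 0 < u \<Longrightarrow> (\<integral>\<^sup>+y\<in>{0<..}. ennreal (exp (- (u * y))) * fT y \<partial>lborel) =
      ennreal (exp (- (\<theta> / real J * (((\<tau> + u) powr \<alpha> - \<tau> powr \<alpha>) / \<alpha>))))"
  shows "(\<integral>\<^sup>+v. ennreal (v ^ m) * V_density \<theta> J (nggp_jump_density \<alpha> \<tau>) fT v \<partial>lborel) =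
    ennreal (Gamma (real m + 1 - \<alpha>) / (Gamma (1 - \<alpha>) * fact m)) *
      (\<integral>\<^sup>+e\<in>{0..}. ennreal ((1 - (\<kappa> / (\<kappa> + e)) powr (1 / \<alpha>)) ^ m * exp (- e)) \<partial>lborel)"
proof -
  define c where "c = \<theta> / real J"
  have c: "0 < c"
    using J \<theta> by (simp add: c_def)
  have \<kappa>: "\<kappa> = c * \<tau> powr \<alpha> / \<alpha>"
    by (simp add: \<kappa>_def c_def)
  define g where "g u = c * (((\<tau> + u) powr \<alpha> - \<tau> powr \<alpha>) / \<alpha>)" for u
  define g' where "g' u = c * (\<tau> + u) powr (\<alpha> - 1)" for u
  define W where "W e = 1 - (\<kappa> / (\<kappa> + e)) powr (1 / \<alpha>)" for e
  define C where "C = Gamma (real m + 1 - \<alpha>) / (Gamma (1 - \<alpha>) * fact m)"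
  have C: "0 \<le> C"
    using \<alpha> by (auto simp: C_def intro!: divide_nonneg_nonneg mult_nonneg_nonneg less_imp_le[OF Gamma_real_pos])
  have [measurable]: "g \<in> borel_measurable borel" "g' \<in> borel_measurable borel" "W \<in> borel_measurable borel"
    unfolding g_def[abs_def] g'_def[abs_def] W_def[abs_def] by measurable
  have Wg: "W (g u) = u / (\<tau> + u)" if "0 \<le> u" for u
  proof -
    have "\<kappa> + g u = c / \<alpha> * (\<tau> + u) powr \<alpha>"
      using \<alpha> by (simp add: \<kappa> g_def field_simps)
    then have "\<kappa> / (\<kappa> + g u) = \<tau> powr \<alpha> / (\<tau> + u) powr \<alpha>"
      using c \<alpha> by (simp add: \<kappa>)
    also have "\<dots> = (\<tau> / (\<tau> + u)) powr \<alpha>"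
      using \<tau> that by (simp add: powr_divide)
    finally have "(\<kappa> / (\<kappa> + g u)) powr (1 / \<alpha>) = \<tau> / (\<tau> + u)"
      using \<alpha> \<tau> that by (simp add: powr_powr)
    then show ?thesis
      using \<tau> that by (simp add: W_def field_simps)
  qed
  have "(\<integral>\<^sup>+v. ennreal (v ^ m) * V_density \<theta> J (nggp_jump_density \<alpha> \<tau>) fT v \<partial>lborel) =
      (\<integral>\<^sup>+u\<in>{0<..}. ennreal (c * (u ^ m / fact m)) *
        (\<integral>\<^sup>+x\<in>{0<..}. ennreal (x ^ (m + 1) * exp (- u * x) * nggp_jump_density \<alpha> \<tau> x) \<partial>lborel) *
        (\<integral>\<^sup>+y\<in>{0<..}. ennreal (exp (- (u * y))) * fT y \<partial>lborel) \<partial>lborel)"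
    unfolding c_def using \<alpha> by (intro V_density_moment J \<theta> fT nggp_jump_density_nonneg) auto
  also have "\<dots> = (\<integral>\<^sup>+u\<in>{0<..}. ennreal C * (ennreal (W (g u) ^ m * exp (- g u)) * ennreal (g' u)) \<partial>lborel)"
  proof (intro nn_integral_cong)
    fix u :: real
    have step: "ennreal (c * (u ^ m / fact m)) *
        ennreal (Gamma (real m + 1 - \<alpha>) / Gamma (1 - \<alpha>) * (\<tau> + u) powr (\<alpha> - real m - 1)) *
        ennreal (exp (- g u)) = ennreal C * (ennreal (W (g u) ^ m * exp (- g u)) * ennreal (g' u))" if u: "0 < u"
    proof -
      have G: "0 \<le> Gamma (real m + 1 - \<alpha>) / Gamma (1 - \<alpha>)"
        using \<alpha> by (intro divide_nonneg_nonneg less_imp_le[OF Gamma_real_pos]) auto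
      have "(\<tau> + u) powr (\<alpha> - real m - 1) = (\<tau> + u) powr (\<alpha> - 1) / (\<tau> + u) ^ m"
        using \<tau> u by (simp add: powr_diff powr_realpow mult_ac)
      then have eq: "c * (u ^ m / fact m) *
          (Gamma (real m + 1 - \<alpha>) / Gamma (1 - \<alpha>) * (\<tau> + u) powr (\<alpha> - real m - 1)) * exp (- g u) =
          C * (W (g u) ^ m * exp (- g u) * g' u)"
        using u by (simp add: Wg C_def g'_def power_divide mult_ac)
      have nn: "0 \<le> c * (u ^ m / fact m)"
        "0 \<le> Gamma (real m + 1 - \<alpha>) / Gamma (1 - \<alpha>) * (\<tau> + u) powr (\<alpha> - real m - 1)"
        "0 \<le> W (g u) ^ m * exp (- g u)" "0 \<le> g' u"
        using c u \<tau> G Wg[of u] by (auto simp: g'_def intro!: mult_nonneg_nonneg simp del: times_divide_eq_left)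
      show ?thesis
        unfolding ennreal_mult[OF nn(1,2), symmetric] ennreal_mult[OF nn(3,4), symmetric]
          ennreal_mult[OF C mult_nonneg_nonneg[OF nn(3,4)], symmetric]
          ennreal_mult[OF mult_nonneg_nonneg[OF nn(1,2)] exp_ge_zero, symmetric] eq ..
    qed
    show "ennreal (c * (u ^ m / fact m)) *
        (\<integral>\<^sup>+x\<in>{0<..}. ennreal (x ^ (m + 1) * exp (- u * x) * nggp_jump_density \<alpha> \<tau> x) \<partial>lborel) *
        (\<integral>\<^sup>+y\<in>{0<..}. ennreal (exp (- (u * y))) * fT y \<partial>lborel) * indicator {0<..} u =
        ennreal C * (ennreal (W (g u) ^ m * exp (- g u)) * ennreal (g' u)) * indicator {0<..} u"
    proof (cases "0 < u")
      case True
      have jumps: "(\<integral>\<^sup>+x\<in>{0<..}. ennreal (x ^ (m + 1) * exp (- u * x) * nggp_jump_density \<alpha> \<tau> x) \<partial>lborel) =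
          ennreal (Gamma (real m + 1 - \<alpha>) / Gamma (1 - \<alpha>) * (\<tau> + u) powr (\<alpha> - real m - 1))"
        using \<tau> True by (intro nggp_moment \<alpha>) simp
      have mass: "(\<integral>\<^sup>+y\<in>{0<..}. ennreal (exp (- (u * y))) * fT y \<partial>lborel) = ennreal (exp (- g u))"
        using laplace[OF True] by (simp only: g_def c_def)
      show ?thesis
        unfolding jumps mass step[OF True] ..
    qed simp
  qed
  also have "\<dots> = (\<integral>\<^sup>+u\<in>{0..}. ennreal C * (ennreal (W (g u) ^ m * exp (- g u)) * ennreal (g' u)) \<partial>lborel)"
    using AE_lborel_singleton[of "0::real"]
    by (intro nn_integral_cong_AE) (auto simp: indicator_def elim!: eventually_mono)
  also have "\<dots> = ennreal C * (\<integral>\<^sup>+u\<in>{0..}. ennreal (W (g u) ^ m * exp (- g u)) * ennreal (g' u) \<partial>lborel)"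
    by (subst nn_integral_cmult[symmetric]) (auto simp: mult.assoc)
  also have "(\<integral>\<^sup>+u\<in>{0..}. ennreal (W (g u) ^ m * exp (- g u)) * ennreal (g' u) \<partial>lborel) =
      (\<integral>\<^sup>+e\<in>{g 0..}. ennreal (W e ^ m * exp (- e)) \<partial>lborel)"
  proof (rule nn_integral_substitution_atLeast[symmetric])
    show "(g has_real_derivative g' x) (at x)" if "0 \<le> x" for x
      unfolding g_def[abs_def] g'_def using that \<tau> \<alpha> by (auto intro!: derivative_eq_intros)
    show "continuous_on {0..} g'"
      unfolding g'_def[abs_def] using \<tau> by (intro continuous_intros) auto
    have "filterlim (\<lambda>u. (\<tau> + u) powr \<alpha>) at_top at_top"
      by (intro filterlim_compose[OF real_powr_at_top[OF \<alpha>(1)]] filterlim_tendsto_add_at_top[OF tendsto_const] filterlim_ident)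
    then have "filterlim (\<lambda>u. - (c / \<alpha> * \<tau> powr \<alpha>) + c / \<alpha> * (\<tau> + u) powr \<alpha>) at_top at_top"
      using c \<alpha> by (intro filterlim_tendsto_add_at_top[OF tendsto_const]
          filterlim_tendsto_pos_mult_at_top[OF tendsto_const]) auto
    moreover have "g u = - (c / \<alpha> * \<tau> powr \<alpha>) + c / \<alpha> * (\<tau> + u) powr \<alpha>" for u
      using \<alpha> by (simp add: g_def field_simps)
    ultimately show "filterlim g at_top at_top"
      by presburger
  qed (use c in \<open>auto simp: g'_def\<close>)
  also have "g 0 = 0"
    by (simp add: g_def)
  finally show ?thesis
    unfolding C_def W_def .
qed

section \<open>The moments of the Beta factor and the exponential integral\<close>

lemma beta_density_moment:
  assumes a: "0 < a" and b: "0 < b"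
  shows "(\<integral>\<^sup>+x. ennreal (beta_density a b x) * ennreal (x ^ m) \<partial>lborel) =
    ennreal (Beta (real m + a) b / Beta a b)"
proof -
  have B: "0 < Beta a b"
    using a b by (simp add: Beta_def Gamma_real_pos)
  have "(\<integral>\<^sup>+x. ennreal (beta_density a b x) * ennreal (x ^ m) \<partial>lborel) =
      (\<integral>\<^sup>+x. ennreal (1 / Beta a b) *
        (ennreal (x powr (real m + a - 1) * (1 - x) powr (b - 1)) * indicator {0..1} x) \<partial>lborel)"
  proof (rule nn_integral_cong_AE)
    show "AE x in lborel. ennreal (beta_density a b x) * ennreal (x ^ m) = ennreal (1 / Beta a b) *
        (ennreal (x powr (real m + a - 1) * (1 - x) powr (b - 1)) * indicator {0..1} x)"
      using AE_lborel_singleton[of "0::real"] AE_lborel_singleton[of "1::real"]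
    proof eventually_elim
      case (elim x)
      show ?case
      proof (cases "0 < x \<and> x < 1")
        case True
        have "x powr (real m + a - 1) = x powr (a - 1) * x ^ m"
          using True by (simp add: powr_add[symmetric] powr_realpow[symmetric] algebra_simps)
        then show ?thesis
          using True B by (simp add: beta_density_def ennreal_mult[symmetric] mult_ac)
      next
        case False
        then show ?thesis
          using elim by (auto simp: beta_density_def indicator_def)
      qed
    qed
  qed
  also have "\<dots> = ennreal (1 / Beta a b) * ennreal (Beta (real m + a) b)"
    using has_integral_Beta_real[of "real m + a" b] a b
    by (subst nn_integral_cmult) (auto intro!: arg_cong2[where f = "(*)"] nn_integral_has_integral_lebesgue')
  also have "\<dots> = ennreal (Beta (real m + a) b / Beta a b)"
    using B by (simp add: ennreal_mult'[symmetric])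
  finally show ?thesis .
qed

text \<open>Under e = \<kappa> (x - 1) the quotient \<kappa> / (\<kappa> + e) becomes 1 / x, and exp
  (- e) becomes exp \<kappa> * exp (- \<kappa> * x).\<close>

lemma nn_integral_exp_integral:
  assumes \<kappa>: "0 < \<kappa>" and a: "0 \<le> a"
  shows "(\<integral>\<^sup>+e\<in>{0..}. ennreal ((\<kappa> / (\<kappa> + e)) powr a * exp (- e)) \<partial>lborel) =
    ennreal (\<kappa> * exp \<kappa> * exp_integral a \<kappa>)"
proof -
  let ?I = "\<integral>\<^sup>+x. ennreal (x powr (- a) * exp (- \<kappa> * x) * indicator {1..} x) \<partial>lborel"
  have "(\<integral>\<^sup>+e\<in>{0..}. ennreal ((\<kappa> / (\<kappa> + e)) powr a * exp (- e)) \<partial>lborel) =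
      ennreal \<kappa> * (\<integral>\<^sup>+x. ennreal ((\<kappa> / (\<kappa> + (- \<kappa> + \<kappa> * x))) powr a * exp (- (- \<kappa> + \<kappa> * x))) *
        indicator {0..} (- \<kappa> + \<kappa> * x) \<partial>lborel)"
    using \<kappa> by (subst nn_integral_real_affine[where c = \<kappa> and t = "- \<kappa>"]) auto
  also have "\<dots> = ennreal \<kappa> * (\<integral>\<^sup>+x. ennreal (exp \<kappa>) *
      ennreal (x powr (- a) * exp (- \<kappa> * x) * indicator {1..} x) \<partial>lborel)"
  proof (rule arg_cong2[where f = "(*)", OF refl nn_integral_cong])
    fix x :: real
    have "0 \<le> - \<kappa> + \<kappa> * x \<longleftrightarrow> 1 \<le> x"
      using \<kappa> by (auto simp: mult_le_cancel_left1)
    moreover have "exp (- (- \<kappa> + \<kappa> * x)) = exp \<kappa> * exp (- \<kappa> * x)"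
      by (simp add: exp_add[symmetric])
    moreover have "(\<kappa> / (\<kappa> + (- \<kappa> + \<kappa> * x))) powr a = x powr (- a)" if "1 \<le> x"
      using that \<kappa> by (simp add: powr_divide powr_minus field_simps)
    ultimately show "ennreal ((\<kappa> / (\<kappa> + (- \<kappa> + \<kappa> * x))) powr a * exp (- (- \<kappa> + \<kappa> * x))) *
        indicator {0..} (- \<kappa> + \<kappa> * x) =
        ennreal (exp \<kappa>) * ennreal (x powr (- a) * exp (- \<kappa> * x) * indicator {1..} x)"
      by (auto simp: indicator_def ennreal_mult[symmetric] mult_ac)
  qed
  also have "\<dots> = ennreal \<kappa> * (ennreal (exp \<kappa>) * ?I)"
    by (subst nn_integral_cmult) auto
  also have "?I = ennreal (exp_integral a \<kappa>)"
  proof -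
    \<comment> \<open>\<open>exp_integral\<close> is a Bochner integral, so finiteness must be
      secured before passing to it. For x >= 1 the power is at most 1, and extending the domain to x
      > 0 leaves a Gamma integral.\<close>
    have "?I \<le> (\<integral>\<^sup>+x\<in>{0<..}. ennreal (x powr (1 - 1) * exp (- \<kappa> * x)) \<partial>lborel)"
    proof (intro nn_integral_mono)
      fix x :: real
      have "x powr (- a) \<le> 1" if "1 \<le> x"
        using that a powr_mono[of "- a" 0 x] by simp
      then show "ennreal (x powr (- a) * exp (- \<kappa> * x) * indicator {1..} x) \<le>
          ennreal (x powr (1 - 1) * exp (- \<kappa> * x)) * indicator {0<..} x"
        by (auto simp: indicator_def intro!: ennreal_leI)
    qed
    also have "\<dots> < \<infinity>"
      using nn_integral_powr_times_exp[of 1 \<kappa>] \<kappa> by simp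
    finally have fin: "?I < \<infinity>" .
    have "exp_integral a \<kappa> = (\<integral>x. x powr (- a) * exp (- \<kappa> * x) * indicator {1..} x \<partial>lborel)"
      unfolding exp_integral_def set_lebesgue_integral_def
      by (intro Bochner_Integration.integral_cong refl) (simp add: indicator_def)
    also have "\<dots> = enn2real ?I"
      by (intro integral_eq_nn_integral) auto
    finally show ?thesis
      using fin by simp
  qed
  finally show ?thesis
    using \<kappa> by (simp add: ennreal_mult'[symmetric] mult_ac)
qed

text \<open>All that is used later about the values of \<open>fT\<close>: this transform determines
  every moment of V.\<close>

lemma nggp_total_mass_laplace:
  fixes \<mu> :: "'n \<Rightarrow> 'a::{second_countable_topology, t2_space} measure"
  assumes J: "1 \<le> J" and \<theta>: "0 < \<theta>" and \<alpha>: "0 < \<alpha>" "\<alpha> < 1" and \<tau>: "0 < \<tau>"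
    and G0: "prob_space G0" "sets G0 = sets borel" "\<forall>s. emeasure G0 {s} = 0"
    and T: "is_CRM N (\<theta> / real J) G0 (nggp_jump_density \<alpha> \<tau>) \<mu>"
      "distributed N lborel (\<lambda>\<omega>. enn2real (total_mass \<mu> \<omega>)) fT"
    and u: "0 < u"
  shows "(\<integral>\<^sup>+y\<in>{0<..}. ennreal (exp (- (u * y))) * fT y \<partial>lborel) =
    ennreal (exp (- (\<theta> / real J * (((\<tau> + u) powr \<alpha> - \<tau> powr \<alpha>) / \<alpha>))))"
proof -
  obtain X where X: "poisson_points N (levy_intensity (\<theta> / real J) G0 (nggp_jump_density \<alpha> \<tau>)) X"
    and \<mu>: "\<forall>\<omega>\<in>space N. \<mu> \<omega> = jump_measure X \<omega>"
    using T(1) unfolding is_CRM_def by blast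
  have c: "0 < \<theta> / real J"
    using J \<theta> by simp
  interpret levy_points N "\<theta> / real J" G0 "nggp_jump_density \<alpha> \<tau>" X
    by (rule levy_points_nggp[OF X c \<alpha> \<tau> G0])
  have mass: "total_mass \<mu> \<omega> = total_mass (jump_measure X) \<omega>" if "\<omega> \<in> space N" for \<omega>
    using \<mu> that by (simp add: total_mass_def)
  have pos: "AE \<omega> in N. 0 < enn2real (total_mass \<mu> \<omega>)"
    using AE_total_mass_pos AE_space by eventually_elim (simp add: mass)
  have "0 \<le> ((\<tau> + u) powr \<alpha> - \<tau> powr \<alpha>) / \<alpha>"
    using \<alpha> \<tau> u by (simp add: powr_mono2)
  then have "0 \<le> \<theta> / real J * (((\<tau> + u) powr \<alpha> - \<tau> powr \<alpha>) / \<alpha>)"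
    using c by (intro mult_nonneg_nonneg) auto
  moreover have "(\<integral>\<^sup>+\<omega>. ennreal (exp (- (u * enn2real (total_mass \<mu> \<omega>)))) \<partial>N) =
      (\<integral>\<^sup>+\<omega>. ennreal (exp (- (u * enn2real (total_mass (jump_measure X) \<omega>)))) \<partial>N)"
    by (intro nn_integral_cong) (simp add: mass)
  ultimately show ?thesis
    unfolding laplace_transform_density[OF T(2) pos] laplace_total_mass[OF u]
      nggp_scaled_laplace_exponent[OF c \<alpha> \<tau> less_imp_le[OF u]]
    by (simp only: enn2real_ennreal)
qed

lemma (in prob_space) expectation_power_distributed:
  assumes X: "distributed M lborel X f" and nn: "AE \<omega> in M. 0 \<le> X \<omega>"
  shows "expectation (\<lambda>\<omega>. X \<omega> ^ m) = enn2real (\<integral>\<^sup>+x. ennreal (x ^ m) * f x \<partial>lborel)"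
proof -
  have [measurable]: "X \<in> borel_measurable M"
    using distributed_measurable[OF X] by simp
  have "expectation (\<lambda>\<omega>. X \<omega> ^ m) = enn2real (\<integral>\<^sup>+\<omega>. ennreal (X \<omega> ^ m) \<partial>M)"
    using nn by (intro integral_eq_nn_integral) auto
  also have "(\<integral>\<^sup>+\<omega>. ennreal (X \<omega> ^ m) \<partial>M) = (\<integral>\<^sup>+x. f x * ennreal (x ^ m) \<partial>lborel)"
    by (rule distributed_nn_integral[OF X, symmetric]) measurable
  finally show ?thesis
    by (simp add: mult.commute)
qed

lemma V_density_unit_interval:
  assumes "distributed Q lborel V (V_density \<theta> J \<rho> fT)"
  shows "AE \<omega> in Q. V \<omega> \<in> {0<..<1}"
  using assms by (rule distributed_AE_support) (auto simp: V_density_def)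

text \<open>The constant \<open>C m\<close> that factors out of the m-th moment of V is the m-th
  moment of the Beta(1 - \<alpha>, \<alpha>) law, and the remaining integral is that of W (E), so
  independence of B and E yields equal moments. The mean is the case m = 1, with the mean of K (E)
  given by the exponential integral.\<close>

lemma nggp_V_law:
  fixes J :: nat and \<theta> \<alpha> \<tau> \<kappa> :: real
    and G0 :: "'a::{second_countable_topology, t2_space} measure"
    and N :: "'n measure" and \<mu>\<^sub>j :: "'n \<Rightarrow> 'a measure" and fT :: "real \<Rightarrow> ennreal"
    and Q :: "'q measure" and V :: "'q \<Rightarrow> real"
    and R :: "'r measure" and B E :: "'r \<Rightarrow> real"
  defines "\<kappa> \<equiv> \<theta> * \<tau> powr \<alpha> / (real J * \<alpha>)"
  assumes J: "1 \<le> J" and \<theta>: "0 < \<theta>" and \<alpha>: "0 < \<alpha>" "\<alpha> < 1" and \<tau>: "0 < \<tau>"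
    and G0: "prob_space G0" "sets G0 = sets borel" "\<forall>s. emeasure G0 {s} = 0"
    and T: "is_CRM N (\<theta> / real J) G0 (nggp_jump_density \<alpha> \<tau>) \<mu>\<^sub>j"
      "distributed N lborel (\<lambda>\<omega>. enn2real (total_mass \<mu>\<^sub>j \<omega>)) fT"
    and V: "prob_space Q" "distributed Q lborel V (V_density \<theta> J (nggp_jump_density \<alpha> \<tau>) fT)"
    and BE: "prob_space R" "distributed R lborel B (beta_density (1 - \<alpha>) \<alpha>)"
      "distributed R lborel E (exponential_density 1)" "prob_space.indep_var R borel B borel E"
  shows "distr Q borel V = distr R borel (\<lambda>\<omega>. B \<omega> * (1 - (\<kappa> / (\<kappa> + E \<omega>)) powr (1 / \<alpha>)))"
    and "prob_space.expectation Q V = (1 - \<alpha>) * (1 - \<kappa> * exp \<kappa> * exp_integral (1 / \<alpha>) \<kappa>)"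
proof -
  interpret Q: prob_space Q by fact
  interpret R: prob_space R by fact
  have \<kappa>: "0 < \<kappa>"
    using J \<theta> \<alpha> \<tau> by (simp add: \<kappa>_def)
  define K where "K e = (\<kappa> / (\<kappa> + e)) powr (1 / \<alpha>)" for e
  define W where "W e = 1 - K e" for e
  have K_meas [measurable]: "K \<in> borel_measurable borel"
    unfolding K_def[abs_def] by measurable
  have W_meas [measurable]: "W \<in> borel_measurable borel"
    unfolding W_def[abs_def] by measurable
  have K01: "0 \<le> K e" "K e \<le> 1" if "0 \<le> e" for e
    using \<kappa> \<alpha> that by (auto simp: K_def intro!: powr_le1)
  have W01: "0 \<le> W e" "W e \<le> 1" if "0 \<le> e" for e
    using K01[OF that] by (auto simp: W_def)
  have fT [measurable]: "fT \<in> borel_measurable borel"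
    using distributed_borel_measurable[OF T(2)] by simp
  have V_meas [measurable]: "V \<in> borel_measurable Q"
    and B_meas [measurable]: "B \<in> borel_measurable R" and E_meas [measurable]: "E \<in> borel_measurable R"
    using distributed_measurable[OF V(2)] distributed_measurable[OF BE(2)] distributed_measurable[OF BE(3)]
    by simp_all
  have V01: "AE \<omega> in Q. V \<omega> \<in> {0<..<1}"
    by (rule V_density_unit_interval[OF V(2)])
  have B01: "AE \<omega> in R. B \<omega> \<in> {0<..<1}"
    using BE(2) by (rule distributed_AE_support) (auto simp: beta_density_def)
  have E0: "AE \<omega> in R. E \<omega> \<in> {0..}"
    using BE(3) by (rule distributed_AE_support) (auto simp: exponential_density_def)
  define C where "C m = Gamma (real m + 1 - \<alpha>) / (Gamma (1 - \<alpha>) * fact m)" for m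
  have C0: "0 \<le> C m" for m
    using \<alpha> by (auto simp: C_def intro!: divide_nonneg_nonneg mult_nonneg_nonneg less_imp_le[OF Gamma_real_pos])
  have E_B: "R.expectation (\<lambda>\<omega>. B \<omega> ^ m) = C m" for m
  proof -
    have "R.expectation (\<lambda>\<omega>. B \<omega> ^ m) =
        enn2real (\<integral>\<^sup>+x. ennreal (beta_density (1 - \<alpha>) \<alpha> x) * ennreal (x ^ m) \<partial>lborel)"
    proof -
      have "AE \<omega> in R. 0 \<le> B \<omega>"
        using B01 by eventually_elim simp
      from R.expectation_power_distributed[OF BE(2) this, of m] show ?thesis
        by (simp only: mult.commute)
    qed
    also have "\<dots> = enn2real (ennreal (Beta (real m + (1 - \<alpha>)) \<alpha> / Beta (1 - \<alpha>) \<alpha>))"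
      using \<alpha> by (subst beta_density_moment) auto
    also have "Beta (real m + (1 - \<alpha>)) \<alpha> / Beta (1 - \<alpha>) \<alpha> = C m"
    proof -
      have "Gamma \<alpha> \<noteq> 0"
        using Gamma_real_pos[OF \<alpha>(1)] by simp
      then show ?thesis
        using Gamma_fact[of m, where 'a = real] by (simp add: Beta_def C_def algebra_simps)
    qed
    finally show ?thesis
      using C0 by simp
  qed
  have exp_int: "(\<integral>\<^sup>+\<omega>. ennreal (h (E \<omega>)) \<partial>R) = (\<integral>\<^sup>+e\<in>{0..}. ennreal (h e * exp (- e)) \<partial>lborel)"
    if [measurable]: "h \<in> borel_measurable borel" and h: "\<And>e. 0 \<le> e \<Longrightarrow> 0 \<le> h e" for h :: "real \<Rightarrow> real"
  proof -
    have "(\<integral>\<^sup>+\<omega>. ennreal (h (E \<omega>)) \<partial>R) = (\<integral>\<^sup>+e. ennreal (exponential_density 1 e) * ennreal (h e) \<partial>lborel)"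
      by (rule distributed_nn_integral[OF BE(3), symmetric]) measurable
    also have "\<dots> = (\<integral>\<^sup>+e\<in>{0..}. ennreal (h e * exp (- e)) \<partial>lborel)"
      by (intro nn_integral_cong)
        (auto simp: exponential_density_def indicator_def h ennreal_mult[symmetric] mult.commute)
    finally show ?thesis .
  qed
  have E_W: "R.expectation (\<lambda>\<omega>. W (E \<omega>) ^ m) =
      enn2real (\<integral>\<^sup>+e\<in>{0..}. ennreal (W e ^ m * exp (- e)) \<partial>lborel)" for m
  proof -
    have "R.expectation (\<lambda>\<omega>. W (E \<omega>) ^ m) = enn2real (\<integral>\<^sup>+\<omega>. ennreal (W (E \<omega>) ^ m) \<partial>R)"
    proof (rule integral_eq_nn_integral)
      show "AE \<omega> in R. 0 \<le> W (E \<omega>) ^ m"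
        using E0 by eventually_elim (simp add: W01)
    qed measurable
    then show ?thesis
      by (subst (asm) exp_int[of "\<lambda>e. W e ^ m"]) (simp_all add: W01)
  qed
  have B_pow: "AE \<omega> in R. \<bar>B \<omega> ^ m\<bar> \<le> 1" for m
    using B01 by eventually_elim (simp add: power_abs power_le_one)
  have W_pow: "AE \<omega> in R. \<bar>W (E \<omega>) ^ m\<bar> \<le> 1" for m
    using E0 by eventually_elim (simp add: power_abs W01 power_le_one)
  have E_BW: "R.expectation (\<lambda>\<omega>. (B \<omega> * W (E \<omega>)) ^ m) =
      R.expectation (\<lambda>\<omega>. B \<omega> ^ m) * R.expectation (\<lambda>\<omega>. W (E \<omega>) ^ m)" for m
  proof -
    have "R.indep_var borel ((\<lambda>x. x ^ m) \<circ> B) borel ((\<lambda>e. W e ^ m) \<circ> E)"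
      by (rule R.indep_var_compose[OF BE(4)]) measurable
    then have "R.indep_var borel (\<lambda>\<omega>. B \<omega> ^ m) borel (\<lambda>\<omega>. W (E \<omega>) ^ m)"
      by (simp add: comp_def)
    moreover have "integrable R (\<lambda>\<omega>. B \<omega> ^ m)" "integrable R (\<lambda>\<omega>. W (E \<omega>) ^ m)"
      using B_pow[of m] W_pow[of m] by (auto intro!: R.integrable_const_bound[where B = 1])
    ultimately show ?thesis
      unfolding power_mult_distrib by (rule R.indep_var_lebesgue_integral)
  qed
  have E_V: "Q.expectation (\<lambda>\<omega>. V \<omega> ^ m) =
      C m * enn2real (\<integral>\<^sup>+e\<in>{0..}. ennreal (W e ^ m * exp (- e)) \<partial>lborel)" for m
  proof -
    have "Q.expectation (\<lambda>\<omega>. V \<omega> ^ m) =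
        enn2real (\<integral>\<^sup>+v. ennreal (v ^ m) * V_density \<theta> J (nggp_jump_density \<alpha> \<tau>) fT v \<partial>lborel)"
    proof (rule Q.expectation_power_distributed[OF V(2)])
      show "AE \<omega> in Q. 0 \<le> V \<omega>"
        using V01 by eventually_elim simp
    qed
    also have "(\<integral>\<^sup>+v. ennreal (v ^ m) * V_density \<theta> J (nggp_jump_density \<alpha> \<tau>) fT v \<partial>lborel) =
        ennreal (C m) * (\<integral>\<^sup>+e\<in>{0..}. ennreal (W e ^ m * exp (- e)) \<partial>lborel)"
      unfolding C_def W_def K_def \<kappa>_def
      by (rule nggp_V_density_moment[OF J \<theta> \<alpha> \<tau> fT nggp_total_mass_laplace[OF J \<theta> \<alpha> \<tau> G0 T]])
    finally show ?thesis
      using C0 by (simp add: enn2real_mult)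
  qed
  have "distr Q borel V = distr R borel (\<lambda>\<omega>. B \<omega> * W (E \<omega>))"
  proof (rule distr_eqI_moments[OF V(1) BE(1) V_meas])
    show "AE \<omega> in Q. \<bar>V \<omega>\<bar> \<le> 1"
      using V01 by eventually_elim auto
    show "AE \<omega> in R. \<bar>B \<omega> * W (E \<omega>)\<bar> \<le> 1"
      using B01 E0
    proof eventually_elim
      case (elim \<omega>)
      then show ?case
        using W01[of "E \<omega>"] by (auto simp: abs_mult intro!: mult_le_one)
    qed
    show "(\<integral>\<omega>. V \<omega> ^ m \<partial>Q) = (\<integral>\<omega>. (B \<omega> * W (E \<omega>)) ^ m \<partial>R)" for m
      by (simp only: E_V E_BW E_B E_W)
  qed measurable
  then show "distr Q borel V = distr R borel (\<lambda>\<omega>. B \<omega> * (1 - (\<kappa> / (\<kappa> + E \<omega>)) powr (1 / \<alpha>)))"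
    by (simp add: W_def K_def)
  have E_K: "R.expectation (\<lambda>\<omega>. K (E \<omega>)) = \<kappa> * exp \<kappa> * exp_integral (1 / \<alpha>) \<kappa>"
  proof -
    have "R.expectation (\<lambda>\<omega>. K (E \<omega>)) = enn2real (\<integral>\<^sup>+\<omega>. ennreal (K (E \<omega>)) \<partial>R)"
    proof (rule integral_eq_nn_integral)
      show "AE \<omega> in R. 0 \<le> K (E \<omega>)"
        using E0 by eventually_elim (simp add: K01)
    qed measurable
    also have "(\<integral>\<^sup>+\<omega>. ennreal (K (E \<omega>)) \<partial>R) = ennreal (\<kappa> * exp \<kappa> * exp_integral (1 / \<alpha>) \<kappa>)"
      using \<alpha> nn_integral_exp_integral[OF \<kappa>, of "1 / \<alpha>"] by (subst exp_int) (auto simp: K01 K_def)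
    finally show ?thesis
      using \<kappa> by (simp add: exp_integral_def set_lebesgue_integral_def Bochner_Integration.integral_nonneg)
  qed
  have "integrable R (\<lambda>\<omega>. K (E \<omega>))"
  proof (rule R.integrable_const_bound[where B = 1])
    show "AE \<omega> in R. norm (K (E \<omega>)) \<le> 1"
      using E0 by eventually_elim (simp add: K01)
  qed measurable
  then have E_W1: "R.expectation (\<lambda>\<omega>. W (E \<omega>)) = 1 - \<kappa> * exp \<kappa> * exp_integral (1 / \<alpha>) \<kappa>"
    by (simp add: W_def E_K R.prob_space)
  \<comment> \<open>The functional equation of Gamma excludes its poles; it gives \<open>C 1\<close>
    = 1 - \<alpha>, the mean of the Beta factor.\<close>
  have "1 - \<alpha> \<notin> \<int>\<^sub>\<le>\<^sub>0"
    using \<alpha> by (auto dest: nonpos_Ints_nonpos)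
  then have "Gamma (2 - \<alpha>) = (1 - \<alpha>) * Gamma (1 - \<alpha>)"
    using Gamma_plus1[of "1 - \<alpha>"] by (simp add: algebra_simps)
  moreover have "0 < Gamma (1 - \<alpha>)"
    using \<alpha> by (intro Gamma_real_pos) simp
  ultimately have "C 1 = 1 - \<alpha>"
    by (simp add: C_def)
  then show "Q.expectation V = (1 - \<alpha>) * (1 - \<kappa> * exp \<kappa> * exp_integral (1 / \<alpha>) \<kappa>)"
    using E_V[of 1] E_W[of 1] E_W1 by simp
qed


section \<open>Bucket sums of an atomic measure\<close>

text \<open>Estimator sums run over symbols while the weights are indexed by points. Grouping by
  fibres of \<open>s\<close> connects the two even when several points share a location.\<close>

lemma infsum_fibres:
  fixes g :: "nat \<Rightarrow> real"
  assumes g: "\<And>k. 0 \<le> g k" "summable g"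
  shows "(\<Sum>\<^sub>\<infinity>a\<in>range s. \<Sum>\<^sub>\<infinity>k\<in>s -` {a}. g k) = suminf g"
proof -
  have g_on: "g summable_on UNIV"
    using g by (simp add: summable_on_UNIV_nonneg_real_iff)
  have bij: "bij_betw (\<lambda>k. (s k, k)) UNIV (Sigma (range s) (\<lambda>a. s -` {a}))"
    by (auto simp: bij_betw_def inj_on_def image_iff)
  have "(\<lambda>(a, k). g k) summable_on Sigma (range s) (\<lambda>a. s -` {a})"
    using g_on summable_on_reindex_bij_betw[OF bij, of "\<lambda>(a, k). g k"] by simp
  then have "(\<Sum>\<^sub>\<infinity>a\<in>range s. \<Sum>\<^sub>\<infinity>k\<in>s -` {a}. g k) =
      (\<Sum>\<^sub>\<infinity>(a, k)\<in>Sigma (range s) (\<lambda>a. s -` {a}). g k)"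
    by (rule infsum_Sigma'_banach)
  also have "\<dots> = infsum g UNIV"
    using infsum_reindex_bij_betw[OF bij, of "\<lambda>(a, k). g k"] by simp
  also have "\<dots> = suminf g"
    using has_sum_imp_sums[OF has_sum_infsum[OF g_on]] by (rule sums_unique)
  finally show ?thesis .
qed

lemma infsum_indicator_fibre:
  fixes g :: "nat \<Rightarrow> real"
  assumes g: "\<And>k. 0 \<le> g k" "summable g"
  shows "(\<Sum>\<^sub>\<infinity>k\<in>B. g k) = (\<Sum>k. g k * indicator B k)"
proof -
  have "summable (\<lambda>k. g k * indicator B k)"
    by (rule summable_comparison_test'[OF g(2), of 0]) (use g(1) in \<open>auto simp: indicator_def\<close>)
  then have on: "(\<lambda>k. g k * indicator B k) summable_on UNIV"
    using g by (simp add: summable_on_UNIV_nonneg_real_iff)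
  have "(\<Sum>\<^sub>\<infinity>k\<in>B. g k) = (\<Sum>\<^sub>\<infinity>k\<in>UNIV. g k * indicator B k)"
    by (intro infsum_cong_neutral) auto
  also have "\<dots> = (\<Sum>k. g k * indicator B k)"
    using has_sum_imp_sums[OF has_sum_infsum[OF on]] by (rule sums_unique)
  finally show ?thesis .
qed

text \<open>Zero weights and repeated locations are allowed, so that the identities below hold for
  every \<omega> and not just almost every one; the estimator is an integral over all of
  them.\<close>

locale atomic_measure =
  fixes P :: "'a::t2_space measure" and y :: "nat \<Rightarrow> real" and s :: "nat \<Rightarrow> 'a"
  assumes y_nonneg: "\<And>k. 0 \<le> y k" and y_summable: "summable y"
    and emeasure_P: "\<And>A. A \<in> sets borel \<Longrightarrow> emeasure P A = (\<Sum>k. ennreal (y k * indicator A (s k)))"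
begin

lemma restricted_summable: "summable (\<lambda>k. y k * indicator (B k) (x k))"
  by (rule summable_comparison_test'[OF y_summable, of 0]) (use y_nonneg in \<open>auto simp: indicator_def\<close>)

lemma measure_atom: "measure P {a} = (\<Sum>k. y k * indicator {a} (s k))"
proof -
  have "emeasure P {a} = (\<Sum>k. ennreal (y k * indicator {a} (s k)))"
    by (rule emeasure_P) simp
  also have "\<dots> = ennreal (\<Sum>k. y k * indicator {a} (s k))"
    using y_nonneg by (intro suminf_ennreal2 restricted_summable) simp
  finally show ?thesis
    using y_nonneg by (simp add: measure_def suminf_nonneg restricted_summable)
qed

lemma measure_atom_fibre: "measure P {a} = (\<Sum>\<^sub>\<infinity>k\<in>s -` {a}. y k)"
  unfolding measure_atom infsum_indicator_fibre[OF y_nonneg y_summable]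
  by (simp add: indicator_def)

lemma measure_atom_le: "measure P {a} \<le> suminf y"
  unfolding measure_atom using y_nonneg
  by (intro suminf_le restricted_summable y_summable) (auto simp: indicator_def)

text \<open>The atoms of the bucket and the range of \<open>s\<close> differ only in symbols where
  the corresponding summand vanishes: locations of zero weight, or symbols with another hash
  value.\<close>

lemma infsum_bucket:
  fixes f :: "'a \<Rightarrow> real"
  assumes f: "\<And>a. 0 \<le> f a" "\<And>a. f a \<le> C"
  shows "(\<Sum>\<^sub>\<infinity>a\<in>bucket_atoms P h j. measure P {a} * f a) =
    (\<Sum>k. y k * indicator {j} (h (s k)) * f (s k))"
proof -
  define g where "g k = y k * indicator {j} (h (s k)) * f (s k)" for k
  have g: "0 \<le> g k" for k
    using y_nonneg f by (simp add: g_def)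
  have g_le: "g k \<le> C * y k" for k
  proof -
    have "y k * f (s k) \<le> y k * C" "0 \<le> C"
      using y_nonneg f order_trans[OF f(1)[of "s k"] f(2)[of "s k"]] by (auto intro: mult_left_mono)
    then show ?thesis
      using y_nonneg[of k] by (simp add: g_def indicator_def mult.commute)
  qed
  have g_sum: "summable g"
    by (rule summable_comparison_test'[OF summable_mult[OF y_summable, of C], of 0]) (use g g_le in auto)
  have "(\<Sum>\<^sub>\<infinity>a\<in>bucket_atoms P h j. measure P {a} * f a) =
      (\<Sum>\<^sub>\<infinity>a\<in>range s. \<Sum>\<^sub>\<infinity>k\<in>s -` {a}. g k)"
  proof (rule infsum_cong_neutral)
    have fibre: "(\<Sum>\<^sub>\<infinity>k\<in>s -` {a}. g k) = measure P {a} * (indicator {j} (h a) * f a)" for a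
    proof -
      have "(\<Sum>\<^sub>\<infinity>k\<in>s -` {a}. g k) = (\<Sum>\<^sub>\<infinity>k\<in>s -` {a}. y k * (indicator {j} (h a) * f a))"
        by (intro infsum_cong) (auto simp: g_def mult.assoc)
      then show ?thesis
        by (simp add: infsum_cmult_left' measure_atom_fibre)
    qed
    show "(\<Sum>\<^sub>\<infinity>k\<in>s -` {a}. g k) = 0" if "a \<in> range s - bucket_atoms P h j" for a
      using that measure_nonneg[of P "{a}"] unfolding fibre
      by (auto simp: bucket_atoms_def indicator_def less_le)
    show "measure P {a} * f a = (\<Sum>\<^sub>\<infinity>k\<in>s -` {a}. g k)" if "a \<in> bucket_atoms P h j \<inter> range s" for a
      using that unfolding fibre by (simp add: bucket_atoms_def)
    show "measure P {a} * f a = 0" if "a \<in> bucket_atoms P h j - range s" for a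
    proof -
      have "s -` {a} = {}"
        using that by auto
      then show ?thesis
        by (simp add: measure_atom_fibre)
    qed
  qed
  also have "\<dots> = suminf g"
    by (rule infsum_fibres[OF g g_sum])
  finally show ?thesis
    unfolding g_def[abs_def] .
qed

lemma bucket_mass_eq: "bucket_mass P h j = (\<Sum>k. y k * indicator {j} (h (s k)))"
  using infsum_bucket[of "\<lambda>_. 1" 1 h j] by (simp add: bucket_mass_def)

lemma bucket_ratio_eq:
  "(\<Sum>\<^sub>\<infinity>a\<in>bucket_atoms P h j. (measure P {a} / bucket_mass P h j)\<^sup>2) =
    (\<Sum>k. y k * indicator {j} (h (s k)) * measure P {s k}) / (\<Sum>k. y k * indicator {j} (h (s k)))\<^sup>2"
proof -
  let ?q = "bucket_mass P h j"
  have "(\<Sum>\<^sub>\<infinity>a\<in>bucket_atoms P h j. (measure P {a} / ?q)\<^sup>2) =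
      (\<Sum>\<^sub>\<infinity>a\<in>bucket_atoms P h j. measure P {a} * measure P {a} * (1 / ?q\<^sup>2))"
    by (intro infsum_cong) (simp add: power2_eq_square)
  also have "\<dots> = (\<Sum>\<^sub>\<infinity>a\<in>bucket_atoms P h j. measure P {a} * measure P {a}) * (1 / ?q\<^sup>2)"
    by (rule infsum_cmult_left')
  also have "(\<Sum>\<^sub>\<infinity>a\<in>bucket_atoms P h j. measure P {a} * measure P {a}) =
      (\<Sum>k. y k * indicator {j} (h (s k)) * measure P {s k})"
    by (rule infsum_bucket[of _ "suminf y"]) (auto intro: measure_atom_le)
  finally show ?thesis
    by (simp add: bucket_mass_eq)
qed

lemma bucket_weight_summable: "summable (\<lambda>k. y k * indicator {j} (h (s k)) * measure P {s k})"
proof (rule summable_comparison_test'[OF summable_mult[OF y_summable, of "suminf y"], of 0])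
  fix k
  have "y k * measure P {s k} \<le> y k * suminf y"
    using y_nonneg measure_atom_le by (intro mult_left_mono) auto
  then show "norm (y k * indicator {j} (h (s k)) * measure P {s k}) \<le> suminf y * y k"
    using y_nonneg suminf_nonneg[OF y_summable y_nonneg]
    by (auto simp: indicator_def mult.commute)
qed

text \<open>Every atom of the bucket weighs at most the bucket mass, so the numerator is at most its
  square. For a bucket without mass the quotient is 0 by the convention on division.\<close>

lemma bucket_ratio_bounds:
  "0 \<le> (\<Sum>k. y k * indicator {j} (h (s k)) * measure P {s k}) / (\<Sum>k. y k * indicator {j} (h (s k)))\<^sup>2"
  "(\<Sum>k. y k * indicator {j} (h (s k)) * measure P {s k}) / (\<Sum>k. y k * indicator {j} (h (s k)))\<^sup>2 \<le> 1"
proof -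
  let ?b = "\<lambda>k. indicator {j} (h (s k)) :: real"
  let ?Q = "\<Sum>k. y k * ?b k" and ?R = "\<Sum>k. y k * ?b k * measure P {s k}"
  have "0 \<le> ?R"
    using y_nonneg by (intro suminf_nonneg bucket_weight_summable) simp
  then show "0 \<le> ?R / ?Q\<^sup>2"
    by simp
  have "measure P {s k} \<le> ?Q" if "h (s k) = j" for k
    unfolding measure_atom using that y_nonneg
    by (intro suminf_le restricted_summable) (auto simp: indicator_def)
  then have "?R \<le> (\<Sum>k. y k * ?b k * ?Q)"
    using y_nonneg
    by (intro suminf_le bucket_weight_summable summable_mult2 restricted_summable)
      (auto simp: indicator_def intro!: mult_left_mono)
  also have "\<dots> = ?Q * ?Q"
    by (intro suminf_mult2[symmetric] restricted_summable)
  finally show "?R / ?Q\<^sup>2 \<le> 1"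
    by (cases "?Q = 0") (simp_all add: divide_le_eq_1 power2_eq_square[symmetric])
qed

end

text \<open>If the total mass is 0 or infinite, every product of its inverse with a jump is 0 in
  \<open>ennreal\<close>, so the weights are all 0 and the claim survives these degenerate
  cases.\<close>

lemma normalized_jump_measure_atomic:
  fixes X :: "nat \<Rightarrow> 'w \<Rightarrow> real \<times> 'a::t2_space"
  defines "T \<equiv> total_mass (jump_measure X)"
  shows "atomic_measure (scale_measure (inverse (T \<omega>)) (jump_measure X \<omega>))
    (\<lambda>k. enn2real (inverse (T \<omega>) * ennreal (fst (X k \<omega>)))) (\<lambda>k. snd (X k \<omega>))"
proof -
  let ?x = "\<lambda>k. ennreal (fst (X k \<omega>))"
  have T: "T \<omega> = (\<Sum>k. ?x k)"
    by (simp add: T_def total_mass_jump_measure)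
  have sum: "(\<Sum>k. inverse (T \<omega>) * ?x k) \<le> 1"
  proof (cases "T \<omega> = 0 \<or> T \<omega> = \<top>")
    case True
    then show ?thesis
      using T by auto
  next
    case False
    then have "inverse (T \<omega>) * T \<omega> = 1"
      using ennreal_divide_self[of "T \<omega>"] by (simp add: divide_ennreal_def mult.commute less_top)
    then show ?thesis
      using T by simp
  qed
  then have fin: "(\<Sum>k. inverse (T \<omega>) * ?x k) \<noteq> \<top>"
    using ennreal_one_less_top by (auto simp: top_unique)
  then have fin_k: "inverse (T \<omega>) * ?x k \<noteq> \<top>" for k
    using ennreal_suminf_lessD[of "\<lambda>k. inverse (T \<omega>) * ?x k" \<top> k] by (simp add: less_top)
  then have y: "ennreal (enn2real (inverse (T \<omega>) * ?x k)) = inverse (T \<omega>) * ?x k" for k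
    by (simp add: less_top)
  show ?thesis
  proof
    show "summable (\<lambda>k. enn2real (inverse (T \<omega>) * ?x k))"
      using fin by (intro summable_suminf_not_top) (simp_all only: y enn2real_nonneg, simp)
    fix A :: "'a set" assume A: "A \<in> sets borel"
    have "emeasure (jump_measure X \<omega>) A = (\<Sum>k. ?x k * indicator A (snd (X k \<omega>)))"
      unfolding jump_measure_def using A
      by (subst emeasure_distr)
        (auto simp: emeasure_density nn_integral_count_space_nat indicator_def intro!: suminf_cong)
    then have "emeasure (scale_measure (inverse (T \<omega>)) (jump_measure X \<omega>)) A =
        (\<Sum>k. inverse (T \<omega>) * (?x k * indicator A (snd (X k \<omega>))))"
      by simp
    also have "\<dots> = (\<Sum>k. ennreal (enn2real (inverse (T \<omega>) * ?x k) * indicator A (snd (X k \<omega>))))"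
      by (intro suminf_cong) (auto simp: indicator_def y)
    finally show "emeasure (scale_measure (inverse (T \<omega>)) (jump_measure X \<omega>)) A =
        (\<Sum>k. ennreal (enn2real (inverse (T \<omega>) * ?x k) * indicator A (snd (X k \<omega>))))" .
  qed simp
qed

section \<open>The bucket ratio as a function of the points and the hash function\<close>

locale hashed_levy = levy_points M \<theta> G0 \<rho> X + hash: universal_hash H J
  for M :: "'w measure" and \<theta> :: real and G0 :: "'a::{second_countable_topology, t2_space} measure"
    and \<rho> :: "real \<Rightarrow> real" and X :: "nat \<Rightarrow> 'w \<Rightarrow> real \<times> 'a"
    and H :: "('a \<Rightarrow> nat) measure" and J :: nat +
  fixes j :: nat
  assumes j: "j \<in> {1..J}"
begin

abbreviation "T \<equiv> total_mass (jump_measure X)"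

definition P :: "'w \<Rightarrow> 'a measure" where
  "P \<omega> = scale_measure (inverse (T \<omega>)) (jump_measure X \<omega>)"

definition y :: "nat \<Rightarrow> 'w \<Rightarrow> real" where
  "y k \<omega> = enn2real (inverse (T \<omega>) * ennreal (fst (X k \<omega>)))"

definition b :: "nat \<Rightarrow> 'w \<Rightarrow> ('a \<Rightarrow> nat) \<Rightarrow> real" where
  "b k \<omega> h = indicator {j} (h (snd (X k \<omega>)))"

text \<open>The second factor is the full mass of the atom rather than the weight of the k-th point:
  only so does the sum over points agree with the sum over symbols when locations coincide.\<close>

definition ratio :: "'w \<Rightarrow> ('a \<Rightarrow> nat) \<Rightarrow> real" where
  "ratio \<omega> h = (\<Sum>k. y k \<omega> * b k \<omega> h * measure (P \<omega>) {snd (X k \<omega>)}) / (\<Sum>k. y k \<omega> * b k \<omega> h)\<^sup>2"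

lemma atomic: "atomic_measure (P \<omega>) (\<lambda>k. y k \<omega>) (\<lambda>k. snd (X k \<omega>))"
  unfolding P_def y_def by (rule normalized_jump_measure_atomic)

lemma ratio_eq:
  "(\<Sum>\<^sub>\<infinity>s\<in>bucket_atoms (P \<omega>) h j. (measure (P \<omega>) {s} / bucket_mass (P \<omega>) h j)\<^sup>2) = ratio \<omega> h"
  unfolding atomic_measure.bucket_ratio_eq[OF atomic] ratio_def b_def ..

lemma ratio_bounds: "0 \<le> ratio \<omega> h" "ratio \<omega> h \<le> 1"
  unfolding ratio_def b_def by (rule atomic_measure.bucket_ratio_bounds[OF atomic])+

lemma b_measurable_hash [measurable]: "b k \<omega> \<in> borel_measurable H"
  unfolding b_def[abs_def] by (rule measurable_compose[OF hash.hash_measurable]) simp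

lemma ratio_measurable_hash [measurable]: "ratio \<omega> \<in> borel_measurable H"
  unfolding ratio_def[abs_def] by measurable

lemma T_measurable [measurable]: "T \<in> borel_measurable M"
  unfolding total_mass_jump_measure[abs_def] by measurable

lemma y_measurable [measurable]: "y k \<in> borel_measurable M"
  unfolding y_def[abs_def] by measurable

text \<open>The separating sets turn equality of two locations into a countable conjunction of
  measurable conditions.\<close>

lemma same_location_measurable: "{\<omega>\<in>space M. snd (X k \<omega>) = snd (X l \<omega>)} \<in> sets M"
proof -
  have eq_iff: "s = t \<longleftrightarrow> (\<forall>i. s \<in> separating_open i \<longleftrightarrow> t \<in> separating_open i)" for s t :: 'a
    using separating_open_separates[of s t] by auto
  have "{\<omega>\<in>space M. snd (X k \<omega>) = snd (X l \<omega>)} =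
      {\<omega>\<in>space M. \<forall>i. snd (X k \<omega>) \<in> separating_open i \<longleftrightarrow> snd (X l \<omega>) \<in> separating_open i}"
    by (intro Collect_cong conj_cong refl eq_iff)
  also have "\<dots> \<in> sets M"
  proof -
    have [measurable]: "separating_open i \<in> sets (borel :: 'a measure)" for i
      by (rule borel_open[OF open_separating])
    show ?thesis
      by measurable
  qed
  finally show ?thesis .
qed

lemma atom_measurable [measurable]: "(\<lambda>\<omega>. measure (P \<omega>) {snd (X k \<omega>)}) \<in> borel_measurable M"
proof -
  have "(\<lambda>\<omega>. \<Sum>l. y l \<omega> * indicator {\<omega>\<in>space M. snd (X l \<omega>) = snd (X k \<omega>)} \<omega>) \<in> borel_measurable M"
    using same_location_measurable by measurable
  moreover have "measure (P \<omega>) {snd (X k \<omega>)} =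
      (\<Sum>l. y l \<omega> * indicator {\<omega>\<in>space M. snd (X l \<omega>) = snd (X k \<omega>)} \<omega>)" if "\<omega> \<in> space M" for \<omega>
    unfolding atomic_measure.measure_atom[OF atomic] using that by (simp add: indicator_def)
  ultimately show ?thesis
    by (subst measurable_cong)
qed

text \<open>
  Since \<open>(h, x) \<mapsto> h x\<close> is not jointly measurable, Fubini does not apply. The mean over \<open>h\<close> is a limit
  of means of functions of finitely many hash values, which only involve the joint laws of those.
\<close>

lemma mean_ratio_measurable: "(\<lambda>\<omega>. \<integral>h. ratio \<omega> h \<partial>H) \<in> borel_measurable M"
proof (rule borel_measurable_LIMSEQ_real)
  \<comment> \<open>A truncated quotient can exceed 1 when locations coincide. The minimum with 1
    supplies the bound for dominated convergence and leaves the limit alone, since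
    \<open>ratio\<close> is at most 1.\<close>
  define \<Phi> where "\<Phi> n \<omega> l = min 1 ((\<Sum>k<n. y k \<omega> * indicator {j} (l k) * measure (P \<omega>) {snd (X k \<omega>)}) /
      (\<Sum>k<n. y k \<omega> * indicator {j} (l k))\<^sup>2)" for n \<omega> and l :: "nat \<Rightarrow> nat"
  define I where "I n \<omega> = (\<integral>h. \<Phi> n \<omega> (\<lambda>i\<in>{..<n}. h (snd (X i \<omega>))) \<partial>H)" for n \<omega>
  have restr: "\<Phi> n \<omega> (\<lambda>i\<in>{..<n}. h (snd (X i \<omega>))) =
      min 1 ((\<Sum>k<n. y k \<omega> * b k \<omega> h * measure (P \<omega>) {snd (X k \<omega>)}) / (\<Sum>k<n. y k \<omega> * b k \<omega> h)\<^sup>2)" for n \<omega> h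
  proof -
    have "(\<Sum>k<n. y k \<omega> * indicator {j} ((\<lambda>i\<in>{..<n}. h (snd (X i \<omega>))) k) * measure (P \<omega>) {snd (X k \<omega>)}) =
        (\<Sum>k<n. y k \<omega> * b k \<omega> h * measure (P \<omega>) {snd (X k \<omega>)})"
      "(\<Sum>k<n. y k \<omega> * indicator {j} ((\<lambda>i\<in>{..<n}. h (snd (X i \<omega>))) k)) = (\<Sum>k<n. y k \<omega> * b k \<omega> h)"
      by (rule sum.cong[OF refl], simp add: b_def)+
    then show ?thesis
      unfolding \<Phi>_def by (simp only:)
  qed
  show "I n \<in> borel_measurable M" for n
  proof -
    have law_meas: "(\<lambda>\<omega>. measure H {h\<in>space H. \<forall>i<n. h (snd (X i \<omega>)) = l i}) \<in> borel_measurable M" for l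
      by (rule hash.pattern_measurable) (rule location_measurable)
    have \<Phi>_meas: "(\<lambda>\<omega>. \<Phi> n \<omega> l) \<in> borel_measurable M" for l
      unfolding \<Phi>_def by measurable
    have I_sum: "I n = (\<lambda>\<omega>. \<Sum>l\<in>Pi\<^sub>E {..<n} (\<lambda>_. {1..J}).
        \<Phi> n \<omega> l * measure H {h\<in>space H. \<forall>i<n. h (snd (X i \<omega>)) = l i})"
    proof
      fix \<omega>
      show "I n \<omega> = (\<Sum>l\<in>Pi\<^sub>E {..<n} (\<lambda>_. {1..J}).
          \<Phi> n \<omega> l * measure H {h\<in>space H. \<forall>i<n. h (snd (X i \<omega>)) = l i})"
        unfolding I_def by (rule hash.expectation_hash_pattern[of "\<Phi> n \<omega>"])
    qed
    show ?thesis
      unfolding I_sum by (intro borel_measurable_sum borel_measurable_times \<Phi>_meas law_meas)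
  qed
  fix \<omega>
  interpret A: atomic_measure "P \<omega>" "\<lambda>k. y k \<omega>" "\<lambda>k. snd (X k \<omega>)"
    by (rule atomic)
  show "(\<lambda>n. I n \<omega>) \<longlonglongrightarrow> (\<integral>h. ratio \<omega> h \<partial>H)"
    unfolding I_def restr
  proof (rule integral_dominated_convergence[where w = "\<lambda>_. 1"])
    let ?R = "\<lambda>h n. \<Sum>k<n. y k \<omega> * b k \<omega> h * measure (P \<omega>) {snd (X k \<omega>)}"
    let ?Q = "\<lambda>h n. \<Sum>k<n. y k \<omega> * b k \<omega> h"
    have nn: "0 \<le> y k \<omega> * b k \<omega> h" for k h
      using A.y_nonneg by (simp add: b_def)
    show "AE h in H. (\<lambda>n. min 1 (?R h n / (?Q h n)\<^sup>2)) \<longlonglongrightarrow> ratio \<omega> h"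
    proof (rule AE_I2)
      fix h
      have R: "?R h \<longlonglongrightarrow> (\<Sum>k. y k \<omega> * b k \<omega> h * measure (P \<omega>) {snd (X k \<omega>)})"
        unfolding b_def by (rule summable_LIMSEQ[OF A.bucket_weight_summable])
      have sQ: "summable (\<lambda>k. y k \<omega> * b k \<omega> h)"
        unfolding b_def by (rule A.restricted_summable)
      have Q: "?Q h \<longlonglongrightarrow> (\<Sum>k. y k \<omega> * b k \<omega> h)"
        by (rule summable_LIMSEQ[OF sQ])
      have "(\<lambda>n. ?R h n / (?Q h n)\<^sup>2) \<longlonglongrightarrow> ratio \<omega> h"
      \<comment> \<open>In a bucket without mass every partial quotient is 0 / 0 = 0, in agreement
        with the limit.\<close>
      proof (cases "(\<Sum>k. y k \<omega> * b k \<omega> h) = 0")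
        case True
        then have zero: "y k \<omega> * b k \<omega> h = 0" for k
          using suminf_eq_zero_iff[OF sQ nn] by blast
        show ?thesis
          unfolding ratio_def zero by simp
      next
        case False
        then show ?thesis
          unfolding ratio_def by (intro tendsto_divide tendsto_power R Q) simp
      qed
      then have "(\<lambda>n. min 1 (?R h n / (?Q h n)\<^sup>2)) \<longlonglongrightarrow> min 1 (ratio \<omega> h)"
        by (intro tendsto_min tendsto_const)
      then show "(\<lambda>n. min 1 (?R h n / (?Q h n)\<^sup>2)) \<longlonglongrightarrow> ratio \<omega> h"
        using ratio_bounds[of \<omega> h] by simp
    qed
    have "0 \<le> ?R h n / (?Q h n)\<^sup>2" for h n
      by (intro divide_nonneg_nonneg sum_nonneg mult_nonneg_nonneg[OF nn]) auto
    then show "AE h in H. norm (min 1 (?R h n / (?Q h n)\<^sup>2)) \<le> 1" for n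
      by (intro AE_I2) (simp add: min_def)
  qed measurable
qed

end


section \<open>The mean over the hash function\<close>

lemma one_minus_exp_bounds:
  fixes d :: real
  assumes "0 \<le> d"
  shows "d / (1 + d) \<le> 1 - exp (- d)" "1 - exp (- d) \<le> d"
proof -
  have "exp (- d) \<le> 1 / (1 + d)"
    using assms exp_ge_add_one_self[of d] by (simp add: exp_minus field_simps)
  then show "d / (1 + d) \<le> 1 - exp (- d)"
    using assms by (simp add: field_simps)
  show "1 - exp (- d) \<le> d"
    using exp_ge_add_one_self[of "- d"] by simp
qed

text \<open>A general sequence \<open>d\<close> is allowed because the lemma is applied both to r /
  (n + 1) and to the increments of the Laplace exponent. The sandwich is d / (1 + d) <= 1 - exp (-
  d) <= d.\<close>

lemma scaled_one_minus_exp_tendsto: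
  fixes d :: "nat \<Rightarrow> real"
  assumes d: "\<And>n. 0 \<le> d n" and lim: "(\<lambda>n. real (Suc n) * d n) \<longlonglongrightarrow> L"
  shows "(\<lambda>n. real (Suc n) * (1 - exp (- d n))) \<longlonglongrightarrow> L"
proof -
  have "(\<lambda>n. real (Suc n) * d n * (1 / real (Suc n))) \<longlonglongrightarrow> L * 0"
    by (intro tendsto_mult lim lim_1_over_n[THEN LIMSEQ_Suc])
  then have "d \<longlonglongrightarrow> 0"
    by simp
  then have "(\<lambda>n. real (Suc n) * d n / (1 + d n)) \<longlonglongrightarrow> L / (1 + 0)"
    by (intro tendsto_divide lim tendsto_add tendsto_const) auto
  then have low: "(\<lambda>n. real (Suc n) * d n / (1 + d n)) \<longlonglongrightarrow> L"
    by simp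
  show ?thesis
  proof (rule tendsto_sandwich[OF _ _ low lim])
    have "real (Suc n) * d n / (1 + d n) \<le> real (Suc n) * (1 - exp (- d n))" for n
      using mult_left_mono[OF one_minus_exp_bounds(1)[OF d[of n]], of "real (Suc n)"] by simp
    then show "\<forall>\<^sub>F n in sequentially. real (Suc n) * d n / (1 + d n) \<le> real (Suc n) * (1 - exp (- d n))"
      by simp
    have "real (Suc n) * (1 - exp (- d n)) \<le> real (Suc n) * d n" for n
      by (intro mult_left_mono one_minus_exp_bounds(2) d) simp
    then show "\<forall>\<^sub>F n in sequentially. real (Suc n) * (1 - exp (- d n)) \<le> real (Suc n) * d n"
      by simp
  qed
qed

text \<open>Concavity of 1 - exp (- t): difference quotients at 0 increase as the step shrinks. Thus
  derivatives are exchanged with integrals by monotone convergence.\<close>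

lemma scaled_one_minus_exp_mono:
  fixes r :: real
  assumes r: "0 \<le> r"
  shows "real (Suc n) * (1 - exp (- (r / real (Suc n)))) \<le>
    real (Suc (Suc n)) * (1 - exp (- (r / real (Suc (Suc n)))))"
proof -
  let ?m = "real (Suc n)" and ?m' = "real (Suc (Suc n))"
  define D where "D r = ?m' * (1 - exp (- (r / ?m'))) - ?m * (1 - exp (- (r / ?m)))" for r
  have "D 0 \<le> D r"
  proof (rule DERIV_nonneg_imp_nondecreasing[OF r])
    fix x :: real assume x: "0 \<le> x" "x \<le> r"
    have "(D has_real_derivative exp (- (x / ?m')) - exp (- (x / ?m))) (at x)"
    proof -
      have "((\<lambda>x. a * (1 - exp (- (x / a)))) has_real_derivative exp (- (x / a))) (at x)"
        if "a \<noteq> 0" for a :: real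
        using that by (auto intro!: derivative_eq_intros)
      then show ?thesis
        unfolding D_def[abs_def] by (intro DERIV_diff) auto
    qed
    moreover have "x / ?m' \<le> x / ?m"
      using x by (intro divide_left_mono) auto
    ultimately show "\<exists>y. (D has_real_derivative y) (at x) \<and> 0 \<le> y"
      by (intro exI conjI) auto
  qed
  then show ?thesis
    by (simp add: D_def)
qed

context hashed_levy
begin

abbreviation "x k \<omega> \<equiv> fst (X k \<omega>)"

text \<open>
  \<open>exp (- f l u z)\<close> is the mean, over a hash value uniform on \<open>{1..J}\<close>, of
  \<open>exp (- (u * z + l * z\<^sup>2))\<close> if the value is \<open>j\<close> and of \<open>1\<close> otherwise. So for iid hash values
  \<open>\<Lambda> l u \<omega>\<close> is the Laplace transform of (bucket mass, bucket sum of squares) at \<open>(u, l)\<close>, and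
  \<open>K n u \<omega>\<close> is a difference quotient for its derivative in \<open>l\<close> at \<open>0\<close>.
\<close>

definition f :: "real \<Rightarrow> real \<Rightarrow> real \<Rightarrow> real" where
  "f l u z = - ln (1 - (1 - exp (- (u * z + l * z\<^sup>2))) / real J)"

definition \<Lambda> :: "real \<Rightarrow> real \<Rightarrow> 'w \<Rightarrow> ennreal" where
  "\<Lambda> l u \<omega> = (INF n. \<Prod>k<n. ennreal (exp (- f l u (x k \<omega>))))"

definition K :: "nat \<Rightarrow> real \<Rightarrow> 'w \<Rightarrow> ennreal" where
  "K n u \<omega> = ennreal (real (Suc n)) * (\<Lambda> 0 u \<omega> - \<Lambda> (1 / real (Suc n)) u \<omega>)"

definition good :: "'w \<Rightarrow> bool" where
  "good \<omega> \<longleftrightarrow> (\<forall>k. 0 < x k \<omega>) \<and> summable (\<lambda>k. x k \<omega>) \<and> inj (\<lambda>k. snd (X k \<omega>)) \<and>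
    (\<forall>n l. (\<forall>i<n. l i \<in> {1..J}) \<longrightarrow>
      measure H {h\<in>space H. \<forall>i<n. h (snd (X i \<omega>)) = l i} = 1 / real J ^ n)"

lemma AE_good: "AE \<omega> in M. good \<omega>"
  using AE_jumps_pos AE_jumps_summable AE_locations_distinct
    AE_hash_law_locations[OF hash.universal_hash_axioms]
  unfolding good_def by eventually_elim blast

lemma J_pos: "0 < real J"
  using hash.J by simp

lemma thinning_factor:
  assumes z: "0 < z" and u: "0 < u" and l: "0 \<le> l"
  shows "exp (- f l u z) = 1 - (1 - exp (- (u * z + l * z\<^sup>2))) / real J" "0 \<le> f l u z"
proof -
  define e where "e = exp (- (u * z + l * z\<^sup>2))"
  have "0 \<le> u * z + l * z\<^sup>2"
    using z u l by (intro add_nonneg_nonneg mult_nonneg_nonneg) simp_all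
  then have e: "0 < e" "e \<le> 1"
    unfolding e_def exp_le_one_iff by simp_all
  have "(1 - e) / real J \<le> (1 - e) / 1"
    using hash.J e by (intro divide_left_mono) auto
  then have pos: "0 < 1 - (1 - e) / real J"
    using e(1) by simp
  moreover have "1 - (1 - e) / real J \<le> 1"
    using e J_pos by simp
  ultimately show "exp (- f l u z) = 1 - (1 - exp (- (u * z + l * z\<^sup>2))) / real J" "0 \<le> f l u z"
    unfolding f_def e_def[symmetric] by (simp_all only: minus_minus exp_ln neg_0_le_iff_le ln_le_zero_iff)
qed

lemma f_measurable [measurable (raw)]:
  assumes [measurable]: "g \<in> borel_measurable N" "h \<in> borel_measurable N"
  shows "(\<lambda>\<omega>. f l (g \<omega>) (h \<omega>)) \<in> borel_measurable N"
  unfolding f_def by measurable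

lemma \<Lambda>_measurable [measurable]: "(\<lambda>z. \<Lambda> l (fst z) (snd z)) \<in> borel_measurable (borel \<Otimes>\<^sub>M M)"
  unfolding \<Lambda>_def by measurable

lemma \<Lambda>_measurable' [measurable]: "\<Lambda> l u \<in> borel_measurable M"
  unfolding \<Lambda>_def[abs_def] by measurable

lemma K_measurable [measurable]: "(\<lambda>z. K n (fst z) (snd z)) \<in> borel_measurable (borel \<Otimes>\<^sub>M M)"
  unfolding K_def by measurable

lemma K_measurable' [measurable]: "K n u \<in> borel_measurable M"
  unfolding K_def[abs_def] by measurable

definition Q :: "'w \<Rightarrow> ('a \<Rightarrow> nat) \<Rightarrow> real" where
  "Q \<omega> h = (\<Sum>k. x k \<omega> * b k \<omega> h)"

definition R :: "'w \<Rightarrow> ('a \<Rightarrow> nat) \<Rightarrow> real" where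
  "R \<omega> h = (\<Sum>k. (x k \<omega>)\<^sup>2 * b k \<omega> h)"

lemma Q_measurable [measurable]: "Q \<omega> \<in> borel_measurable H"
  unfolding Q_def[abs_def] by measurable

lemma R_measurable [measurable]: "R \<omega> \<in> borel_measurable H"
  unfolding R_def[abs_def] by measurable

context
  fixes \<omega> assumes good: "good \<omega>"
begin

lemma x_pos: "0 < x k \<omega>" and x_summable: "summable (\<lambda>k. x k \<omega>)" and
  s_inj: "inj (\<lambda>k. snd (X k \<omega>))"
  using good by (auto simp: good_def)

lemma x_sq_summable: "summable (\<lambda>k. (x k \<omega>)\<^sup>2)"
proof (rule summable_comparison_test'[OF summable_mult[OF x_summable, of "\<Sum>k. x k \<omega>"], of 0])
  fix k
  have "x k \<omega> \<le> (\<Sum>k. x k \<omega>)"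
    using sum_le_suminf[OF x_summable, of "{k}"] x_pos by (simp add: less_imp_le)
  then show "norm ((x k \<omega>)\<^sup>2) \<le> (\<Sum>k. x k \<omega>) * x k \<omega>"
    using x_pos[of k] by (simp add: power2_eq_square)
qed

lemma Q_summable: "summable (\<lambda>k. x k \<omega> * b k \<omega> h)"
  by (rule summable_comparison_test'[OF x_summable, of 0])
    (use x_pos in \<open>auto simp: b_def indicator_def less_imp_le\<close>)

lemma R_summable: "summable (\<lambda>k. (x k \<omega>)\<^sup>2 * b k \<omega> h)"
  by (rule summable_comparison_test'[OF x_sq_summable, of 0]) (auto simp: b_def indicator_def)

lemma Q_nonneg: "0 \<le> Q \<omega> h"
  unfolding Q_def using x_pos by (intro suminf_nonneg Q_summable) (simp add: b_def less_imp_le)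

lemma R_nonneg: "0 \<le> R \<omega> h"
  unfolding R_def by (intro suminf_nonneg R_summable) (simp add: b_def)

text \<open>Excludes the one conflict of conventions: with R > 0 and Q = 0 the integral of u R exp
  (- u Q) would be infinite, while the quotient is 0.\<close>

lemma R_eq_0: "Q \<omega> h = 0 \<Longrightarrow> R \<omega> h = 0"
proof -
  assume "Q \<omega> h = 0"
  then have "x k \<omega> * b k \<omega> h = 0" for k
    unfolding Q_def using suminf_eq_zero_iff[OF Q_summable] x_pos
    by (simp add: b_def less_imp_le)
  then have zero: "(x k \<omega>)\<^sup>2 * b k \<omega> h = 0" for k
    by (auto simp: power2_eq_square)
  show ?thesis
    unfolding R_def zero by simp
qed

text \<open>The ratio is homogeneous of degree 0, so the total mass \<open>t\<close> cancels.
  Injectivity of the locations makes each atom carry a single jump.\<close>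

lemma ratio_good: "ratio \<omega> h = R \<omega> h / (Q \<omega> h)\<^sup>2"
proof -
  interpret A: atomic_measure "P \<omega>" "\<lambda>k. y k \<omega>" "\<lambda>k. snd (X k \<omega>)"
    by (rule atomic)
  define t where "t = (\<Sum>k. x k \<omega>)"
  have t: "0 < t"
    unfolding t_def using x_pos x_summable by (intro suminf_pos)
  have "T \<omega> = ennreal t"
    unfolding total_mass_jump_measure t_def using x_pos x_summable
    by (intro suminf_ennreal2) (simp_all add: less_imp_le)
  then have y_eq: "y k \<omega> = x k \<omega> / t" for k
    using t x_pos[of k]
    by (simp add: y_def inverse_ennreal ennreal_mult[symmetric] divide_inverse mult.commute less_imp_le)
  have atom: "measure (P \<omega>) {snd (X k \<omega>)} = x k \<omega> / t" for k
  proof -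
    have "measure (P \<omega>) {snd (X k \<omega>)} = (\<Sum>l. y l \<omega> * indicator {snd (X k \<omega>)} (snd (X l \<omega>)))"
      by (rule A.measure_atom)
    also have "\<dots> = (\<Sum>l\<in>{k}. y l \<omega> * indicator {snd (X k \<omega>)} (snd (X l \<omega>)))"
      using s_inj by (intro suminf_finite) (auto simp: indicator_def inj_def)
    finally show ?thesis
      by (simp add: y_eq)
  qed
  have "(\<Sum>k. y k \<omega> * b k \<omega> h * measure (P \<omega>) {snd (X k \<omega>)}) = (\<Sum>k. (x k \<omega>)\<^sup>2 * b k \<omega> h * (1 / t\<^sup>2))"
    by (simp add: y_eq atom power2_eq_square mult_ac)
  also have "\<dots> = R \<omega> h * (1 / t\<^sup>2)"
    unfolding R_def by (rule suminf_mult2[symmetric, OF R_summable])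
  finally have num: "(\<Sum>k. y k \<omega> * b k \<omega> h * measure (P \<omega>) {snd (X k \<omega>)}) = R \<omega> h * (1 / t\<^sup>2)" .
  have "(\<Sum>k. y k \<omega> * b k \<omega> h) = (\<Sum>k. x k \<omega> * b k \<omega> h * (1 / t))"
    by (simp add: y_eq)
  also have "\<dots> = Q \<omega> h * (1 / t)"
    unfolding Q_def by (rule suminf_mult2[symmetric, OF Q_summable])
  finally have "(\<Sum>k. y k \<omega> * b k \<omega> h) = Q \<omega> h * (1 / t)" .
  then show ?thesis
    unfolding ratio_def num using t by (simp add: power_mult_distrib power_divide)
qed

text \<open>The exponential is a decreasing limit of products over finitely many points, and each
  finite product only involves the joint law of finitely many hash values, which \<open>good\<close>
  declares iid uniform.\<close>

lemma hash_laplace: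
  assumes u: "0 < u" and l: "0 \<le> l"
  shows "(\<integral>\<^sup>+h. ennreal (exp (- (u * Q \<omega> h + l * R \<omega> h))) \<partial>H) = \<Lambda> l u \<omega>"
proof -
  define g where "g k = u * x k \<omega> + l * (x k \<omega>)\<^sup>2" for k
  have g: "0 \<le> g k" for k
    using u l x_pos[of k] by (simp add: g_def)
  define \<phi> where "\<phi> k i = exp (- (g k * indicator {j} i))" for k and i :: nat
  have \<phi>1: "\<phi> k i \<le> 1" for k i
    using g by (simp add: \<phi>_def)
  have gb: "g k * b k \<omega> h = u * (x k \<omega> * b k \<omega> h) + l * ((x k \<omega>)\<^sup>2 * b k \<omega> h)" for k h
    by (simp add: g_def algebra_simps)
  have \<phi>_meas [measurable]: "(\<lambda>h. \<phi> k (h (snd (X k \<omega>)))) \<in> borel_measurable H" for k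
    by (rule measurable_compose[OF hash.hash_measurable]) simp
  have "ennreal (exp (- (u * Q \<omega> h + l * R \<omega> h))) = (INF n. \<Prod>k<n. ennreal (\<phi> k (h (snd (X k \<omega>)))))" for h
  proof -
    have "(\<lambda>k. g k * b k \<omega> h) sums (u * Q \<omega> h + l * R \<omega> h)"
      unfolding gb Q_def R_def by (intro sums_add sums_mult summable_sums Q_summable R_summable)
    then have "summable (\<lambda>k. g k * b k \<omega> h)" "(\<Sum>k. g k * b k \<omega> h) = u * Q \<omega> h + l * R \<omega> h"
      by (auto simp: sums_iff)
    moreover have "\<phi> k (h (snd (X k \<omega>))) = exp (- (g k * b k \<omega> h))" for k
      by (simp add: \<phi>_def b_def)
    moreover have "0 \<le> g k * b k \<omega> h" for k
      using g by (simp add: b_def)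
    ultimately show ?thesis
      by (simp add: INF_prod_exp)
  qed
  then have "(\<integral>\<^sup>+h. ennreal (exp (- (u * Q \<omega> h + l * R \<omega> h))) \<partial>H) =
      (\<integral>\<^sup>+h. (INF n. \<Prod>k<n. ennreal (\<phi> k (h (snd (X k \<omega>))))) \<partial>H)"
    by (simp only:)
  also have "\<dots> = (INF n. \<integral>\<^sup>+h. (\<Prod>k<n. ennreal (\<phi> k (h (snd (X k \<omega>))))) \<partial>H)"
  proof (rule nn_integral_monotone_convergence_INF_decseq[where i = 0])
    show "decseq (\<lambda>n h. \<Prod>k<n. ennreal (\<phi> k (h (snd (X k \<omega>)))))"
    proof (rule decseq_SucI, rule le_funI)
      fix n h
      have "decseq (\<lambda>n. \<Prod>k<n. ennreal (\<phi> k (h (snd (X k \<omega>)))))"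
        using \<phi>1 by (intro decseq_prod_ennreal) (simp add: ennreal_le_1)
      then show "(\<Prod>k<Suc n. ennreal (\<phi> k (h (snd (X k \<omega>))))) \<le> (\<Prod>k<n. ennreal (\<phi> k (h (snd (X k \<omega>)))))"
        by (rule decseq_SucD)
    qed
  qed (auto simp: hash.emeasure_space_1 simp del: prod_ennreal)
  also have "(\<lambda>n. \<integral>\<^sup>+h. (\<Prod>k<n. ennreal (\<phi> k (h (snd (X k \<omega>))))) \<partial>H) =
      (\<lambda>n. \<Prod>k<n. ennreal (exp (- f l u (x k \<omega>))))"
  proof
    fix n
    have "(\<integral>\<^sup>+h. (\<Prod>k<n. ennreal (\<phi> k (h (snd (X k \<omega>))))) \<partial>H) =
        (\<integral>\<^sup>+h. ennreal (\<Prod>k<n. \<phi> k (h (snd (X k \<omega>)))) \<partial>H)"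
      by (intro nn_integral_cong prod_ennreal) (simp add: \<phi>_def)
    also have "\<dots> = ennreal (hash.expectation (\<lambda>h. \<Prod>k<n. \<phi> k (h (snd (X k \<omega>)))))"
    proof (rule nn_integral_eq_integral)
      have "norm (\<Prod>k<n. \<phi> k (h (snd (X k \<omega>)))) \<le> 1" for h
        using \<phi>1 by (auto simp: \<phi>_def abs_prod intro!: prod_le_1)
      then show "integrable H (\<lambda>h. \<Prod>k<n. \<phi> k (h (snd (X k \<omega>))))"
        by (intro hash.integrable_const_bound[where B = 1]) auto
    qed (auto simp: \<phi>_def intro!: prod_nonneg)
    also have "hash.expectation (\<lambda>h. \<Prod>k<n. \<phi> k (h (snd (X k \<omega>)))) = (\<Prod>k<n. (\<Sum>i=1..J. \<phi> k i) / real J)"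
    proof (rule hash.expectation_prod_hash)
      fix l' :: "nat \<Rightarrow> nat" assume "\<And>i. i < n \<Longrightarrow> l' i \<in> {1..J}"
      then show "hash.prob {h\<in>space H. \<forall>i<n. h (snd (X i \<omega>)) = l' i} = 1 / real J ^ n"
        using good unfolding good_def by blast
    qed
    also have "\<dots> = (\<Prod>k<n. exp (- f l u (x k \<omega>)))"
    proof (rule prod.cong[OF refl])
      fix k
      \<comment> \<open>Of the J equally likely hash values only j contributes exp (- g); the other
        J - 1 contribute 1 each.\<close>
      have "(\<Sum>i=1..J. \<phi> k i) = \<phi> k j + (\<Sum>i\<in>{1..J} - {j}. \<phi> k i)"
        using j by (intro sum.remove) auto
      also have "(\<Sum>i\<in>{1..J} - {j}. \<phi> k i) = (\<Sum>i\<in>{1..J} - {j}. 1)"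
        by (intro sum.cong) (auto simp: \<phi>_def)
      also have "\<dots> = real J - 1"
        using j hash.J by (simp add: of_nat_diff)
      finally have "(\<Sum>i=1..J. \<phi> k i) = exp (- g k) + (real J - 1)"
        by (simp add: \<phi>_def)
      then show "(\<Sum>i=1..J. \<phi> k i) / real J = exp (- f l u (x k \<omega>))"
        using J_pos unfolding thinning_factor(1)[OF x_pos u l] by (simp add: g_def field_simps)
    qed
    finally show "(\<integral>\<^sup>+h. (\<Prod>k<n. ennreal (\<phi> k (h (snd (X k \<omega>))))) \<partial>H) =
        (\<Prod>k<n. ennreal (exp (- f l u (x k \<omega>))))"
      by (simp add: prod_ennreal)
  qed
  finally show ?thesis
    unfolding \<Lambda>_def .
qed

end

end

section \<open>Averaging over the Poisson points\<close>

lemma ennreal_indicator_mono: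
  fixes z :: real
  shows "(0 < z \<Longrightarrow> a \<le> b) \<Longrightarrow> ennreal a * indicator {0<..} z \<le> ennreal b * indicator {0<..} z"
  by (cases "0 < z") (auto intro: ennreal_leI)

context hashed_levy
begin

text \<open>The joint Laplace exponent, at (u, l), of the sum and the sum of squares of the jumps of
  a process with rate \<theta> / J.\<close>

definition I :: "real \<Rightarrow> real \<Rightarrow> ennreal" where
  "I l u = (\<integral>\<^sup>+z\<in>{0<..}. ennreal (\<theta> / real J * \<rho> z * (1 - exp (- (u * z + l * z\<^sup>2)))) \<partial>lborel)"

text \<open>The derivative of \<open>I l u\<close> in l at 0, differentiated under the
  integral.\<close>

definition D :: "real \<Rightarrow> ennreal" where
  "D u = (\<integral>\<^sup>+z\<in>{0<..}. ennreal (\<theta> / real J * \<rho> z * (z\<^sup>2 * exp (- (u * z)))) \<partial>lborel)"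

lemma rate_pos: "0 < \<theta> / real J"
  using \<theta> J_pos by simp

text \<open>Used at both levels: with \<open>r\<close> the sum of squares
  \<open>R \<omega> h\<close> inside the mean over \<open>h\<close>, and with \<open>r\<close> the
  scaled increment of the Laplace exponent after the mean over \<omega>.\<close>

lemma difference_quotient:
  assumes r: "0 \<le> r"
  shows "ennreal (real (Suc n)) * (ennreal (exp (- (a + 0 * r))) - ennreal (exp (- (a + 1 / real (Suc n) * r)))) =
    ennreal (exp (- a) * (real (Suc n) * (1 - exp (- (r / real (Suc n))))))"
proof -
  have "exp (- (a + 1 / real (Suc n) * r)) = exp (- a) * exp (- (r / real (Suc n)))"
    by (simp add: exp_add[symmetric])
  moreover have "exp (- (r / real (Suc n))) \<le> 1"
    using r by simp
  ultimately show ?thesis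
    by (simp add: ennreal_minus ennreal_mult'[symmetric] right_diff_distrib' del: of_nat_Suc)
qed

text \<open>\<open>K n u \<omega>\<close> is a mean over \<open>h\<close> of difference quotients
  increasing to R exp (- u Q). The supremum expresses the same mean without mentioning
  \<open>h\<close>, in a form that is jointly measurable in (u, \<omega>).\<close>

lemma K_good:
  assumes good: "good \<omega>" and u: "0 < u"
  shows "incseq (\<lambda>n. K n u \<omega>)"
    and "(\<integral>\<^sup>+h. ennreal (R \<omega> h * exp (- (u * Q \<omega> h))) \<partial>H) = (SUP n. K n u \<omega>)"
proof -
  note [simp] = R_nonneg[OF good]
  define d where "d n h = ennreal (exp (- (u * Q \<omega> h)) * (real (Suc n) * (1 - exp (- (R \<omega> h / real (Suc n))))))" for n h
  have d_meas [measurable]: "d n \<in> borel_measurable H" for n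
    unfolding d_def[abs_def] by measurable
  have inc: "incseq d"
    by (intro incseq_SucI le_funI)
      (auto simp: d_def simp del: of_nat_Suc intro!: ennreal_leI mult_left_mono scaled_one_minus_exp_mono)
  have Kd: "K n u \<omega> = (\<integral>\<^sup>+h. d n h \<partial>H)" for n
  proof -
    let ?e = "\<lambda>l h. ennreal (exp (- (u * Q \<omega> h + l * R \<omega> h)))"
    have "(\<integral>\<^sup>+h. ?e 0 h - ?e (1 / real (Suc n)) h \<partial>H) =
        (\<integral>\<^sup>+h. ?e 0 h \<partial>H) - (\<integral>\<^sup>+h. ?e (1 / real (Suc n)) h \<partial>H)"
    proof (rule nn_integral_diff)
      have "0 \<le> u * Q \<omega> h + 1 / real (Suc n) * R \<omega> h" for h
        using Q_nonneg[OF good, of h] u by (intro add_nonneg_nonneg mult_nonneg_nonneg) auto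
      then have "?e (1 / real (Suc n)) h \<le> 1" for h
        by (simp only: ennreal_le_1 exp_le_one_iff neg_le_0_iff_le)
      then have "(\<integral>\<^sup>+h. ?e (1 / real (Suc n)) h \<partial>H) \<le> (\<integral>\<^sup>+h. 1 \<partial>H)"
        by (intro nn_integral_mono)
      then show "(\<integral>\<^sup>+h. ?e (1 / real (Suc n)) h \<partial>H) \<noteq> \<infinity>"
        using ennreal_one_less_top by (auto simp: hash.emeasure_space_1 top_unique)
      show "AE h in H. ?e (1 / real (Suc n)) h \<le> ?e 0 h"
        by (intro AE_I2 ennreal_leI) simp
    qed measurable
    then have "\<Lambda> 0 u \<omega> - \<Lambda> (1 / real (Suc n)) u \<omega> = (\<integral>\<^sup>+h. ?e 0 h - ?e (1 / real (Suc n)) h \<partial>H)"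
      using hash_laplace[OF good u, of 0] hash_laplace[OF good u, of "1 / real (Suc n)"] by simp
    then have "K n u \<omega> = (\<integral>\<^sup>+h. ennreal (real (Suc n)) * (?e 0 h - ?e (1 / real (Suc n)) h) \<partial>H)"
      unfolding K_def by (subst nn_integral_cmult) auto
    also have "\<dots> = (\<integral>\<^sup>+h. d n h \<partial>H)"
      unfolding d_def by (intro nn_integral_cong difference_quotient) simp
    finally show ?thesis .
  qed
  show "incseq (\<lambda>n. K n u \<omega>)"
    unfolding Kd using incseq_SucD[OF inc] by (intro incseq_SucI nn_integral_mono) (auto simp: le_fun_def)
  have lim: "(\<lambda>n. d n h) \<longlonglongrightarrow> ennreal (R \<omega> h * exp (- (u * Q \<omega> h)))" for h
  proof -
    have "(\<lambda>n. real (Suc n) * (1 - exp (- (R \<omega> h / real (Suc n))))) \<longlonglongrightarrow> R \<omega> h"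
      by (rule scaled_one_minus_exp_tendsto) (simp_all del: of_nat_Suc)
    then have "(\<lambda>n. d n h) \<longlonglongrightarrow> ennreal (exp (- (u * Q \<omega> h)) * R \<omega> h)"
      unfolding d_def by (intro tendsto_ennrealI tendsto_mult tendsto_const)
    then show ?thesis
      by (simp add: mult.commute)
  qed
  have "(\<lambda>n. K n u \<omega>) \<longlonglongrightarrow> (\<integral>\<^sup>+h. ennreal (R \<omega> h * exp (- (u * Q \<omega> h))) \<partial>H)"
    unfolding Kd by (rule nn_integral_LIMSEQ[OF inc d_meas lim])
  then show "(\<integral>\<^sup>+h. ennreal (R \<omega> h * exp (- (u * Q \<omega> h))) \<partial>H) = (SUP n. K n u \<omega>)"
    using LIMSEQ_unique[OF LIMSEQ_SUP[OF \<open>incseq (\<lambda>n. K n u \<omega>)\<close>]] by simp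
qed

text \<open>For fixed \<omega> everything is measurable in \<open>h\<close>, so Fubini between
  \<open>h\<close> and \<open>u\<close> is legitimate here.\<close>

lemma mean_ratio_hash:
  assumes good: "good \<omega>"
  shows "(\<integral>\<^sup>+h. ennreal (ratio \<omega> h) \<partial>H) = (\<integral>\<^sup>+u\<in>{0<..}. ennreal u * (SUP n. K n u \<omega>) \<partial>lborel)"
proof -
  interpret HL: pair_sigma_finite H lborel
    by unfold_locales
  have "ennreal (ratio \<omega> h) = (\<integral>\<^sup>+u. ennreal (u * (R \<omega> h * exp (- (u * Q \<omega> h)))) * indicator {0<..} u \<partial>lborel)" for h
  proof (cases "Q \<omega> h = 0")
    case True
    then show ?thesis
      by (simp add: ratio_good[OF good] R_eq_0[OF good])
  next
    case False
    then have Q: "0 < Q \<omega> h"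
      using Q_nonneg[OF good, of h] by simp
    have "(\<integral>\<^sup>+u. ennreal (u * (R \<omega> h * exp (- (u * Q \<omega> h)))) * indicator {0<..} u \<partial>lborel) =
        (\<integral>\<^sup>+u. ennreal (R \<omega> h) * (ennreal (u ^ 1 / fact 1 * exp (- Q \<omega> h * u)) * indicator {0<..} u) \<partial>lborel)"
      using R_nonneg[OF good, of h]
      by (intro nn_integral_cong) (auto simp: indicator_def ennreal_mult'[symmetric] mult_ac)
    also have "\<dots> = ennreal (R \<omega> h) * ennreal (1 / Q \<omega> h ^ (1 + 1))"
      by (subst nn_integral_cmult) (simp_all only: nn_integral_power_times_exp_scaled[OF Q], measurable)
    finally show ?thesis
      using R_nonneg[OF good, of h]
      by (simp add: ratio_good[OF good] ennreal_mult'[symmetric] power2_eq_square)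
  qed
  then have "(\<integral>\<^sup>+h. ennreal (ratio \<omega> h) \<partial>H) =
      (\<integral>\<^sup>+h. \<integral>\<^sup>+u. ennreal (u * (R \<omega> h * exp (- (u * Q \<omega> h)))) * indicator {0<..} u \<partial>lborel \<partial>H)"
    by (simp only:)
  also have "\<dots> = (\<integral>\<^sup>+u. \<integral>\<^sup>+h. ennreal (u * (R \<omega> h * exp (- (u * Q \<omega> h)))) * indicator {0<..} u \<partial>H \<partial>lborel)"
    by (rule HL.Fubini'[symmetric]) measurable
  also have "\<dots> = (\<integral>\<^sup>+u\<in>{0<..}. ennreal u * (SUP n. K n u \<omega>) \<partial>lborel)"
  proof (rule nn_integral_cong)
    fix u :: real
    show "(\<integral>\<^sup>+h. ennreal (u * (R \<omega> h * exp (- (u * Q \<omega> h)))) * indicator {0<..} u \<partial>H) =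
        ennreal u * (SUP n. K n u \<omega>) * indicator {0<..} u"
    proof (cases "0 < u")
      case True
      then have "(\<integral>\<^sup>+h. ennreal (u * (R \<omega> h * exp (- (u * Q \<omega> h)))) * indicator {0<..} u \<partial>H) =
          (\<integral>\<^sup>+h. ennreal u * ennreal (R \<omega> h * exp (- (u * Q \<omega> h))) \<partial>H)"
        by (intro nn_integral_cong) (simp add: ennreal_mult'[symmetric])
      also have "\<dots> = ennreal u * (SUP n. K n u \<omega>)"
        by (subst nn_integral_cmult) (simp_all add: K_good(2)[OF good True])
      finally show ?thesis
        using True by simp
    qed simp
  qed
  finally show ?thesis .
qed

context
  fixes u :: real assumes u: "0 < u" and D_fin: "D u < \<infinity>"
begin

text \<open>The increment of \<open>I\<close> as l goes from 0 to 1 / (n + 1), given directly as an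
  integral to avoid subtraction in \<open>ennreal\<close>.\<close>

definition \<delta> :: "nat \<Rightarrow> ennreal" where
  "\<delta> n = (\<integral>\<^sup>+z\<in>{0<..}. ennreal (\<theta> / real J * \<rho> z * (exp (- (u * z)) * (1 - exp (- (1 / real (Suc n) * z\<^sup>2))))) \<partial>lborel)"

lemma I_split: "I (1 / real (Suc n)) u = I 0 u + \<delta> n"
proof -
  have "I (1 / real (Suc n)) u = (\<integral>\<^sup>+z.
      ennreal (\<theta> / real J * \<rho> z * (1 - exp (- (u * z + 0 * z\<^sup>2)))) * indicator {0<..} z +
      ennreal (\<theta> / real J * \<rho> z * (exp (- (u * z)) * (1 - exp (- (1 / real (Suc n) * z\<^sup>2))))) * indicator {0<..} z \<partial>lborel)"
    unfolding I_def
  proof (rule nn_integral_cong)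
    fix z :: real
    let ?l = "1 / real (Suc n)"
    show "ennreal (\<theta> / real J * \<rho> z * (1 - exp (- (u * z + ?l * z\<^sup>2)))) * indicator {0<..} z =
        ennreal (\<theta> / real J * \<rho> z * (1 - exp (- (u * z + 0 * z\<^sup>2)))) * indicator {0<..} z +
        ennreal (\<theta> / real J * \<rho> z * (exp (- (u * z)) * (1 - exp (- (?l * z\<^sup>2))))) * indicator {0<..} z"
    proof (cases "0 < z")
      case True
      have "exp (- (u * z + ?l * z\<^sup>2)) = exp (- (u * z)) * exp (- (?l * z\<^sup>2))"
        by (simp add: exp_add[symmetric])
      moreover have "c * (1 - a * b) = c * (1 - a) + c * (a * (1 - b))" for a b c :: real
        by (simp add: algebra_simps)
      ultimately have "\<theta> / real J * \<rho> z * (1 - exp (- (u * z + ?l * z\<^sup>2))) =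
          \<theta> / real J * \<rho> z * (1 - exp (- (u * z + 0 * z\<^sup>2))) +
          \<theta> / real J * \<rho> z * (exp (- (u * z)) * (1 - exp (- (?l * z\<^sup>2))))"
        by (simp only: mult_zero_left add_0_right)
      moreover have "0 \<le> \<theta> / real J * \<rho> z * (1 - exp (- (u * z + 0 * z\<^sup>2)))"
        "0 \<le> \<theta> / real J * \<rho> z * (exp (- (u * z)) * (1 - exp (- (?l * z\<^sup>2))))"
        using True u \<rho>_nonneg[OF True] \<theta> by (auto intro!: mult_nonneg_nonneg divide_nonneg_nonneg)
      moreover have "indicator {0<..} z = (1 :: ennreal)"
        using True by simp
      ultimately show ?thesis
        by (simp only: mult_1_right ennreal_plus)
    qed simp
  qed
  also have "\<dots> = I 0 u + \<delta> n"
    unfolding I_def \<delta>_def by (intro nn_integral_add) measurable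
  finally show ?thesis .
qed

lemma \<delta>_tendsto: "(\<lambda>n. ennreal (real (Suc n)) * \<delta> n) \<longlonglongrightarrow> D u"
proof -
  define d where "d n z = ennreal (\<theta> / real J * \<rho> z * (exp (- (u * z)) *
      (real (Suc n) * (1 - exp (- (z\<^sup>2 / real (Suc n))))))) * indicator {0<..} z" for n z
  have d_meas [measurable]: "d n \<in> borel_measurable lborel" for n
    unfolding d_def[abs_def] by measurable
  have "ennreal (real (Suc n)) * \<delta> n = (\<integral>\<^sup>+z. ennreal (real (Suc n)) * (ennreal (\<theta> / real J * \<rho> z *
      (exp (- (u * z)) * (1 - exp (- (1 / real (Suc n) * z\<^sup>2))))) * indicator {0<..} z) \<partial>lborel)" for n
    unfolding \<delta>_def by (rule nn_integral_cmult[symmetric]) measurable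
  also have "\<dots> n = (\<integral>\<^sup>+z. d n z \<partial>lborel)" for n
    by (rule nn_integral_cong)
      (auto simp: d_def indicator_def ennreal_mult'[symmetric] mult_ac simp del: of_nat_Suc)
  finally have \<delta>_eq: "ennreal (real (Suc n)) * \<delta> n = (\<integral>\<^sup>+z. d n z \<partial>lborel)" for n .
  have coef: "0 \<le> \<theta> / real J * \<rho> z" if "0 < z" for z
    using that \<rho>_nonneg rate_pos by (intro mult_nonneg_nonneg) auto
  have "(\<lambda>n. \<integral>\<^sup>+z. d n z \<partial>lborel) \<longlonglongrightarrow> D u"
    unfolding D_def
  proof (rule nn_integral_LIMSEQ[OF _ d_meas])
    show "incseq d"
    proof (rule incseq_SucI, rule le_funI)
      fix n z
      show "d n z \<le> d (Suc n) z"
        unfolding d_def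
        by (intro ennreal_indicator_mono mult_left_mono scaled_one_minus_exp_mono coef) auto
    qed
    fix z :: real
    have "(\<lambda>n. real (Suc n) * (1 - exp (- (z\<^sup>2 / real (Suc n))))) \<longlonglongrightarrow> z\<^sup>2"
      by (rule scaled_one_minus_exp_tendsto) (simp_all del: of_nat_Suc)
    then have "(\<lambda>n. ennreal (\<theta> / real J * \<rho> z * (exp (- (u * z)) *
        (real (Suc n) * (1 - exp (- (z\<^sup>2 / real (Suc n)))))))) \<longlonglongrightarrow>
        ennreal (\<theta> / real J * \<rho> z * (exp (- (u * z)) * z\<^sup>2))"
      by (intro tendsto_ennrealI tendsto_mult tendsto_const)
    then show "(\<lambda>n. d n z) \<longlonglongrightarrow> ennreal (\<theta> / real J * \<rho> z * (z\<^sup>2 * exp (- (u * z)))) * indicator {0<..} z"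
      by (cases "0 < z") (simp_all add: d_def mult.commute[of "z\<^sup>2"] del: of_nat_Suc)
  qed
  then show ?thesis
    unfolding \<delta>_eq .
qed

lemma \<delta>_fin: "\<delta> n < \<infinity>"
proof -
  have "\<delta> n \<le> D u"
    unfolding \<delta>_def D_def
  proof (rule nn_integral_mono)
    fix z :: real
    have "1 - exp (- (1 / real (Suc n) * z\<^sup>2)) \<le> 1 / real (Suc n) * z\<^sup>2"
      by (rule one_minus_exp_bounds(2)) simp
    also have "\<dots> \<le> 1 * z\<^sup>2"
      by (intro mult_right_mono) auto
    finally have le: "1 - exp (- (1 / real (Suc n) * z\<^sup>2)) \<le> z\<^sup>2"
      by simp
    have "\<theta> / real J * \<rho> z * (exp (- (u * z)) * (1 - exp (- (1 / real (Suc n) * z\<^sup>2)))) \<le>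
        \<theta> / real J * \<rho> z * (z\<^sup>2 * exp (- (u * z)))" if "0 < z"
    proof (rule mult_left_mono)
      show "exp (- (u * z)) * (1 - exp (- (1 / real (Suc n) * z\<^sup>2))) \<le> z\<^sup>2 * exp (- (u * z))"
        using mult_right_mono[OF le, of "exp (- (u * z))"] by (simp only: mult.commute) simp
      show "0 \<le> \<theta> / real J * \<rho> z"
        using that \<rho>_nonneg rate_pos by (intro mult_nonneg_nonneg) auto
    qed
    then show "ennreal (\<theta> / real J * \<rho> z * (exp (- (u * z)) * (1 - exp (- (1 / real (Suc n) * z\<^sup>2))))) *
        indicator {0<..} z \<le> ennreal (\<theta> / real J * \<rho> z * (z\<^sup>2 * exp (- (u * z)))) * indicator {0<..} z"
      by (rule ennreal_indicator_mono)
  qed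
  then show ?thesis
    using D_fin by (rule le_less_trans)
qed

lemma I0_fin: "I 0 u < \<infinity>"
proof -
  have "I 0 u \<le> (\<integral>\<^sup>+x\<in>{0<..}. ennreal (\<theta> * \<rho> x * (1 - exp (- (u * x)))) \<partial>lborel)"
    unfolding I_def
  proof (rule nn_integral_mono)
    fix z :: real
    have "\<theta> / real J * \<rho> z * (1 - exp (- (u * z + 0 * z\<^sup>2))) \<le> \<theta> * \<rho> z * (1 - exp (- (u * z)))" if "0 < z"
    proof -
      have "\<theta> / real J \<le> \<theta> / 1"
        using \<theta> hash.J by (intro divide_left_mono) auto
      then have "\<theta> / real J * \<rho> z * (1 - exp (- (u * z))) \<le> \<theta> * \<rho> z * (1 - exp (- (u * z)))"
        using that \<rho>_nonneg[OF that] u by (intro mult_right_mono) auto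
      then show ?thesis
        by (simp only: mult_zero_left add_0_right)
    qed
    then show "ennreal (\<theta> / real J * \<rho> z * (1 - exp (- (u * z + 0 * z\<^sup>2)))) * indicator {0<..} z \<le>
        ennreal (\<theta> * \<rho> z * (1 - exp (- (u * z)))) * indicator {0<..} z"
      by (rule ennreal_indicator_mono)
  qed
  then show ?thesis
    using laplace_exponent_finite[OF u] by (rule le_less_trans)
qed

text \<open>The averaged thinning factor gives 1 - exp (- f) = (1 - exp (- (u z + l z^2))) / J; this
  1 / J turns the rate \<theta> into \<theta> / J.\<close>

lemma mean_\<Lambda>:
  assumes l: "0 \<le> l" and fin: "I l u < \<infinity>"
  shows "(\<integral>\<^sup>+\<omega>. \<Lambda> l u \<omega> \<partial>M) = ennreal (exp (- enn2real (I l u)))"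
proof -
  have eq: "(\<integral>\<^sup>+z\<in>{0<..}. ennreal (\<theta> * \<rho> z * (1 - exp (- f l u z))) \<partial>lborel) = I l u"
    unfolding I_def
    by (rule nn_integral_cong) (simp add: indicator_def thinning_factor(1)[OF _ u l])
  show ?thesis
    unfolding \<Lambda>_def eq[symmetric]
    using thinning_factor(2)[OF _ u l] fin eq by (intro laplace_jumps) auto
qed

text \<open>Minus the derivative at l = 0 of exp (- I l u), computed along l = 1 / (n + 1). The
  means of \<open>K\<close> converge by continuity of the explicit formula, and monotonicity of
  \<open>K\<close> in n moves the supremum inside the mean.\<close>

lemma mean_SUP_K: "(\<integral>\<^sup>+\<omega>. (SUP n. K n u \<omega>) \<partial>M) = ennreal (exp (- enn2real (I 0 u))) * D u"
proof -
  have fin: "I (1 / real (Suc n)) u < \<infinity>" for n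
    unfolding I_split using I0_fin \<delta>_fin by simp
  define dr where "dr n = enn2real (\<delta> n)" for n
  have \<delta>_dr: "\<delta> n = ennreal (dr n)" for n
    using \<delta>_fin[of n] by (simp add: dr_def)
  have I_dr: "enn2real (I (1 / real (Suc n)) u) = enn2real (I 0 u) + dr n" for n
    unfolding I_split dr_def using I0_fin \<delta>_fin[of n] by (intro enn2real_plus) auto
  have mean_K: "(\<integral>\<^sup>+\<omega>. K n u \<omega> \<partial>M) =
      ennreal (exp (- enn2real (I 0 u)) * (real (Suc n) * (1 - exp (- dr n))))" for n
  proof -
    let ?l = "1 / real (Suc n)"
    have "AE \<omega> in M. \<Lambda> ?l u \<omega> \<le> \<Lambda> 0 u \<omega>"
      using AE_good
    proof eventually_elim
      case (elim \<omega>)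
      show ?case
      proof -
        have "(\<integral>\<^sup>+h. ennreal (exp (- (u * Q \<omega> h + ?l * R \<omega> h))) \<partial>H) \<le>
            (\<integral>\<^sup>+h. ennreal (exp (- (u * Q \<omega> h + 0 * R \<omega> h))) \<partial>H)"
          using R_nonneg[OF elim] by (intro nn_integral_mono ennreal_leI) simp
        moreover have "0 \<le> ?l"
          by simp
        ultimately show ?thesis
          by (simp only: hash_laplace[OF elim u] order_refl)
      qed
    qed
    then have "(\<integral>\<^sup>+\<omega>. \<Lambda> 0 u \<omega> - \<Lambda> ?l u \<omega> \<partial>M) = (\<integral>\<^sup>+\<omega>. \<Lambda> 0 u \<omega> \<partial>M) - (\<integral>\<^sup>+\<omega>. \<Lambda> ?l u \<omega> \<partial>M)"
      by (intro nn_integral_diff) (simp_all add: mean_\<Lambda>[OF _ fin] del: of_nat_Suc)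
    then have "(\<integral>\<^sup>+\<omega>. K n u \<omega> \<partial>M) = ennreal (real (Suc n)) *
        (ennreal (exp (- (enn2real (I 0 u) + 0 * (real (Suc n) * dr n)))) -
          ennreal (exp (- (enn2real (I 0 u) + 1 / real (Suc n) * (real (Suc n) * dr n)))))"
      unfolding K_def
      by (subst nn_integral_cmult) (simp_all add: mean_\<Lambda>[OF _ fin] mean_\<Lambda>[OF _ I0_fin] I_dr del: of_nat_Suc)
    also have "\<dots> = ennreal (exp (- enn2real (I 0 u)) * (real (Suc n) * (1 - exp (- (real (Suc n) * dr n / real (Suc n))))))"
      by (rule difference_quotient) (simp add: dr_def)
    finally show ?thesis
      by (simp del: of_nat_Suc)
  qed
  have "(\<lambda>n. enn2real (ennreal (real (Suc n)) * \<delta> n)) \<longlonglongrightarrow> enn2real (D u)"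
    using \<delta>_tendsto D_fin by (intro tendsto_enn2real) (simp_all add: less_top)
  then have "(\<lambda>n. real (Suc n) * dr n) \<longlonglongrightarrow> enn2real (D u)"
    by (simp add: enn2real_mult dr_def del: of_nat_Suc)
  then have "(\<lambda>n. real (Suc n) * (1 - exp (- dr n))) \<longlonglongrightarrow> enn2real (D u)"
    by (intro scaled_one_minus_exp_tendsto) (simp_all add: dr_def)
  then have "(\<lambda>n. \<integral>\<^sup>+\<omega>. K n u \<omega> \<partial>M) \<longlonglongrightarrow> ennreal (exp (- enn2real (I 0 u)) * enn2real (D u))"
    unfolding mean_K by (intro tendsto_ennrealI tendsto_mult tendsto_const)
  also have "ennreal (exp (- enn2real (I 0 u)) * enn2real (D u)) = ennreal (exp (- enn2real (I 0 u))) * D u"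
    using D_fin by (simp add: ennreal_mult')
  finally have lim: "(\<lambda>n. \<integral>\<^sup>+\<omega>. K n u \<omega> \<partial>M) \<longlonglongrightarrow> ennreal (exp (- enn2real (I 0 u))) * D u" .
  have step: "AE \<omega> in M. K n u \<omega> \<le> K (Suc n) u \<omega>" for n
    using AE_good by eventually_elim (rule incseq_SucD[OF K_good(1)[OF _ u]])
  then have "(\<integral>\<^sup>+\<omega>. (SUP n. K n u \<omega>) \<partial>M) = (SUP n. \<integral>\<^sup>+\<omega>. K n u \<omega> \<partial>M)"
    by (rule nn_integral_monotone_convergence_SUP_AE) measurable
  moreover have "incseq (\<lambda>n. \<integral>\<^sup>+\<omega>. K n u \<omega> \<partial>M)"
    using step by (intro incseq_SucI nn_integral_mono_AE)
  ultimately show ?thesis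
    using LIMSEQ_unique[OF LIMSEQ_SUP lim] by simp
qed

end

lemma mean_ratio:
  assumes D_fin: "\<And>u. 0 < u \<Longrightarrow> D u < \<infinity>"
  shows "(\<integral>\<^sup>+\<omega>. \<integral>\<^sup>+h. ennreal (ratio \<omega> h) \<partial>H \<partial>M) =
    (\<integral>\<^sup>+u\<in>{0<..}. ennreal u * (ennreal (exp (- enn2real (I 0 u))) * D u) \<partial>lborel)"
proof -
  interpret LM: pair_sigma_finite lborel M
    by unfold_locales
  have "(\<integral>\<^sup>+\<omega>. \<integral>\<^sup>+h. ennreal (ratio \<omega> h) \<partial>H \<partial>M) =
      (\<integral>\<^sup>+\<omega>. \<integral>\<^sup>+u. ennreal u * (SUP n. K n u \<omega>) * indicator {0<..} u \<partial>lborel \<partial>M)"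
    using AE_good by (intro nn_integral_cong_AE) (auto elim!: eventually_rev_mp simp: mean_ratio_hash)
  also have "\<dots> = (\<integral>\<^sup>+u. \<integral>\<^sup>+\<omega>. ennreal u * (SUP n. K n u \<omega>) * indicator {0<..} u \<partial>M \<partial>lborel)"
  proof (rule LM.Fubini')
    have "(\<lambda>z. SUP n. K n (fst z) (snd z)) \<in> borel_measurable (borel \<Otimes>\<^sub>M M)"
      by measurable
    then show "(\<lambda>(u, \<omega>). ennreal u * (SUP n. K n u \<omega>) * indicator {0<..} u) \<in> borel_measurable (lborel \<Otimes>\<^sub>M M)"
      unfolding case_prod_beta' by measurable
  qed
  also have "\<dots> = (\<integral>\<^sup>+u\<in>{0<..}. ennreal u * (ennreal (exp (- enn2real (I 0 u))) * D u) \<partial>lborel)"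
  proof (rule nn_integral_cong)
    fix u :: real
    show "(\<integral>\<^sup>+\<omega>. ennreal u * (SUP n. K n u \<omega>) * indicator {0<..} u \<partial>M) =
        ennreal u * (ennreal (exp (- enn2real (I 0 u))) * D u) * indicator {0<..} u"
    proof (cases "0 < u")
      case True
      then show ?thesis
        by (simp add: nn_integral_cmult mean_SUP_K[OF True D_fin[OF True]])
    qed simp
  qed
  finally show ?thesis .
qed

text \<open>A Bochner integral of a non-measurable function is 0 by convention, so passing to
  nonnegative integrals rests on \<open>mean_ratio_measurable\<close>; the bounds on
  \<open>ratio\<close> keep the inner mean finite.\<close>

lemma smoothed_estimator_eq:
  "smoothed_estimator M P H c j = real c * enn2real (\<integral>\<^sup>+\<omega>. \<integral>\<^sup>+h. ennreal (ratio \<omega> h) \<partial>H \<partial>M)"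
proof -
  have "(\<integral>h. ratio \<omega> h \<partial>H) = enn2real (\<integral>\<^sup>+h. ennreal (ratio \<omega> h) \<partial>H)" for \<omega>
    using ratio_bounds(1) by (intro integral_eq_nn_integral) auto
  moreover have "(\<integral>\<^sup>+h. ennreal (ratio \<omega> h) \<partial>H) \<le> (\<integral>\<^sup>+h. 1 \<partial>H)" for \<omega>
    using ratio_bounds(2) by (intro nn_integral_mono) (simp add: ennreal_le_1)
  then have "(\<integral>\<^sup>+h. ennreal (ratio \<omega> h) \<partial>H) \<noteq> \<top>" for \<omega>
    using ennreal_one_less_top by (metis hash.emeasure_space_1 leD mult_1 nn_integral_const)
  ultimately have inner: "ennreal (\<integral>h. ratio \<omega> h \<partial>H) = (\<integral>\<^sup>+h. ennreal (ratio \<omega> h) \<partial>H)" for \<omega>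
    by (simp add: less_top)
  have "smoothed_estimator M P H c j = real c * (\<integral>\<omega>. \<integral>h. ratio \<omega> h \<partial>H \<partial>M)"
    unfolding smoothed_estimator_def ratio_eq by simp
  also have "(\<integral>\<omega>. \<integral>h. ratio \<omega> h \<partial>H \<partial>M) = enn2real (\<integral>\<^sup>+\<omega>. ennreal (\<integral>h. ratio \<omega> h \<partial>H) \<partial>M)"
    using ratio_bounds(1)
    by (intro integral_eq_nn_integral mean_ratio_measurable AE_I2 Bochner_Integration.integral_nonneg)
  finally show ?thesis
    unfolding inner .
qed

end

section \<open>The estimator for the NGGP\<close>

lemma smoothed_estimator_cong:
  assumes "\<And>\<omega>. \<omega> \<in> space M \<Longrightarrow> P \<omega> = P' \<omega>"
  shows "smoothed_estimator M P H c j = smoothed_estimator M P' H c j"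
  unfolding smoothed_estimator_def using assms
  by (intro Bochner_Integration.integral_cong refl) simp

text \<open>A one-point space would be an atom of mass 1, which a diffuse \<open>G0\<close> forbids;
  this provides the second symbol.\<close>

lemma universal_hashI:
  fixes G0 :: "'a::{second_countable_topology, t2_space} measure" and H :: "('a \<Rightarrow> nat) measure"
  assumes J: "1 \<le> J" and H: "strongly_universal J H" "measurable_hash_laws H"
    and G0: "prob_space G0" "sets G0 = sets borel" "\<forall>s. emeasure G0 {s} = 0"
  shows "universal_hash H J"
proof -
  interpret G0: prob_space G0 by fact
  have "\<exists>x y :: 'a. x \<noteq> y"
  proof (rule ccontr)
    assume "\<not> (\<exists>x y :: 'a. x \<noteq> y)"
    then have "space G0 = {undefined}"
      using sets_eq_imp_space_eq[OF G0(2)] by auto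
    then show False
      using G0.emeasure_space_1 G0(3) by simp
  qed
  then show ?thesis
    using J H by (intro universal_hash.intro universal_hash_axioms.intro) (auto simp: strongly_universal_def)
qed

text \<open>Both sides are the integral over u > 0 of u exp (- I 0 u) D u: for V this is
  \<open>V_density_moment\<close> with m = 1, because \<open>I 0\<close> is the Laplace exponent of
  \<open>T\<^sub>j\<close> and \<open>D\<close> is the tilted second moment of the jumps at rate
  \<theta> / J.\<close>

lemma nggp_smoothed_estimator:
  fixes J j c :: nat and \<theta> \<alpha> \<tau> :: real
    and G0 :: "'a::{second_countable_topology, t2_space} measure"
    and M :: "'w measure" and P :: "'w \<Rightarrow> 'a measure"
    and H :: "('a \<Rightarrow> nat) measure"
    and N :: "'n measure" and \<mu>\<^sub>j :: "'n \<Rightarrow> 'a measure" and fT :: "real \<Rightarrow> ennreal"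
    and Q :: "'q measure" and V :: "'q \<Rightarrow> real"
  assumes J: "1 \<le> J" and j: "j \<in> {1..J}"
    and \<theta>: "0 < \<theta>" and \<alpha>: "0 < \<alpha>" "\<alpha> < 1" and \<tau>: "0 < \<tau>"
    and G0: "prob_space G0" "sets G0 = sets borel" "\<forall>s. emeasure G0 {s} = 0"
    and P: "NGGP M \<theta> G0 \<alpha> \<tau> P"
    and H: "strongly_universal J H" "measurable_hash_laws H"
    and T: "is_CRM N (\<theta> / real J) G0 (nggp_jump_density \<alpha> \<tau>) \<mu>\<^sub>j"
      "distributed N lborel (\<lambda>\<omega>. enn2real (total_mass \<mu>\<^sub>j \<omega>)) fT"
    and V: "prob_space Q" "distributed Q lborel V (V_density \<theta> J (nggp_jump_density \<alpha> \<tau>) fT)"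
  shows "smoothed_estimator M P H c j = real c * prob_space.expectation Q V"
proof -
  let ?\<rho> = "nggp_jump_density \<alpha> \<tau>"
  obtain \<mu> X where X: "poisson_points M (levy_intensity \<theta> G0 ?\<rho>) X"
    and \<mu>: "\<forall>\<omega>\<in>space M. \<mu> \<omega> = jump_measure X \<omega>"
    and P_eq: "\<forall>\<omega>\<in>space M. P \<omega> = scale_measure (inverse (total_mass \<mu> \<omega>)) (\<mu> \<omega>)"
    using P unfolding NGGP_def NRM_def is_CRM_def by blast
  interpret Q: prob_space Q by fact
  interpret levy_points M \<theta> G0 ?\<rho> X
    by (rule levy_points_nggp[OF X \<theta> \<alpha> \<tau> G0])
  interpret hash: universal_hash H J
    by (rule universal_hashI[OF J H G0])
  interpret HL: hashed_levy M \<theta> G0 ?\<rho> X H J j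
    by unfold_locales (rule j)
  have c: "0 < \<theta> / real J"
    using J \<theta> by simp
  have mass: "HL.I 0 u = ennreal (\<theta> / real J * (((\<tau> + u) powr \<alpha> - \<tau> powr \<alpha>) / \<alpha>))" if "0 < u" for u
    using nggp_scaled_laplace_exponent[OF c \<alpha> \<tau>, of u] that by (simp add: HL.I_def)
  have jumps: "HL.D u = ennreal (\<theta> / real J) *
      (\<integral>\<^sup>+x\<in>{0<..}. ennreal (x ^ (1 + 1) * exp (- u * x) * ?\<rho> x) \<partial>lborel)" for u
  proof -
    have "HL.D u = (\<integral>\<^sup>+x. ennreal (\<theta> / real J) *
        (ennreal (x ^ (1 + 1) * exp (- u * x) * ?\<rho> x) * indicator {0<..} x) \<partial>lborel)"
      unfolding HL.D_def
    proof (rule nn_integral_cong)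
      fix x :: real
      have "ennreal (a * ?\<rho> x * (x\<^sup>2 * exp (- (u * x)))) =
          ennreal a * ennreal (x ^ (1 + 1) * exp (- u * x) * ?\<rho> x)" if "0 \<le> a" for a
        using that by (simp add: ennreal_mult'[symmetric] power2_eq_square mult_ac)
      then show "ennreal (\<theta> / real J * ?\<rho> x * (x\<^sup>2 * exp (- (u * x)))) * indicator {0<..} x =
          ennreal (\<theta> / real J) * (ennreal (x ^ (1 + 1) * exp (- u * x) * ?\<rho> x) * indicator {0<..} x)"
        using c by (simp only: less_imp_le mult.assoc)
    qed
    then show ?thesis
      by (subst (asm) nn_integral_cmult) measurable
  qed
  have D_fin: "HL.D u < \<infinity>" if "0 < u" for u
    unfolding jumps using that \<tau> nggp_moment[OF \<alpha>, of \<tau> u 1] by (simp add: ennreal_mult_less_top)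
  have "fT \<in> borel_measurable borel"
    using distributed_borel_measurable[OF T(2)] by simp
  then have "(\<integral>\<^sup>+v. ennreal (v ^ 1) * V_density \<theta> J ?\<rho> fT v \<partial>lborel) =
      (\<integral>\<^sup>+u\<in>{0<..}. ennreal (\<theta> / real J * (u ^ 1 / fact 1)) *
        (\<integral>\<^sup>+x\<in>{0<..}. ennreal (x ^ (1 + 1) * exp (- u * x) * ?\<rho> x) \<partial>lborel) *
        (\<integral>\<^sup>+y\<in>{0<..}. ennreal (exp (- (u * y))) * fT y \<partial>lborel) \<partial>lborel)"
    using \<alpha> by (intro V_density_moment J \<theta> nggp_jump_density_nonneg) auto
  also have "\<dots> = (\<integral>\<^sup>+u\<in>{0<..}. ennreal u * (ennreal (exp (- enn2real (HL.I 0 u))) * HL.D u) \<partial>lborel)"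
  proof (rule nn_integral_cong)
    fix u :: real
    show "ennreal (\<theta> / real J * (u ^ 1 / fact 1)) *
        (\<integral>\<^sup>+x\<in>{0<..}. ennreal (x ^ (1 + 1) * exp (- u * x) * ?\<rho> x) \<partial>lborel) *
        (\<integral>\<^sup>+y\<in>{0<..}. ennreal (exp (- (u * y))) * fT y \<partial>lborel) * indicator {0<..} u =
        ennreal u * (ennreal (exp (- enn2real (HL.I 0 u))) * HL.D u) * indicator {0<..} u"
    proof (cases "0 < u")
      case u: True
      have "0 \<le> \<theta> / real J * (((\<tau> + u) powr \<alpha> - \<tau> powr \<alpha>) / \<alpha>)"
        using \<theta> u \<alpha> \<tau> by (intro mult_nonneg_nonneg divide_nonneg_nonneg) (auto intro!: powr_mono2)
      then have "(\<integral>\<^sup>+y\<in>{0<..}. ennreal (exp (- (u * y))) * fT y \<partial>lborel) =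
          ennreal (exp (- enn2real (HL.I 0 u)))"
        unfolding nggp_total_mass_laplace[OF J \<theta> \<alpha> \<tau> G0 T u] mass[OF u] by (simp only: enn2real_ennreal)
      moreover have "ennreal (\<theta> / real J * (u ^ 1 / fact 1)) = ennreal (\<theta> / real J) * ennreal u"
        using c by (simp only: ennreal_mult' power_one_right fact_1 div_by_1 less_imp_le)
      ultimately show ?thesis
        by (simp only: jumps mult_ac)
    qed simp
  qed
  also have "\<dots> = (\<integral>\<^sup>+\<omega>. \<integral>\<^sup>+h. ennreal (HL.ratio \<omega> h) \<partial>H \<partial>M)"
    by (rule HL.mean_ratio[OF D_fin, symmetric])
  finally have "(\<integral>\<^sup>+v. ennreal (v ^ 1) * V_density \<theta> J ?\<rho> fT v \<partial>lborel) =
      (\<integral>\<^sup>+\<omega>. \<integral>\<^sup>+h. ennreal (HL.ratio \<omega> h) \<partial>H \<partial>M)" .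
  moreover have "Q.expectation (\<lambda>\<omega>. V \<omega> ^ 1) =
      enn2real (\<integral>\<^sup>+v. ennreal (v ^ 1) * V_density \<theta> J ?\<rho> fT v \<partial>lborel)"
  proof (rule Q.expectation_power_distributed[OF V(2)])
    show "AE \<omega> in Q. 0 \<le> V \<omega>"
      using V_density_unit_interval[OF V(2)] by eventually_elim simp
  qed
  ultimately have "smoothed_estimator M HL.P H c j = real c * Q.expectation V"
    by (simp only: HL.smoothed_estimator_eq power_one_right)
  moreover have "P \<omega> = HL.P \<omega>" if "\<omega> \<in> space M" for \<omega>
    using P_eq \<mu> that by (simp add: HL.P_def total_mass_def)
  ultimately show ?thesis
    by (simp only: smoothed_estimator_cong[of M P HL.P])
qed

theorem mainTheorem5:
  fixes J j c :: nat and \<theta> \<alpha> \<tau> \<kappa> :: real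
    and G0 :: "'a::{second_countable_topology, t2_space} measure"
    and M :: "'w measure" and P :: "'w \<Rightarrow> 'a measure"
    and H :: "('a \<Rightarrow> nat) measure"
    and N :: "'n measure" and \<mu>\<^sub>j :: "'n \<Rightarrow> 'a measure" and fT :: "real \<Rightarrow> ennreal"
    and Q :: "'q measure" and V :: "'q \<Rightarrow> real"
    and R :: "'r measure" and B E :: "'r \<Rightarrow> real"
  defines "\<kappa> \<equiv> \<theta> * \<tau> powr \<alpha> / (real J * \<alpha>)"
  assumes J: "1 \<le> J" and j: "j \<in> {1..J}"
    and \<theta>: "0 < \<theta>" and \<alpha>: "0 < \<alpha>" "\<alpha> < 1" and \<tau>: "0 < \<tau>"
    and G0: "prob_space G0" "sets G0 = sets borel" "\<forall>s. emeasure G0 {s} = 0"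
    and P: "NGGP M \<theta> G0 \<alpha> \<tau> P"
    and H: "strongly_universal J H" "measurable_hash_laws H"
    and T\<^sub>j: "is_CRM N (\<theta> / real J) G0 (nggp_jump_density \<alpha> \<tau>) \<mu>\<^sub>j"
      "distributed N lborel (\<lambda>\<omega>. enn2real (total_mass \<mu>\<^sub>j \<omega>)) fT"
    and V: "prob_space Q" "distributed Q lborel V (V_density \<theta> J (nggp_jump_density \<alpha> \<tau>) fT)"
    and BE: "prob_space R" "distributed R lborel B (beta_density (1 - \<alpha>) \<alpha>)"
      "distributed R lborel E (exponential_density 1)" "prob_space.indep_var R borel B borel E"
  shows "distr Q borel V =
           distr R borel (\<lambda>\<omega>. B \<omega> * (1 - (\<kappa> / (\<kappa> + E \<omega>)) powr (1 / \<alpha>))) \<and>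
         smoothed_estimator M P H c j = real c * prob_space.expectation Q V \<and>
         real c * prob_space.expectation Q V =
           real c * (1 - \<alpha>) * (1 - \<kappa> * exp \<kappa> * exp_integral (1 / \<alpha>) \<kappa>)"
proof (intro conjI)
  show "distr Q borel V = distr R borel (\<lambda>\<omega>. B \<omega> * (1 - (\<kappa> / (\<kappa> + E \<omega>)) powr (1 / \<alpha>)))"
    unfolding \<kappa>_def by (rule nggp_V_law(1)[OF J \<theta> \<alpha> \<tau> G0 T\<^sub>j V BE])
  show "smoothed_estimator M P H c j = real c * prob_space.expectation Q V"
    by (rule nggp_smoothed_estimator[OF J j \<theta> \<alpha> \<tau> G0 P H T\<^sub>j V])
  show "real c * prob_space.expectation Q V =
      real c * (1 - \<alpha>) * (1 - \<kappa> * exp \<kappa> * exp_integral (1 / \<alpha>) \<kappa>)"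
    unfolding \<kappa>_def nggp_V_law(2)[OF J \<theta> \<alpha> \<tau> G0 T\<^sub>j V BE] by simp
qed

end
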